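(* Let $\Omega=B\setminus E$, $E=\bigcup_{k=1}^\infty \overline{B}(x_k,r_k)$, be a champagne subregion of the unit disc $B\subset\mathbb{R}^2$. (a) If $E$ is unavoidable, then $$\sum_k \frac{(1-|x_k|)^2}{|y-x_k|^2}\left\{\log\frac{1-|x_k|}{r_k}\right\}^{-1}=\infty\quad\text{for }\sigma\text{-almost every }y\in\partial B.\qquad( * )$$ In particular, $$\sum_k \frac{(1-|x_k|)^2}{|y-x_k|^2}=\infty\quad\text{for }\sigma\text{-almost every }y\in\partial B.$$ (b) Conversely, if $( * )$ holds together with the separation condition $$\inf_{j\neq k}\frac{|x_k-x_j|\left\{\log\frac{1-|x_k|}{r_k}\right\}^{1/2}}{1-|x_k|}>0,$$ then $E$ is unavoidable.
   Context: $B(x,r)$ denotes the open disc in $\mathbb{R}^2$ of centre $x$ and radius $r>0$, and $B=B(0,1)$. Let $(\overline{B}(x_k,r_k))_{k\ge 1}$ be a sequence of pairwise disjoint closed discs, with $x_k\in B$ and $r_k>0$, such that $|x_k|\to 1$ and $\sup_k r_k/(1-|x_k|)<1$. Put $E=\bigcup_{k=1}^\infty\overline{B}(x_k,r_k)$. The set $\Omega=B\setminus E$ is called a champagne subregion of the unit disc; it is assumed throughout that $0\in\Omega$. The set $E$ is called unavoidable if it carries full harmonic measure with respect to $\Omega$, that is, the harmonic measure of $\partial B$ relative to $\Omega$ is zero. $\sigma$ denotes normalised arclength measure on $\partial B$. *)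

theory Defs
  imports "HOL-Probability.Probability"
begin

text \<open>The plane is identified with the type of complex numbers.\<close>

text \<open>Normalised arclength on the unit circle, as a Borel probability measure on the
  plane concentrated on the circle.\<close>

definition circle_measure :: "complex measure" where
  "circle_measure = distr (uniform_measure lborel {0..2 * pi}) borel cis"

text \<open>The integral of an extended real valued function is the integral of its positive
  part minus that of its negative part (\<^const>\<open>e2ennreal\<close> sends negative values to 0).
  It is only used for lower semicontinuous functions with values in \<open>(-\<infinity>, \<infinity>]\<close>, whose
  negative part is bounded on circles.\<close>

definition circle_mean :: "(complex \<Rightarrow> ereal) \<Rightarrow> complex \<Rightarrow> real \<Rightarrow> ereal" where
  "circle_mean u z \<rho> =
     enn2ereal (\<integral>\<^sup>+ y. e2ennreal (u (z + of_real \<rho> * y)) \<partial>circle_measure) -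
     enn2ereal (\<integral>\<^sup>+ y. e2ennreal (- u (z + of_real \<rho> * y)) \<partial>circle_measure)"

text \<open>Hyperharmonic functions on an open set: superharmonic functions, except that the
  value \<open>\<infinity>\<close> is allowed identically on components.\<close>

definition hyperharmonic_on :: "complex set \<Rightarrow> (complex \<Rightarrow> ereal) \<Rightarrow> bool" where
  "hyperharmonic_on \<Omega> u \<longleftrightarrow>
     (\<forall>z\<in>\<Omega>. u z \<noteq> -\<infinity>) \<and>
     (\<forall>z\<in>\<Omega>. u z \<le> Liminf (at z within \<Omega>) u) \<and>
     (\<forall>z \<rho>. 0 < \<rho> \<longrightarrow> cball z \<rho> \<subseteq> \<Omega> \<longrightarrow> circle_mean u z \<rho> \<le> u z)"

text \<open>The upper class and the upper solution of the Dirichlet problem in the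
  Perron--Wiener--Brelot method, for a bounded open set and boundary data \<open>f\<close>.\<close>

definition upper_class :: "complex set \<Rightarrow> (complex \<Rightarrow> ereal) \<Rightarrow> (complex \<Rightarrow> ereal) set" where
  "upper_class \<Omega> f =
     {u. hyperharmonic_on \<Omega> u \<and>
         (\<exists>c::real. \<forall>z\<in>\<Omega>. ereal c \<le> u z) \<and>
         (\<forall>y\<in>frontier \<Omega>. f y \<le> Liminf (at y within \<Omega>) u)}"

definition upper_solution :: "complex set \<Rightarrow> (complex \<Rightarrow> ereal) \<Rightarrow> complex \<Rightarrow> ereal" where
  "upper_solution \<Omega> f z = (INF u\<in>upper_class \<Omega> f. u z)"

text \<open>Harmonic measure at \<open>z\<close> of a Borel set \<open>A\<close> of boundary points of the bounded open set
  \<open>\<Omega>\<close> is the solution of the Dirichlet problem with boundary data the indicator of \<open>A\<close>.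
  Bounded Borel data are resolutive, so the upper solution is the solution. The lower
  solution lies between 0 and the upper one, so for harmonic measure zero no appeal to
  resolutivity is needed.\<close>

definition harmonic_measure :: "complex set \<Rightarrow> complex \<Rightarrow> complex set \<Rightarrow> ereal" where
  "harmonic_measure \<Omega> z A = upper_solution \<Omega> (\<lambda>y. ereal (indicator A y)) z"

definition bubbles :: "(nat \<Rightarrow> complex) \<Rightarrow> (nat \<Rightarrow> real) \<Rightarrow> complex set" where
  "bubbles x r = (\<Union>k. cball (x k) (r k))"

text \<open>The supremum is taken in the extended reals, where it is always meaningful; over the
  reals it would be unspecified for unbounded families.\<close>

definition champagne :: "(nat \<Rightarrow> complex) \<Rightarrow> (nat \<Rightarrow> real) \<Rightarrow> bool" where
  "champagne x r \<longleftrightarrow>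
     disjoint_family (\<lambda>k. cball (x k) (r k)) \<and>
     (\<forall>k. x k \<in> ball 0 1 \<and> 0 < r k) \<and>
     (\<lambda>k. cmod (x k)) \<longlonglongrightarrow> 1 \<and>
     (SUP k. ereal (r k / (1 - cmod (x k)))) < 1 \<and>
     0 \<in> ball 0 1 - bubbles x r"

definition unavoidable :: "complex set \<Rightarrow> bool" where
  "unavoidable E \<longleftrightarrow>
     (\<forall>z\<in>ball 0 1 - E. harmonic_measure (ball 0 1 - E) z (sphere 0 1) = 0)"

end

theory Submission
  imports Defs "HOL-Complex_Analysis.Complex_Analysis"
begin

text \<open>
  For part (a) suppose that the series is finite on a set \<open>A\<close> of positive measure. Let \<open>h\<close> be the
  harmonic measure of \<open>A\<close> in the disc and subtract from it a constant times the sum over \<open>k \<ge> N\<close>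
  of \<open>h (x k)\<close> times the truncated Green function with pole \<open>x k\<close>, normalised to be 1 on the bubble.
  By Harnack's inequality the difference \<open>w\<close> is nonpositive on these bubbles; it is subharmonic,
  and positive at 0 when \<open>N\<close> is large. If the bubbles were unavoidable, then \<open>w\<close> would be bounded
  by its maximum on the first \<open>N\<close> bubbles, against the strong maximum principle.

  For part (b) it suffices to find, for a fixed \<open>c > 0\<close> and every point \<open>z\<close>, a finite sum of
  Green functions \<open>\<le> 1\<close> off the bubbles, with poles at centres, whose value at \<open>z\<close> is at least
  \<open>c\<close>: functions \<open>1 - u\<close> of this kind can be glued along circles close to the boundary, which
  multiplies the probability of escape by a factor \<open>1 - c / 2\<close> in each step. By the separation
  condition the series still diverges almost everywhere when it is restricted to dyadic
  nontangential regions. Stopping these sums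
  when they exceed 1 selects centres whose masses \<open>(1 - |x k|) / log ((1 - |x k|) / r k)\<close> form a
  Carleson measure of total mass comparable to \<open>1 - |z|\<close> near \<open>z\<close>. The Carleson condition bounds the
  Green potential away from the pole, and the area of the disjoint discs provided by the separation
  condition bounds it nearby.
\<close>

subsection \<open>Means over circles\<close>

text \<open>Members of the upper class are extended valued and only lower semicontinuous, so every
  comparison with them goes through one minimum principle against a continuous minorant. The Green
  functions are truncated at two different levels, for opposite reasons. In part (a) the truncation
  covers the bubble, because the potential has to dominate \<open>h\<close> on all of it. In part
  (b) it takes place inside the bubble, because \<open>1 - u\<close> has to be superharmonic on the
  whole complement of the bubbles. Since the ratios of radius to distance from the circle stay below
  some \<open>c < 1\<close>, the logarithms stay away from 0, and this makes the two levels
  comparable. In part (b) the sum of all Green functions diverges together with the series, so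
  finite subfamilies have to be selected whose potentials have a bound independent of
  \<open>z\<close>. The stopping rule provides this: the selected sums are below 1 before the last
  generation, the separation condition bounds what the last generation adds, and reaching 1 almost
  everywhere gives the mass from below.\<close>

definition angle_measure :: "real measure" where
  "angle_measure = uniform_measure lborel {0..2 * pi}"

definition cmean :: "(complex \<Rightarrow> real) \<Rightarrow> complex \<Rightarrow> real \<Rightarrow> real" where
  "cmean f z \<rho> = (LINT t|angle_measure. f (z + of_real \<rho> * cis t))"

lemma sets_angle_measure [simp, measurable_cong]: "sets angle_measure = sets borel"
  by (simp add: angle_measure_def)

lemma space_angle_measure [simp]: "space angle_measure = UNIV"
  by (simp add: angle_measure_def)

lemma prob_space_angle_measure: "prob_space angle_measure"
  unfolding angle_measure_def by (rule prob_space_uniform_measure) auto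

interpretation angle: prob_space angle_measure
  by (rule prob_space_angle_measure)

lemma measurable_cis [measurable]: "cis \<in> borel_measurable borel"
  by (intro borel_measurable_continuous_onI continuous_intros)

lemma circle_measure_eq: "circle_measure = distr angle_measure borel cis"
  by (simp add: circle_measure_def angle_measure_def)

lemma AE_angle_measure: "AE t in angle_measure. 0 \<le> t \<and> t < 2 * pi"
proof -
  have "AE t in lborel. t \<noteq> 2 * pi"
    by (rule AE_lborel_singleton)
  then show ?thesis
    unfolding angle_measure_def by (intro AE_uniform_measureI) auto
qed

lemma emeasure_angle_measure:
  assumes "A \<in> sets borel"
  shows "emeasure angle_measure A = emeasure lborel ({0..2 * pi} \<inter> A) / ennreal (2 * pi)"
  unfolding angle_measure_def using assms by (subst emeasure_uniform_measure) auto

lemma lint_angle_measure: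
  fixes f :: "real \<Rightarrow> real"
  assumes "continuous_on {0..2 * pi} f" "f \<in> borel_measurable borel"
  shows "(LINT t|angle_measure. f t) = integral {0..2 * pi} f / (2 * pi)"
proof -
  have eq: "indicator {0..2*pi} t / ennreal (2*pi) = ennreal (indicator {0..2*pi} t / (2*pi))" for t::real
    by (auto simp: indicator_def divide_ennreal ennreal_1[symmetric] simp del: ennreal_1)
  have "(LINT t|angle_measure. f t) = (LINT t|lborel. (indicator {0..2*pi} t / (2*pi)) *\<^sub>R f t)"
    unfolding angle_measure_def uniform_measure_def
    using assms(2) by (simp add: eq integral_density)
  also have "\<dots> = (LINT t|lborel. indicator {0..2*pi} t *\<^sub>R f t) / (2*pi)"
    by (simp add: divide_simps flip: integral_divide_zero)
  also have "(LINT t|lborel. indicator {0..2*pi} t *\<^sub>R f t) = integral {0..2*pi} f"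
    using set_borel_integral_eq_integral(2)[OF borel_integrable_atLeastAtMost'[OF assms(1)]]
    by (simp add: set_lebesgue_integral_def)
  finally show ?thesis .
qed

lemma continuous_on_circle_param:
  assumes "continuous_on (sphere z \<rho>) f" "0 \<le> \<rho>"
  shows "continuous_on A (\<lambda>t. f (z + of_real \<rho> * cis t))"
proof (rule continuous_on_compose2[OF assms(1)])
  show "continuous_on A (\<lambda>t. z + of_real \<rho> * cis t)"
    by (intro continuous_intros)
  show "(\<lambda>t. z + of_real \<rho> * cis t) ` A \<subseteq> sphere z \<rho>"
    using assms(2) by (auto simp: dist_norm norm_mult)
qed

lemma borel_measurable_circle_param:
  fixes f :: "complex \<Rightarrow> real"
  assumes "continuous_on (sphere z \<rho>) f" "0 \<le> \<rho>"
  shows "(\<lambda>t. f (z + of_real \<rho> * cis t)) \<in> borel_measurable borel"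
  by (rule borel_measurable_continuous_onI, rule continuous_on_circle_param[OF assms])

lemma integrable_circle_param:
  fixes f :: "complex \<Rightarrow> real"
  assumes "continuous_on (sphere z \<rho>) f" "0 \<le> \<rho>"
  shows "integrable angle_measure (\<lambda>t. f (z + of_real \<rho> * cis t))"
proof -
  have "compact (f ` sphere z \<rho>)"
    using assms by (intro compact_continuous_image) auto
  then obtain B where "\<And>y. y \<in> f ` sphere z \<rho> \<Longrightarrow> norm y \<le> B"
    using compact_imp_bounded bounded_iff by metis
  then have "norm (f (z + of_real \<rho> * cis t)) \<le> B" for t
    using assms(2) by (auto simp: dist_norm norm_mult)
  then show ?thesis
    using borel_measurable_circle_param[OF assms]
    by (intro angle.integrable_const_bound[where B=B]) (auto cong: measurable_cong_sets)
qed

lemma cmean_const [simp]: "cmean (\<lambda>_. c) z \<rho> = c"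
  using angle.prob_space by (simp add: cmean_def)

lemma cmean_mult: "cmean (\<lambda>y. c * f y) z \<rho> = c * cmean f z \<rho>"
  by (simp add: cmean_def)

lemma cmean_add:
  assumes "continuous_on (sphere z \<rho>) f" "continuous_on (sphere z \<rho>) g" "0 \<le> \<rho>"
  shows "cmean (\<lambda>y. f y + g y) z \<rho> = cmean f z \<rho> + cmean g z \<rho>"
  unfolding cmean_def by (intro Bochner_Integration.integral_add integrable_circle_param assms)

lemma cmean_diff:
  assumes "continuous_on (sphere z \<rho>) f" "continuous_on (sphere z \<rho>) g" "0 \<le> \<rho>"
  shows "cmean (\<lambda>y. f y - g y) z \<rho> = cmean f z \<rho> - cmean g z \<rho>"
  unfolding cmean_def by (intro Bochner_Integration.integral_diff integrable_circle_param assms)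

lemma cmean_sum:
  assumes "\<And>i. i \<in> I \<Longrightarrow> continuous_on (sphere z \<rho>) (f i)" "0 \<le> \<rho>"
  shows "cmean (\<lambda>y. \<Sum>i\<in>I. f i y) z \<rho> = (\<Sum>i\<in>I. cmean (f i) z \<rho>)"
  unfolding cmean_def by (intro Bochner_Integration.integral_sum integrable_circle_param assms)

lemma cmean_mono:
  assumes "continuous_on (sphere z \<rho>) f" "continuous_on (sphere z \<rho>) g" "0 \<le> \<rho>"
    and "\<And>y. y \<in> sphere z \<rho> \<Longrightarrow> f y \<le> g y"
  shows "cmean f z \<rho> \<le> cmean g z \<rho>"
  unfolding cmean_def using assms(3)
  by (intro integral_mono integrable_circle_param assms) (auto simp: dist_norm norm_mult)

lemma cmean_cong:
  assumes "0 \<le> \<rho>" "\<And>y. y \<in> sphere z \<rho> \<Longrightarrow> f y = g y"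
  shows "cmean f z \<rho> = cmean g z \<rho>"
  unfolding cmean_def using assms
  by (intro Bochner_Integration.integral_cong refl) (auto simp: dist_norm norm_mult)

lemma cmean_eq_integral:
  assumes "continuous_on (sphere z \<rho>) f" "0 \<le> \<rho>"
  shows "cmean f z \<rho> = integral {0..2 * pi} (\<lambda>t. f (z + of_real \<rho> * cis t)) / (2 * pi)"
  unfolding cmean_def
  by (intro lint_angle_measure continuous_on_circle_param borel_measurable_circle_param assms)

lemma cmean_nonneg_eq_0:
  assumes f: "continuous_on (sphere z \<rho>) f" and \<rho>: "0 \<le> \<rho>"
    and nn: "\<And>y. y \<in> sphere z \<rho> \<Longrightarrow> 0 \<le> f y"
    and le: "cmean f z \<rho> \<le> 0" and y: "y \<in> sphere z \<rho>"
  shows "f y = 0"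
proof -
  let ?g = "\<lambda>t. f (z + of_real \<rho> * cis t)"
  have cont: "continuous_on {0..2*pi} ?g"
    by (rule continuous_on_circle_param[OF f \<rho>])
  have ge: "?g t \<ge> 0" for t
    using nn \<rho> by (auto simp: dist_norm norm_mult)
  have "0 \<le> integral {0..2*pi} ?g"
    by (intro integral_nonneg integrable_continuous_real cont ge)
  moreover have "integral {0..2*pi} ?g \<le> 0"
    using le pi_not_less_zero pi_gt_zero leD[of pi 0] by (auto simp add: cmean_eq_integral[OF f \<rho>] divide_le_0_iff)
  ultimately have "integral {0..2*pi} ?g = 0" by linarith
  then have z: "\<forall>t\<in>{0..2*pi}. ?g t = 0"
    using integral_eq_0_iff[OF cont] ge by simp
  obtain t where t: "0 \<le> t" "t < 2*pi" "y - z = of_real \<rho> * cis t"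
  proof -
    have "y - z = of_real \<rho> * cis (Arg2pi (y - z))"
      using Arg2pi_eq[of "y - z"] y by (simp add: dist_norm norm_minus_commute cis_conv_exp)
    then show thesis using that Arg2pi_ge_0[of "y - z"] Arg2pi_lt_2pi[of "y - z"] by blast
  qed
  then have "y = z + of_real \<rho> * cis t" by (simp add: algebra_simps)
  then show ?thesis using z t by auto
qed

text \<open>All mean value equalities below rest on this one: harmonic functions occur only as real
  parts of holomorphic functions, at least locally, so Cauchy's formula is enough.\<close>

lemma cmean_Re_holomorphic:
  assumes f: "f holomorphic_on cball z \<rho>" and \<rho>: "0 < \<rho>"
  shows "cmean (\<lambda>y. Re (f y)) z \<rho> = Re (f z)"
proof -
  have cont: "continuous_on (sphere z \<rho>) f"
    using holomorphic_on_imp_continuous_on[OF f] continuous_on_subset by (metis sphere_cball)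
  have "((\<lambda>u. f u / (u - z)) has_contour_integral (2 * of_real pi * \<i> * f z)) (circlepath z \<rho>)"
    using \<rho> by (intro Cauchy_integral_circlepath_simple f) auto
  then have "((\<lambda>t. f (z + of_real \<rho> * cis t) / (of_real \<rho> * cis t) * of_real \<rho> * \<i> * cis t) has_integral
      (2 * of_real pi * \<i> * f z)) {0..2*pi}"
    unfolding circlepath_def by (subst (asm) has_contour_integral_part_circlepath_iff) auto
  then have "((\<lambda>t. \<i> * f (z + of_real \<rho> * cis t)) has_integral
      (2 * of_real pi * \<i> * f z)) {0..2*pi}"
    using \<rho> by (simp add: field_simps)
  then have "((\<lambda>t. (- \<i>) * (\<i> * f (z + of_real \<rho> * cis t))) has_integral
      ((-\<i>) * (2 * of_real pi * \<i> * f z))) {0..2*pi}"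
    by (rule has_integral_mult_right)
  then have "((\<lambda>t. f (z + of_real \<rho> * cis t)) has_integral
      (2 * of_real pi * f z)) {0..2*pi}"
    by (simp add: algebra_simps)
  then have "((\<lambda>t. Re (f (z + of_real \<rho> * cis t))) has_integral
      (Re (2 * of_real pi * f z))) {0..2*pi}"
    using has_integral_Re by blast
  then have "integral {0..2*pi} (\<lambda>t. Re (f (z + of_real \<rho> * cis t))) = 2 * pi * Re (f z)"
    by (simp add: integral_unique)
  moreover have "continuous_on (sphere z \<rho>) (\<lambda>y. Re (f y))"
    by (intro continuous_intros cont)
  ultimately show ?thesis
    using \<rho> by (subst cmean_eq_integral) auto
qed

text \<open>\<^const>\<open>circle_mean\<close> integrates the positive and negative parts separately; for a continuous
  real function this is the mean \<^const>\<open>cmean\<close>, and a lower bound needs no measurability.\<close>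

lemma nn_integral_circle_measure:
  assumes [measurable]: "f \<in> borel_measurable borel"
  shows "(\<integral>\<^sup>+ y. f y \<partial>circle_measure) = (\<integral>\<^sup>+ t. f (cis t) \<partial>angle_measure)"
  unfolding circle_measure_eq by (intro nn_integral_distr) auto

lemma AE_circle_measure_sphere: "AE y in circle_measure. cmod y = 1"
  unfolding circle_measure_eq by (subst AE_distr_iff) auto

lemma circle_mean_ereal:
  assumes \<rho>: "0 \<le> \<rho>" and \<phi>: "continuous_on (sphere z \<rho>) \<phi>"
  shows "circle_mean (\<lambda>y. ereal (\<phi> y)) z \<rho> = ereal (cmean \<phi> z \<rho>)"
proof -
  let ?g = "\<lambda>t. \<phi> (z + of_real \<rho> * cis t)"
  have int: "integrable angle_measure ?g"
    by (rule integrable_circle_param[OF \<phi> \<rho>])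
  have eq: "(\<integral>\<^sup>+ y. ennreal (s * \<phi> (z + of_real \<rho> * y)) \<partial>circle_measure)
      = (\<integral>\<^sup>+ t. ennreal (s * ?g t) \<partial>angle_measure)" for s
  proof -
    \<comment> \<open>Passing to the image measure needs a Borel function on the plane, while
      \<open>\<phi>\<close> is only known to be continuous on the circle. The indicator cuts it off
      there.\<close>
    define h where "h = (\<lambda>y. indicator (sphere 0 1) y *\<^sub>R (s * \<phi> (z + of_real \<rho> * y)))"
    have "continuous_on (sphere 0 1) (\<lambda>y. \<phi> (z + of_real \<rho> * y))"
    proof (rule continuous_on_compose2[OF \<phi>])
      show "continuous_on (sphere 0 1) (\<lambda>y. z + of_real \<rho> * y)"
        by (intro continuous_intros)
      show "(\<lambda>y. z + of_real \<rho> * y) ` sphere 0 1 \<subseteq> sphere z \<rho>"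
        using \<rho> by (auto simp: dist_norm norm_mult)
    qed
    then have "continuous_on (sphere 0 1) (\<lambda>y. s * \<phi> (z + of_real \<rho> * y))"
      by (intro continuous_intros)
    then have m: "h \<in> borel_measurable borel"
      unfolding h_def by (intro borel_measurable_continuous_on_indicator) auto
    have "(\<integral>\<^sup>+ y. ennreal (s * \<phi> (z + of_real \<rho> * y)) \<partial>circle_measure)
        = (\<integral>\<^sup>+ y. ennreal (h y) \<partial>circle_measure)"
      by (intro nn_integral_cong_AE eventually_mono[OF AE_circle_measure_sphere]) (auto simp: h_def)
    also have "\<dots> = (\<integral>\<^sup>+ t. ennreal (h (cis t)) \<partial>angle_measure)"
      using m by (intro nn_integral_circle_measure) auto
    also have "\<dots> = (\<integral>\<^sup>+ t. ennreal (s * ?g t) \<partial>angle_measure)"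
      by (simp add: h_def)
    finally show ?thesis .
  qed
  have fin: "(\<integral>\<^sup>+ t. ennreal (?g t) \<partial>angle_measure) \<noteq> \<infinity>" "(\<integral>\<^sup>+ t. ennreal (- ?g t) \<partial>angle_measure) \<noteq> \<infinity>"
    using real_integrable_def int by blast+
  show ?thesis
    unfolding circle_mean_def cmean_def real_lebesgue_integral_def[OF int]
    using eq[of 1] eq[of "-1"] fin
    by (cases "\<integral>\<^sup>+ t. ennreal (?g t) \<partial>angle_measure"; cases "\<integral>\<^sup>+ t. ennreal (- ?g t) \<partial>angle_measure")
       (simp_all add: e2ennreal_ereal enn2ereal_ennreal)
qed

lemma circle_mean_ge:
  assumes \<rho>: "0 \<le> \<rho>" and \<phi>: "continuous_on (sphere z \<rho>) \<phi>"
    and le: "\<And>y. y \<in> sphere z \<rho> \<Longrightarrow> ereal (\<phi> y) \<le> v y"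
  shows "ereal (cmean \<phi> z \<rho>) \<le> circle_mean v z \<rho>"
proof -
  have le': "AE y in circle_measure. ereal (\<phi> (z + of_real \<rho> * y)) \<le> v (z + of_real \<rho> * y)"
    using AE_circle_measure_sphere
    by (rule eventually_mono) (use \<rho> in \<open>auto intro!: le simp: dist_norm norm_mult\<close>)
  have "circle_mean (\<lambda>y. ereal (\<phi> y)) z \<rho> \<le> circle_mean v z \<rho>"
    unfolding circle_mean_def
  proof (intro ereal_minus_mono)
    show "enn2ereal (\<integral>\<^sup>+ y. e2ennreal (ereal (\<phi> (z + of_real \<rho> * y))) \<partial>circle_measure)
        \<le> enn2ereal (\<integral>\<^sup>+ y. e2ennreal (v (z + of_real \<rho> * y)) \<partial>circle_measure)"
      unfolding less_eq_ennreal.rep_eq[symmetric]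
      by (intro nn_integral_mono_AE eventually_mono[OF le']) (metis e2ennreal_mono)
    show "enn2ereal (\<integral>\<^sup>+ y. e2ennreal (- v (z + of_real \<rho> * y)) \<partial>circle_measure)
        \<le> enn2ereal (\<integral>\<^sup>+ y. e2ennreal (- ereal (\<phi> (z + of_real \<rho> * y))) \<partial>circle_measure)"
      unfolding less_eq_ennreal.rep_eq[symmetric]
      by (intro nn_integral_mono_AE eventually_mono[OF le'] e2ennreal_mono) (simp only: ereal_minus_le_minus)
  qed
  then show ?thesis
    by (simp add: circle_mean_ereal[OF \<rho> \<phi>])
qed


subsection \<open>The minimum principle\<close>

definition superharmonic_at :: "(complex \<Rightarrow> real) \<Rightarrow> complex \<Rightarrow> bool" where
  "superharmonic_at f z \<longleftrightarrow> (\<forall>\<^sub>F \<rho> in at_right 0. cmean f z \<rho> \<le> f z)"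

lemma continuous_on_sphere_in_ball:
  assumes "continuous_on (ball 0 1) f" "cball z \<rho> \<subseteq> ball 0 1"
  shows "continuous_on (sphere z \<rho>) f"
  using assms sphere_cball continuous_on_subset by blast

lemma continuous_on_unit_ball:
  fixes f :: "complex \<Rightarrow> real"
  assumes "\<And>R. R < 1 \<Longrightarrow> continuous_on (cball 0 R) f"
  shows "continuous_on (ball 0 1) f"
  unfolding continuous_on_eq_continuous_at[OF open_ball]
proof
  fix z :: complex assume z: "z \<in> ball 0 1"
  define R where "R = (1 + cmod z) / 2"
  have "R < 1" "z \<in> interior (cball 0 R)" using z by (auto simp: R_def interior_cball)
  then show "isCont f z" using continuous_on_interior[OF assms] by blast
qed

lemma cball_in_unit_ball:
  fixes z :: complex
  assumes "cball z \<rho> \<subseteq> ball 0 1" "0 < \<rho>"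
  obtains R where "R < 1" "\<And>y. y \<in> cball z \<rho> \<Longrightarrow> cmod y \<le> R"
proof -
  have "compact (cmod ` cball z \<rho>)" by (intro compact_continuous_image continuous_intros) auto
  moreover have "cmod ` cball z \<rho> \<noteq> {}" using assms by auto
  ultimately obtain b where "b \<in> cball z \<rho>" "\<And>y. y \<in> cball z \<rho> \<Longrightarrow> cmod y \<le> cmod b"
    using compact_attains_sup[of "cmod ` cball z \<rho>"] by auto
  then show thesis using that[of "cmod b"] assms(1) by auto
qed

text \<open>Turns a failure of almost everywhere divergence into a uniform bound on a set of
  positive measure: otherwise the countably many sublevel sets would all be null.\<close>

lemma ex_positive_sublevel:
  fixes f :: "'a \<Rightarrow> ennreal"
  assumes [measurable]: "f \<in> borel_measurable M" and nAE: "\<not> (AE t in M. f t = \<infinity>)"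
  obtains n :: nat where "emeasure M {t \<in> space M. f t \<le> of_nat n} \<noteq> 0"
proof (rule ccontr)
  assume "\<not> thesis"
  then have "{t \<in> space M. f t \<le> of_nat n} \<in> null_sets M" for n :: nat
    using that by (auto intro!: null_setsI)
  then have "AE t in M. \<forall>n::nat. t \<notin> {t \<in> space M. f t \<le> of_nat n}"
    unfolding AE_all_countable by (intro allI AE_not_in)
  with AE_space have "AE t in M. f t = \<infinity>"
  proof eventually_elim
    case (elim t)
    show ?case
    proof (rule ccontr)
      assume "f t \<noteq> \<infinity>"
      then obtain n :: nat where "f t < of_nat n"
        using ennreal_Ex_less_of_nat less_top by (metis infinity_ennreal_def)
      then show False using elim less_imp_le[of "f t" "of_nat n"] by simp
    qed
  qed
  then show False using nAE by simp
qed

lemma eventually_cball_subset: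
  fixes z :: complex
  assumes "open S" "z \<in> S"
  shows "\<forall>\<^sub>F \<rho> in at_right 0. 0 < \<rho> \<and> cball z \<rho> \<subseteq> S"
proof -
  obtain e where "e > 0" "cball z e \<subseteq> S"
    using assms open_contains_cball by blast
  then show ?thesis
    unfolding eventually_at_right_field by (intro exI[of _ e]) (auto simp: subset_iff)
qed

text \<open>Among the points where \<open>v - w\<close> attains a negative minimum take one with the largest real
  part: on a small circle around it \<open>v - w\<close> exceeds the minimum somewhere. Adding a continuous
  bump there contradicts the mean value inequalities without any measurability of \<open>v\<close>.\<close>

lemma hyperharmonic_minimum_principle:
  fixes v :: "complex \<Rightarrow> ereal" and w :: "complex \<Rightarrow> real"
  assumes \<Omega>: "open \<Omega>" "bounded \<Omega>"
    and lsc: "\<And>z. z \<in> \<Omega> \<Longrightarrow> v z \<le> Liminf (at z within \<Omega>) v"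
    and fin: "\<And>z. z \<in> \<Omega> \<Longrightarrow> v z \<noteq> -\<infinity>"
    and mean: "\<And>z. z \<in> \<Omega> \<Longrightarrow> \<forall>\<^sub>F \<rho> in at_right 0. circle_mean v z \<rho> \<le> v z"
    and w: "continuous_on \<Omega> w"
    and mean_w: "\<And>z. z \<in> \<Omega> \<Longrightarrow> \<forall>\<^sub>F \<rho> in at_right 0. w z \<le> cmean w z \<rho>"
    and bd: "\<And>y \<epsilon>. y \<in> frontier \<Omega> \<Longrightarrow> 0 < \<epsilon> \<Longrightarrow> \<forall>\<^sub>F z in at y within \<Omega>. ereal (w z - \<epsilon>) \<le> v z"
    and z: "z \<in> \<Omega>"
  shows "ereal (w z) \<le> v z"
proof (rule ccontr)
  assume "\<not> ereal (w z) \<le> v z"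
  then have vz: "v z < ereal (w z)" by simp
  define S where "S a = {z\<in>\<Omega>. v z \<le> ereal (w z + a)}" for a :: real
  have within: "at y within \<Omega> = at y" if "y \<in> \<Omega>" for y
    using that \<Omega>(1) by (rule at_within_open)
  have lsc': "\<forall>\<^sub>F x in nhds y. b < v x" if "y \<in> \<Omega>" "b < v y" for y b
  proof -
    have "\<forall>\<^sub>F x in at y. b < v x"
      using lsc[OF that(1)] that(2) unfolding le_Liminf_iff within[OF that(1)] by blast
    then have "\<forall>\<^sub>F x in nhds y. x \<noteq> y \<longrightarrow> b < v x"
      by (simp add: eventually_at_filter)
    then show ?thesis by (rule eventually_mono) (use that in metis)
  qed
  have w': "\<forall>\<^sub>F x in nhds y. w x < b" if "y \<in> \<Omega>" "w y < b" for y b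
  proof -
    have "(w \<longlongrightarrow> w y) (nhds y)"
      using w that(1) \<Omega>(1) by (simp add: continuous_on_eq_continuous_at isCont_def tendsto_nhds_iff)
    then show ?thesis using that(2) by (rule order_tendstoD(2))
  qed
  \<comment> \<open>The boundary condition \<open>bd\<close> keeps limit points of
    \<open>S a\<close> off the frontier when the level is negative; inside, closedness is lower
    semicontinuity of \<open>v - w\<close>.\<close>
  have compact: "compact (S a)" if a: "a < 0" for a
  proof -
    have "closed (S a)"
      unfolding closed_limpt
    proof (intro allI impI)
      fix y assume y: "y islimpt S a"
      have "S a \<subseteq> \<Omega>" by (auto simp: S_def)
      then have cl: "y \<in> closure \<Omega>"
        using islimpt_subset[OF y] by (simp add: closure_def)
      have freq: "\<exists>\<^sub>F x in at y. x \<in> S a"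
        using y by (simp add: islimpt_iff_eventually frequently_def)
      have "y \<notin> frontier \<Omega>"
      proof
        assume "y \<in> frontier \<Omega>"
        from bd[OF this, of "-a/2"] a
        have "\<forall>\<^sub>F x in at y within \<Omega>. ereal (w x + a/2) \<le> v x" by simp
        then have "\<forall>\<^sub>F x in at y. x \<in> \<Omega> \<longrightarrow> ereal (w x + a/2) \<le> v x"
          unfolding eventually_at_filter by (rule eventually_mono) auto
        from frequently_eventually_frequently[OF freq this]
        obtain x where "x \<in> S a" "ereal (w x + a/2) \<le> v x"
          using frequently_ex by (auto simp: S_def)
        then have "ereal (w x + a/2) \<le> ereal (w x + a)"
          unfolding S_def using order_trans by blast
        then show False using a by simp
      qed
      then have y\<Omega>: "y \<in> \<Omega>"
        using cl \<Omega>(1) by (simp add: frontier_def interior_open)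
      show "y \<in> S a"
      proof (rule ccontr)
        assume "y \<notin> S a"
        then have "ereal (w y + a) < v y" using y\<Omega> by (auto simp: S_def)
        then obtain b where b: "w y + a < b" "ereal b < v y"
          using ereal_dense2 by (metis ereal_less_eq(3) less_ereal.simps(1) linorder_not_less)
        have "\<forall>\<^sub>F x in nhds y. ereal b < v x \<and> w x < b - a"
          using lsc'[OF y\<Omega> b(2)] w'[OF y\<Omega>, of "b - a"] b(1) by (intro eventually_conj) auto
        then have "\<forall>\<^sub>F x in at y. ereal b < v x \<and> w x < b - a"
          unfolding eventually_at_filter by (rule eventually_mono) simp
        from frequently_eventually_frequently[OF freq this]
        obtain x where "x \<in> S a" "ereal b < v x" "w x < b - a"
          using frequently_ex by blast
        then have "ereal b < ereal (w x + a)" "w x < b - a"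
          unfolding S_def using less_le_trans by blast+
        then show False by simp
      qed
    qed
    moreover have "bounded (S a)"
      using bounded_subset[OF \<Omega>(2)] by (auto simp: S_def)
    ultimately show ?thesis by (simp add: compact_eq_bounded_closed)
  qed
  define A where "A = {a. a < 0 \<and> S a \<noteq> {}}"
  have "\<exists>b. b < w z \<and> v z \<le> ereal b"
    using vz by (cases "v z") (auto intro: exI[of _ "w z - 1"])
  then obtain b where b: "b < w z" "v z \<le> ereal b" by blast
  then have bA: "b - w z \<in> A"
    using z by (auto simp: A_def S_def)
  \<comment> \<open>A common point of these nested compact sets is a minimum point of the extended
    valued difference \<open>v - w\<close>.\<close>
  have "\<Inter>(S ` A) \<noteq> {}"
  proof (rule compact_chain)
    show "\<And>X. X \<in> S ` A \<Longrightarrow> compact X" using compact by (auto simp: A_def)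
    show "{} \<notin> S ` A" by (auto simp: A_def)
    fix X Y assume "X \<in> S ` A \<and> Y \<in> S ` A"
    then obtain a c where "X = S a" "Y = S c" by blast
    moreover have "S a \<subseteq> S c" if "a \<le> c" for a c
      using that by (auto simp: S_def intro: order_trans)
    ultimately show "X \<subseteq> Y \<or> Y \<subseteq> X" by (meson linear)
  qed
  then obtain p where p: "\<And>a. a \<in> A \<Longrightarrow> p \<in> S a" by auto
  then have p\<Omega>: "p \<in> \<Omega>" "v p \<le> ereal (w p + (b - w z))" using bA by (auto simp: S_def)
  then obtain vp where vp: "v p = ereal vp" using fin[of p] by (cases "v p") auto
  define m where "m = vp - w p"
  have m0: "m < 0" using p\<Omega> vp b by (simp add: m_def)
  have min: "ereal (w y + m) \<le> v y" if "y \<in> \<Omega>" for y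
  proof (rule ccontr)
    assume c: "\<not> ereal (w y + m) \<le> v y"
    then obtain vy where vy: "v y = ereal vy" using fin[OF \<open>y \<in> \<Omega>\<close>] by (cases "v y") auto
    have "vy - w y < m" using c vy by simp
    then have "vy - w y \<in> A" using that vy m0 by (auto simp: A_def S_def)
    from p[OF this] vp have "m \<le> vy - w y" by (simp add: S_def m_def)
    then show False using \<open>vy - w y < m\<close> by simp
  qed
  have "p \<in> S m" using p\<Omega> vp by (simp add: S_def m_def)
  then obtain q where q: "q \<in> S m" "\<And>y. y \<in> S m \<Longrightarrow> Re y \<le> Re q"
    using continuous_attains_sup[OF compact[OF m0], of Re] continuous_on_Re[OF continuous_on_id, of "S m"]
    by (auto simp: id_def)
  then have q\<Omega>: "q \<in> \<Omega>" by (simp add: S_def)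
  have "\<forall>\<^sub>F \<rho> in at_right 0. (0 < \<rho> \<and> cball q \<rho> \<subseteq> \<Omega>) \<and> circle_mean v q \<rho> \<le> v q \<and> w q \<le> cmean w q \<rho>"
    by (intro eventually_conj eventually_cball_subset \<Omega> mean mean_w q\<Omega>)
  then obtain \<rho> where \<rho>: "0 < \<rho>" "cball q \<rho> \<subseteq> \<Omega>" "circle_mean v q \<rho> \<le> v q" "w q \<le> cmean w q \<rho>"
    using eventually_happens'[of "at_right (0::real)"] by auto
  \<comment> \<open>The rightmost point of the circle has a larger real part than \<open>q\<close>,
    so it lies outside \<open>S m\<close> and \<open>v - w\<close> exceeds its minimum
    there.\<close>
  define y0 where "y0 = q + of_real \<rho>"
  have y0: "y0 \<in> sphere q \<rho>" using \<rho> by (simp add: y0_def dist_norm)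
  then have y0\<Omega>: "y0 \<in> \<Omega>" using \<rho> by auto
  have "y0 \<notin> S m" using q(2)[of y0] \<rho> by (auto simp: y0_def)
  then have "ereal (w y0 + m) < v y0" using y0\<Omega> by (auto simp: S_def)
  then obtain b where b: "w y0 + m < b" "ereal b < v y0"
    using ereal_dense2 by (metis ereal_less_eq(3) less_ereal.simps(1) linorder_not_less)
  \<comment> \<open>Half of the gap between \<open>w y0 + m\<close> and \<open>b\<close>: a bump of
    this height keeps \<open>\<phi>\<close> below \<open>b\<close>, hence below \<open>v\<close>,
    near \<open>y0\<close>.\<close>
  define \<eta> where "\<eta> = (b - w y0 - m) / 2"
  have \<eta>: "\<eta> > 0" using b by (simp add: \<eta>_def)
  have "\<forall>\<^sub>F x in nhds y0. ereal b < v x \<and> w x < b - m - \<eta>"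
    using lsc'[OF y0\<Omega> b(2)] w'[OF y0\<Omega>, of "b - m - \<eta>"] b(1)
    by (intro eventually_conj) (auto simp: \<eta>_def field_simps)
  then obtain r where r: "r > 0" "\<And>x. dist x y0 < r \<Longrightarrow> ereal b < v x \<and> w x < b - m - \<eta>"
    unfolding eventually_nhds_metric by blast
  define \<phi> where "\<phi> x = w x + m + max 0 (\<eta> * (1 - dist x y0 / r))" for x
  have cw: "continuous_on (sphere q \<rho>) w"
    using \<rho> by (intro continuous_on_subset[OF w]) auto
  have c\<phi>: "continuous_on (sphere q \<rho>) \<phi>"
    unfolding \<phi>_def using r(1) by (intro continuous_intros cw) simp
  have \<phi>v: "ereal (\<phi> x) \<le> v x" if "x \<in> sphere q \<rho>" for x
  proof (cases "dist x y0 < r")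
    case True
    have "\<eta> * (1 - dist x y0 / r) \<le> \<eta>"
      using \<eta> r(1) by (simp add: mult_le_cancel_left2)
    then have "\<phi> x \<le> w x + m + \<eta>" using \<eta> by (simp add: \<phi>_def)
    also have "\<dots> < b" using r(2)[OF True] by simp
    finally show ?thesis using r(2)[OF True] by (meson ereal_less_eq(3) less_imp_le order_trans)
  next
    case False
    then have "\<eta> * (1 - dist x y0 / r) \<le> 0"
      using \<eta> r(1) by (simp add: mult_le_0_iff)
    then have "\<phi> x = w x + m" by (simp add: \<phi>_def)
    then show ?thesis using min[of x] that \<rho> by auto
  qed
  have "ereal (cmean \<phi> q \<rho>) \<le> v q"
    using circle_mean_ge[OF _ c\<phi> \<phi>v] \<rho> order_trans by fastforce
  also have "v q \<le> ereal (w q + m)" using q by (simp add: S_def)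
  also have "\<dots> \<le> ereal (cmean (\<lambda>x. w x + m) q \<rho>)"
    using \<rho> by (subst cmean_add) (auto intro: cw continuous_intros)
  finally have "cmean (\<lambda>x. \<phi> x - (w x + m)) q \<rho> \<le> 0"
    using \<rho> by (subst cmean_diff) (auto intro!: cw c\<phi> continuous_intros)
  then have "\<phi> y0 - (w y0 + m) = 0"
    by (intro cmean_nonneg_eq_0[where f="\<lambda>x. \<phi> x - (w x + m)" and z=q and \<rho>=\<rho>])
       (use \<rho> y0 r(1) in \<open>auto intro!: cw c\<phi> continuous_intros simp: \<phi>_def\<close>)
  then show False using \<eta> by (simp add: \<phi>_def)
qed

subsection \<open>Approximation by trigonometric polynomials\<close>

text \<open>In the form \<open>Re (poly P y)\<close> a trigonometric polynomial on the circle
  carries its harmonic extension to the disc with it.\<close>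

definition trig_poly :: "(complex \<Rightarrow> real) \<Rightarrow> bool" where
  "trig_poly g \<longleftrightarrow> (\<exists>P. \<forall>y. cmod y = 1 \<longrightarrow> g y = Re (poly P y))"

lemma trig_poly_add: "trig_poly f \<Longrightarrow> trig_poly g \<Longrightarrow> trig_poly (\<lambda>y. f y + g y)"
  unfolding trig_poly_def by (metis plus_complex.simps(1) poly_add)

lemma trig_poly_const: "trig_poly (\<lambda>_. c)"
  unfolding trig_poly_def by (intro exI[of _ "[:of_real c:]"]) simp

lemma trig_poly_sum: "(\<And>i. i \<in> I \<Longrightarrow> trig_poly (f i)) \<Longrightarrow> trig_poly (\<lambda>y. \<Sum>i\<in>I. f i y)"
  by (induction I rule: infinite_finite_induct) (simp_all add: trig_poly_const trig_poly_add)

lemma trig_poly_monom: "trig_poly (\<lambda>y. Re (a * y ^ n))"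
  unfolding trig_poly_def by (intro exI[of _ "monom a n"]) (simp add: poly_monom)

lemma trig_poly_cong:
  assumes "trig_poly f" "\<And>y. cmod y = 1 \<Longrightarrow> f y = g y"
  shows "trig_poly g"
  using assms unfolding trig_poly_def by metis

text \<open>Re u Re v is half the sum of Re (u v) and Re (cnj u v). On the circle
  \<open>cnj y\<close> is the inverse of \<open>y\<close>, so for \<open>i \<le> j\<close> the
  second product is a monomial with exponent \<open>j - i\<close>.\<close>

lemma trig_poly_mult_monom: "trig_poly (\<lambda>y. Re (a * y ^ i) * Re (b * y ^ j))"
proof (induction i j arbitrary: a b rule: linorder_wlog)
  case (le i j)
  show ?case
  proof (rule trig_poly_cong)
    show "trig_poly (\<lambda>y. Re (a * b / 2 * y ^ (i + j)) + Re (cnj a * b / 2 * y ^ (j - i)))"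
      by (intro trig_poly_add trig_poly_monom)
    fix y :: complex assume y: "cmod y = 1"
    have 1: "Re u * Re v = Re (u * v / 2) + Re (cnj u * v / 2)" for u v :: complex
      by (simp add: field_simps)
    have "cnj y * y = 1" using y by (simp add: complex_norm_square[symmetric] mult.commute flip: complex_norm_square)
    then have "cnj (y ^ i) * y ^ i = 1"
      by (metis complex_cnj_power power_mult_distrib power_one)
    then have "cnj (y ^ i) * y ^ j = y ^ (j - i)"
      using le by (metis (no_types, opaque_lifting) le_add_diff_inverse mult.assoc mult_1 power_add)
    then have "cnj (a * y ^ i) * (b * y ^ j) / 2 = cnj a * b / 2 * y ^ (j - i)"
      by (simp add: mult_ac flip: \<open>cnj (y ^ i) * y ^ j = y ^ (j - i)\<close>)
    moreover have "(a * y ^ i) * (b * y ^ j) / 2 = a * b / 2 * y ^ (i + j)"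
      by (simp add: power_add mult_ac)
    ultimately show "Re (a * b / 2 * y ^ (i + j)) + Re (cnj a * b / 2 * y ^ (j - i)) = Re (a * y ^ i) * Re (b * y ^ j)"
      using 1[of "a * y ^ i" "b * y ^ j"] by (simp only:)
  qed
next
  case (sym i j)
  show ?case using sym[of b a] by (simp add: mult.commute)
qed

lemma trig_poly_mult:
  assumes "trig_poly f" "trig_poly g"
  shows "trig_poly (\<lambda>y. f y * g y)"
proof -
  obtain P Q where P: "\<And>y. cmod y = 1 \<Longrightarrow> f y = Re (poly P y)"
    and Q: "\<And>y. cmod y = 1 \<Longrightarrow> g y = Re (poly Q y)"
    using assms unfolding trig_poly_def by blast
  show ?thesis
  proof (rule trig_poly_cong)
    show "trig_poly (\<lambda>y. \<Sum>i\<le>degree P. \<Sum>j\<le>degree Q. Re (coeff P i * y ^ i) * Re (coeff Q j * y ^ j))"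
      by (intro trig_poly_sum trig_poly_mult_monom)
    show "(\<Sum>i\<le>degree P. \<Sum>j\<le>degree Q. Re (coeff P i * y ^ i) * Re (coeff Q j * y ^ j)) = f y * g y"
      if "cmod y = 1" for y
      by (simp add: P[OF that] Q[OF that] poly_altdef Re_sum sum_product)
  qed
qed

lemma real_polynomial_function_trig_poly:
  assumes "real_polynomial_function g"
  shows "trig_poly g"
  using assms
proof (induction rule: real_polynomial_function.induct)
  case (linear f)
  interpret bounded_linear f by fact
  have "f y = Re ((of_real (f 1) - \<i> * of_real (f \<i>)) * y ^ 1)" for y
  proof -
    have "f y = f (Re y *\<^sub>R 1 + Im y *\<^sub>R \<i>)"
      by (rule arg_cong[where f=f]) (simp add: complex_eq_iff)
    also have "\<dots> = Re y * f 1 + Im y * f \<i>" by (simp add: add scaleR)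
    finally show ?thesis by (simp add: mult.commute)
  qed
  then show ?case by (rule trig_poly_cong[OF trig_poly_monom sym])
qed (auto intro: trig_poly_const trig_poly_add trig_poly_mult)

text \<open>The upper class demands the mean inequality on all closed discs, whereas constructions
  by minima and gluing only give it on small circles. To bridge this, \<open>f\<close> is
  approximated on the given circle by a trigonometric polynomial, whose harmonic extension is
  compared with \<open>f\<close> inside by the minimum principle and has an exact mean at the
  centre.\<close>

lemma superharmonic_mean_le:
  assumes f: "continuous_on (cball z \<rho>) f" and \<rho>: "0 < \<rho>"
    and sup: "\<And>y. y \<in> ball z \<rho> \<Longrightarrow> superharmonic_at f y"
  shows "cmean f z \<rho> \<le> f z"
proof (rule field_le_epsilon)
  fix e :: real assume e: "e > 0"
  define g where "g y = f (z + of_real \<rho> * y)" for y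
  have "continuous_on (sphere 0 1) g"
    unfolding g_def using \<rho>
    by (intro continuous_on_compose2[OF f]) (auto intro!: continuous_intros simp: dist_norm norm_mult)
  then obtain p where p: "real_polynomial_function p" "\<And>y. y \<in> sphere 0 1 \<Longrightarrow> \<bar>g y - p y\<bar> < e / 3"
    using Stone_Weierstrass_real_polynomial_function[of "sphere 0 1" g "e/3"] e by auto
  obtain P where P: "\<And>y. cmod y = 1 \<Longrightarrow> p y = Re (poly P y)"
    using real_polynomial_function_trig_poly[OF p(1)] unfolding trig_poly_def by blast
  define F where "F y = poly P ((y - z) / of_real \<rho>)" for y
  have holF: "F holomorphic_on S" for S
    unfolding F_def by (intro holomorphic_intros) (use \<rho> in auto)
  have contF: "continuous_on S (\<lambda>y. Re (F y))" for S
    by (intro continuous_intros holomorphic_on_imp_continuous_on holF)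
  have close: "\<bar>f y - Re (F y)\<bar> < e / 3" if "y \<in> sphere z \<rho>" for y
  proof -
    have y: "cmod ((y - z) / of_real \<rho>) = 1"
      using that \<rho> by (simp add: norm_divide dist_norm norm_minus_commute)
    have "g ((y - z) / of_real \<rho>) = f y" using \<rho> by (simp add: g_def)
    then show ?thesis using p(2)[of "(y - z) / of_real \<rho>"] P[OF y] y by (simp add: F_def)
  qed
  have "ereal (Re (F z) - e / 3) \<le> ereal (f z)"
  proof (rule hyperharmonic_minimum_principle[where \<Omega>="ball z \<rho>" and v="\<lambda>y. ereal (f y)"
          and w="\<lambda>y. Re (F y) - e / 3"])
    show "continuous_on (ball z \<rho>) (\<lambda>y. Re (F y) - e / 3)"
      by (intro continuous_intros contF)
    fix y assume y: "y \<in> ball z \<rho>"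
    have "continuous_on (ball z \<rho>) f" using f by (rule continuous_on_subset) auto
    then have "(f \<longlongrightarrow> f y) (at y within ball z \<rho>)" using y by (simp add: continuous_on_def)
    then show "ereal (f y) \<le> Liminf (at y within ball z \<rho>) (\<lambda>y. ereal (f y))"
      using y at_within_open[of y "ball z \<rho>"] by (intro eq_refl[OF sym[OF lim_imp_Liminf]]) auto
    have ev: "\<forall>\<^sub>F r in at_right 0. 0 < r \<and> cball y r \<subseteq> ball z \<rho>"
      by (rule eventually_cball_subset) (use y in auto)
    have cs: "continuous_on (sphere y r) f" if "cball y r \<subseteq> ball z \<rho>" for r
      using that by (intro continuous_on_subset[OF f]) (meson ball_subset_cball sphere_cball subset_trans)
    show "\<forall>\<^sub>F r in at_right 0. circle_mean (\<lambda>y. ereal (f y)) y r \<le> ereal (f y)"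
      using ev sup[OF y, unfolded superharmonic_at_def]
      by eventually_elim (simp add: circle_mean_ereal cs)
    show "\<forall>\<^sub>F r in at_right 0. Re (F y) - e / 3 \<le> cmean (\<lambda>y. Re (F y) - e / 3) y r"
      using ev by eventually_elim (simp add: cmean_diff contF cmean_Re_holomorphic holF)
  next
    fix y d assume y: "y \<in> frontier (ball z \<rho>)" and d: "0 < (d::real)"
    then have ys: "y \<in> sphere z \<rho>" using \<rho> by simp
    have "continuous_on (cball z \<rho>) (\<lambda>x. f x - Re (F x))" 
      by (intro continuous_intros f contF)
    then have "((\<lambda>x. f x - Re (F x)) \<longlongrightarrow> f y - Re (F y)) (at y within cball z \<rho>)"
      using ys by (auto simp: continuous_on_def)
    then have "\<forall>\<^sub>F x in at y within cball z \<rho>. - (e / 3) < f x - Re (F x)"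
    proof (rule order_tendstoD(1))
      show "- (e / 3) < f y - Re (F y)" using close[OF ys] by linarith
    qed
    moreover have "at y within ball z \<rho> \<le> at y within cball z \<rho>"
      by (rule at_le) auto
    ultimately have "\<forall>\<^sub>F x in at y within ball z \<rho>. - (e / 3) < f x - Re (F x)"
      using filter_leD by blast
    then show "\<forall>\<^sub>F x in at y within ball z \<rho>. ereal (Re (F x) - e / 3 - d) \<le> ereal (f x)"
      by eventually_elim (use d in auto)
  qed (use \<rho> in auto)
  then have 1: "Re (F z) - e / 3 \<le> f z" by simp
  have "cmean f z \<rho> \<le> cmean (\<lambda>y. Re (F y) + e / 3) z \<rho>"
  proof (rule cmean_mono)
    show "continuous_on (sphere z \<rho>) f" using f by (rule continuous_on_subset) auto
    show "f y \<le> Re (F y) + e / 3" if "y \<in> sphere z \<rho>" for y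
      using close[OF that] by linarith
  qed (use \<rho> in \<open>auto intro!: continuous_intros contF\<close>)
  also have "\<dots> = Re (F z) + e / 3"
    using \<rho> by (simp add: cmean_add contF cmean_Re_holomorphic holF)
  finally show "cmean f z \<rho> \<le> f z + e" using 1 e by simp
qed


subsection \<open>The truncated Green function of the disc\<close>

definition blaschke :: "complex \<Rightarrow> complex \<Rightarrow> complex" where
  "blaschke x z = (z - x) / (1 - cnj x * z)"

text \<open>\<open>- ln (cmod (blaschke x z))\<close> is the Green function of the unit disc with pole \<open>x\<close>; here it
  is truncated at height \<open>- ln m\<close> and normalised to have maximum 1.\<close>

definition tgreen :: "complex \<Rightarrow> real \<Rightarrow> complex \<Rightarrow> real" where
  "tgreen x m z = ln (max (cmod (blaschke x z)) m) / ln m"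

lemma cmod_one_minus_cnj_mult_ge:
  assumes "cmod z \<le> 1"
  shows "1 - cmod x \<le> cmod (1 - cnj x * z)"
proof -
  have "cmod (cnj x * z) \<le> cmod x"
    using assms by (simp add: norm_mult mult_left_le)
  then show ?thesis
    using norm_triangle_ineq2[of 1 "cnj x * z"] by simp
qed

lemma one_minus_cnj_mult_nonzero:
  assumes "cmod x < 1" "cmod z < 1"
  shows "1 - cnj x * z \<noteq> 0"
  using cmod_one_minus_cnj_mult_ge[of z x] assms by auto

lemma cmod_one_minus_cnj_mult_le:
  assumes "cmod x < 1"
  shows "cmod (1 - cnj x * z) \<le> cmod (z - x) + 2 * (1 - cmod x)"
proof -
  have "1 - cnj x * z = of_real (1 - (cmod x)\<^sup>2) - cnj x * (z - x)"
    using complex_norm_square[of x] by (simp add: algebra_simps)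
  then have "cmod (1 - cnj x * z) \<le> \<bar>1 - (cmod x)\<^sup>2\<bar> + cmod x * cmod (z - x)"
    by (metis norm_triangle_ineq4 norm_mult norm_of_real complex_mod_cnj)
  moreover have "\<bar>1 - (cmod x)\<^sup>2\<bar> \<le> 2 * (1 - cmod x)"
  proof -
    have "1 - (cmod x)\<^sup>2 = (1 - cmod x) * (1 + cmod x)" by (simp add: power2_eq_square algebra_simps)
    moreover have "0 \<le> (1 - cmod x) * (1 + cmod x)" using assms by simp
    moreover have "(1 - cmod x) * (1 + cmod x) \<le> (1 - cmod x) * 2"
      using assms by (intro mult_left_mono) auto
    ultimately show ?thesis by simp
  qed
  moreover have "cmod x * cmod (z - x) \<le> cmod (z - x)"
    using assms by (simp add: mult_left_le_one_le)
  ultimately show ?thesis by linarith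
qed

text \<open>This identity yields both \<open>cmod (blaschke x z) < 1\<close> and the closed formula
  for the Green function in \<open>ln_cmod_blaschke\<close>.\<close>

lemma cmod_one_minus_cnj_mult_square:
  "(cmod (1 - cnj x * z))\<^sup>2 = (cmod (z - x))\<^sup>2 + (1 - (cmod x)\<^sup>2) * (1 - (cmod z)\<^sup>2)"
  unfolding cmod_power2 by (simp add: power2_eq_square algebra_simps)

lemma cmod_blaschke_less_1:
  assumes "cmod x < 1" "cmod z < 1"
  shows "cmod (blaschke x z) < 1"
proof -
  have "0 < (1 - (cmod x)\<^sup>2) * (1 - (cmod z)\<^sup>2)"
    using assms by (intro mult_pos_pos) (auto simp: power_less_one_iff)
  then have "(cmod (z - x))\<^sup>2 < (cmod (1 - cnj x * z))\<^sup>2"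
    by (simp add: cmod_one_minus_cnj_mult_square)
  then have "cmod (z - x) < cmod (1 - cnj x * z)"
    by (rule power_less_imp_less_base) simp
  then show ?thesis by (simp add: blaschke_def norm_divide divide_less_eq)
qed

lemma cmod_blaschke_le:
  assumes "cmod x < 1" "cmod z < 1"
  shows "cmod (blaschke x z) \<le> cmod (z - x) / (1 - cmod x)"
  unfolding blaschke_def norm_divide
  using assms cmod_one_minus_cnj_mult_ge[of z x] by (intro divide_left_mono mult_pos_pos) auto

text \<open>The quotient t / (t + 2 (1 - |x|)) increases with t. Its value at the radius of a bubble
  is a level below which \<open>cmod (blaschke x z)\<close> falls only inside the bubble; this is
  the origin of \<open>cut\<close>.\<close>

lemma cmod_blaschke_gt:
  assumes "cmod x < 1" "cmod z < 1" "0 < r" "r < cmod (z - x)"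
  shows "r / (r + 2 * (1 - cmod x)) < cmod (blaschke x z)"
proof -
  have pos: "0 < cmod (1 - cnj x * z)"
    using one_minus_cnj_mult_nonzero[OF assms(1,2)] by simp
  have "r / (r + 2 * (1 - cmod x)) < cmod (z - x) / (cmod (z - x) + 2 * (1 - cmod x))"
  proof -
    have "0 < (1 - cmod x) * (cmod (z - x) - r)" using assms by simp
    then show ?thesis using assms by (simp add: field_simps add_pos_pos)
  qed
  also have "\<dots> \<le> cmod (z - x) / cmod (1 - cnj x * z)"
    using cmod_one_minus_cnj_mult_le[OF assms(1), of z] pos assms
    by (intro divide_left_mono mult_pos_pos) auto
  finally show ?thesis by (simp add: blaschke_def norm_divide)
qed

lemma holomorphic_blaschke:
  assumes "cmod x < 1"
  shows "blaschke x holomorphic_on ball 0 1"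
  unfolding blaschke_def
  using one_minus_cnj_mult_nonzero[OF assms] by (intro holomorphic_intros) auto

lemma continuous_on_blaschke:
  assumes "cmod x < 1"
  shows "continuous_on (ball 0 1) (blaschke x)"
  by (rule holomorphic_on_imp_continuous_on[OF holomorphic_blaschke[OF assms]])

lemma continuous_on_tgreen:
  assumes "cmod x < 1" "0 < m" "m < 1"
  shows "continuous_on (ball 0 1) (tgreen x m)"
  unfolding tgreen_def using assms
  by (intro continuous_intros continuous_on_blaschke) auto

lemma tgreen_nonneg:
  assumes "cmod x < 1" "cmod z < 1" "0 < m" "m < 1"
  shows "0 \<le> tgreen x m z"
  unfolding tgreen_def using assms cmod_blaschke_less_1[OF assms(1,2)]
  by (intro divide_nonpos_neg) auto

lemma tgreen_le_1:
  assumes "0 < m" "m < 1"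
  shows "tgreen x m z \<le> 1"
  unfolding tgreen_def using assms by (simp add: divide_le_eq)

lemma tgreen_eq_1:
  assumes "0 < m" "m < 1" "cmod (blaschke x z) \<le> m"
  shows "tgreen x m z = 1"
  unfolding tgreen_def using assms by (simp add: max_absorb2)

lemma tgreen_ge_ratio:
  assumes "0 < m" "m < 1" "cmod (blaschke x z) \<le> k" "m \<le> k" "k < 1"
  shows "ln k / ln m \<le> tgreen x m z"
  unfolding tgreen_def using assms
  by (intro divide_right_mono_neg ln_mono) auto

lemma ln_cmod_blaschke:
  assumes "cmod x < 1" "cmod z < 1" "z \<noteq> x"
  shows "- ln (cmod (blaschke x z)) = ln (1 + (1 - (cmod x)\<^sup>2) * (1 - (cmod z)\<^sup>2) / (cmod (z - x))\<^sup>2) / 2"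
proof -
  have nz: "cmod (z - x) \<noteq> 0" "cmod (1 - cnj x * z) \<noteq> 0"
    using assms one_minus_cnj_mult_nonzero[OF assms(1,2)] by auto
  have "1 + (1 - (cmod x)\<^sup>2) * (1 - (cmod z)\<^sup>2) / (cmod (z - x))\<^sup>2 = (cmod (1 - cnj x * z))\<^sup>2 / (cmod (z - x))\<^sup>2"
    using nz by (simp add: cmod_one_minus_cnj_mult_square add_divide_distrib)
  also have "\<dots> = (1 / cmod (blaschke x z))\<^sup>2"
    by (simp add: blaschke_def norm_divide power_divide)
  finally show ?thesis
    using nz by (simp add: ln_realpow ln_div blaschke_def norm_divide)
qed

lemma green_ratio_nonneg:
  assumes "cmod x < 1" "cmod z < 1"
  shows "0 \<le> (1 - (cmod x)\<^sup>2) * (1 - (cmod z)\<^sup>2) / (cmod (z - x))\<^sup>2"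
  using assms by (intro divide_nonneg_nonneg mult_nonneg_nonneg) (auto simp: power_le_one_iff)

lemma tgreen_le_green:
  assumes "cmod x < 1" "cmod z < 1" "z \<noteq> x" "0 < m" "m < 1"
  shows "tgreen x m z \<le> - ln (cmod (blaschke x z)) / (- ln m)"
proof -
  have "0 < cmod (blaschke x z)"
    using assms one_minus_cnj_mult_nonzero[OF assms(1,2)] by (simp add: blaschke_def)
  then have "ln (max (cmod (blaschke x z)) m) / ln m \<le> ln (cmod (blaschke x z)) / ln m"
    using assms by (intro divide_right_mono_neg ln_mono) auto
  then show ?thesis by (simp add: tgreen_def)
qed

lemma tgreen_le_ratio:
  assumes "cmod x < 1" "cmod z < 1" "z \<noteq> x" "0 < m" "m < 1"
  shows "tgreen x m z \<le> (1 - (cmod x)\<^sup>2) * (1 - (cmod z)\<^sup>2) / (cmod (z - x))\<^sup>2 / (- ln m)"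
proof -
  define t where "t = (1 - (cmod x)\<^sup>2) * (1 - (cmod z)\<^sup>2) / (cmod (z - x))\<^sup>2"
  have t: "0 \<le> t" unfolding t_def by (rule green_ratio_nonneg[OF assms(1,2)])
  have "- ln (cmod (blaschke x z)) \<le> t"
    using ln_cmod_blaschke[OF assms(1-3)] ln_add_one_self_le_self[OF t] t by (simp add: t_def[symmetric])
  then have "- ln (cmod (blaschke x z)) / (- ln m) \<le> t / (- ln m)"
    using assms by (intro divide_right_mono) auto
  then show ?thesis using tgreen_le_green[OF assms] by (simp add: t_def)
qed

text \<open>Since 1 + t is at most (1 + sqrt t)^2, the logarithm is at most 2 sqrt t. The
  singularity is now of order 1 / |z - x| only, which can be summed against area near the pole,
  where \<open>tgreen_le_ratio\<close> is too weak.\<close>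

lemma tgreen_le_sqrt_ratio:
  assumes "cmod x < 1" "cmod z < 1" "z \<noteq> x" "0 < m" "m < 1"
  shows "tgreen x m z \<le> sqrt ((1 - (cmod x)\<^sup>2) * (1 - (cmod z)\<^sup>2)) / cmod (z - x) / (- ln m)"
proof -
  define t where "t = (1 - (cmod x)\<^sup>2) * (1 - (cmod z)\<^sup>2) / (cmod (z - x))\<^sup>2"
  have t: "0 \<le> t" unfolding t_def by (rule green_ratio_nonneg[OF assms(1,2)])
  have "ln (1 + t) \<le> ln ((1 + sqrt t)\<^sup>2)"
    using t by (intro ln_mono) (auto simp: power2_sum)
  also have "\<dots> = 2 * ln (1 + sqrt t)"
    using t by (subst ln_realpow) auto
  also have "ln (1 + sqrt t) \<le> sqrt t"
    using t by (intro ln_add_one_self_le_self) auto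
  finally have "- ln (cmod (blaschke x z)) \<le> sqrt t"
    using ln_cmod_blaschke[OF assms(1-3)] by (simp add: t_def[symmetric])
  then have "- ln (cmod (blaschke x z)) / (- ln m) \<le> sqrt t / (- ln m)"
    using assms by (intro divide_right_mono) auto
  then show ?thesis using tgreen_le_green[OF assms] by (simp add: t_def real_sqrt_divide)
qed

text \<open>Converse of \<open>tgreen_le_ratio\<close> up to a factor 4 where the truncation is
  inactive: ln (1 + t) is at least t / (1 + t), hence at least t / 2 when t is at most 1.\<close>

lemma tgreen_ge_ratio_quarter:
  assumes "cmod x < 1" "cmod z < 1" "z \<noteq> x" "0 < m" "m < cmod (blaschke x z)"
    and t: "(1 - (cmod x)\<^sup>2) * (1 - (cmod z)\<^sup>2) / (cmod (z - x))\<^sup>2 \<le> 1" (is "?t \<le> 1")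
  shows "?t / (4 * (- ln m)) \<le> tgreen x m z"
proof -
  have m1: "m < 1" using assms cmod_blaschke_less_1[OF assms(1,2)] by linarith
  have t0: "0 \<le> ?t" by (rule green_ratio_nonneg[OF assms(1,2)])
  have "?t / 2 \<le> ?t / (1 + ?t)"
    using t t0 by (intro divide_left_mono) auto
  also have "\<dots> \<le> ln (1 + ?t)"
  proof -
    have "ln (1 / (1 + ?t)) \<le> 1 / (1 + ?t) - 1"
      using t0 by (intro ln_le_minus_one) auto
    moreover have "ln (1 / (1 + ?t)) = - ln (1 + ?t)"
      using t0 by (simp add: ln_div)
    moreover have "1 / (1 + ?t) - 1 = - (?t / (1 + ?t))"
      using t0 by (simp add: field_simps)
    ultimately show ?thesis by linarith
  qed
  finally have "?t / 4 \<le> - ln (cmod (blaschke x z))"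
    using ln_cmod_blaschke[OF assms(1-3)] by simp
  then have "?t / 4 / (- ln m) \<le> - ln (cmod (blaschke x z)) / (- ln m)"
    using assms(4) m1 by (intro divide_right_mono) auto
  also have "\<dots> = tgreen x m z"
    using assms by (simp add: tgreen_def)
  finally show ?thesis by simp
qed

lemma tgreen_mean_value:
  assumes x: "cmod x < 1" and z: "cmod z < 1" and m: "0 < m" "m < cmod (blaschke x z)"
  shows "\<forall>\<^sub>F \<rho> in at_right 0. cmean (tgreen x m) z \<rho> = tgreen x m z"
proof -
  have nz: "blaschke x z \<noteq> 0" using m by auto
  have m1: "m < 1" using m cmod_blaschke_less_1[OF x z] by linarith
  have "(blaschke x \<longlongrightarrow> blaschke x z) (nhds z)"
    using continuous_on_blaschke[OF x] z
    by (simp add: continuous_on_eq_continuous_at isCont_def tendsto_nhds_iff)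
  then have lim: "((\<lambda>y. cmod (blaschke x y)) \<longlongrightarrow> cmod (blaschke x z)) (nhds z)"
    "((\<lambda>y. Re (blaschke x y / blaschke x z)) \<longlongrightarrow> Re (blaschke x z / blaschke x z)) (nhds z)"
    by (intro tendsto_norm tendsto_Re tendsto_divide tendsto_const nz; assumption)+
  have "\<forall>\<^sub>F y in nhds z. y \<in> ball 0 1 \<and> m < cmod (blaschke x y) \<and> 0 < Re (blaschke x y / blaschke x z)"
    using order_tendstoD(1)[OF lim(1) m(2)] order_tendstoD(1)[OF lim(2), of 0] nz z
    by (intro eventually_conj eventually_nhds_in_open) auto
  then obtain S where S: "open S" "z \<in> S"
    "\<And>y. y \<in> S \<Longrightarrow> y \<in> ball 0 1 \<and> m < cmod (blaschke x y) \<and> 0 < Re (blaschke x y / blaschke x z)"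
    unfolding eventually_nhds by blast
  \<comment> \<open>Division by the value at \<open>z\<close> keeps the quotient in the right
    half-plane throughout \<open>S\<close>, so the principal logarithm is holomorphic there.\<close>
  define H where "H y = (Ln (blaschke x y / blaschke x z) + of_real (ln (cmod (blaschke x z)))) / of_real (ln m)" for y
  have "blaschke x holomorphic_on S"
    using holomorphic_on_subset[OF holomorphic_blaschke[OF x]] S(3) by blast
  then have hol: "H holomorphic_on S"
    unfolding H_def
  proof (intro holomorphic_intros)
    show "blaschke x y / blaschke x z \<notin> \<real>\<^sub>\<le>\<^sub>0" if "y \<in> S" for y
      using S(3)[OF that] by (simp add: complex_nonpos_Reals_iff)
  qed (use nz m m1 in auto)
  have eq: "tgreen x m y = Re (H y)" if "y \<in> S" for y
  proof -
    have y: "m < cmod (blaschke x y)" "blaschke x y \<noteq> 0" using S(3)[OF that] m by auto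
    have "Re (Ln (blaschke x y / blaschke x z)) = ln (cmod (blaschke x y)) - ln (cmod (blaschke x z))"
      using y nz by (simp add: norm_divide ln_div)
    then show ?thesis
      using y m m1 by (simp add: H_def tgreen_def max_absorb1 Re_divide_of_real)
  qed
  have "\<forall>\<^sub>F \<rho> in at_right 0. 0 < \<rho> \<and> cball z \<rho> \<subseteq> S"
    by (rule eventually_cball_subset[OF S(1,2)])
  then show ?thesis
  proof eventually_elim
    case (elim \<rho>)
    have "cmean (tgreen x m) z \<rho> = cmean (\<lambda>y. Re (H y)) z \<rho>"
      using elim by (intro cmean_cong eq) auto
    also have "\<dots> = Re (H z)"
      using elim holomorphic_on_subset[OF hol] by (intro cmean_Re_holomorphic) auto
    finally show ?case using eq[OF S(2)] by simp
  qed
qed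

lemma superharmonic_at_tgreen:
  assumes x: "cmod x < 1" and z: "cmod z < 1" and m: "0 < m" "m < 1"
  shows "superharmonic_at (tgreen x m) z"
proof (cases "m < cmod (blaschke x z)")
  case True
  show ?thesis
    unfolding superharmonic_at_def
    using tgreen_mean_value[OF x z m(1) True] by eventually_elim simp
next
  case False
  have "\<forall>\<^sub>F \<rho> in at_right 0. 0 < \<rho> \<and> cball z \<rho> \<subseteq> ball 0 1"
    by (rule eventually_cball_subset) (use z in auto)
  then show ?thesis
    unfolding superharmonic_at_def
  proof eventually_elim
    case (elim \<rho>)
    have "cmean (tgreen x m) z \<rho> \<le> cmean (\<lambda>_. 1) z \<rho>"
    proof (rule cmean_mono)
      have "sphere z \<rho> \<subseteq> ball 0 1" using elim sphere_cball by blast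
      then show "continuous_on (sphere z \<rho>) (tgreen x m)"
        using continuous_on_tgreen[OF x m] continuous_on_subset by blast
    qed (use elim tgreen_le_1[OF m] in auto)
    then show ?case using tgreen_eq_1[OF m] False by simp
  qed
qed


subsection \<open>Champagne regions\<close>

lemma champagne_bubble:
  assumes "champagne x r"
  shows "cmod (x k) < 1" "0 < r k"
  using assms by (auto simp: champagne_def)

lemma champagne_ratio:
  assumes "champagne x r"
  obtains c where "0 < c" "c < 1" "\<And>k. r k \<le> c * (1 - cmod (x k))"
proof -
  have "(SUP k. ereal (r k / (1 - cmod (x k)))) < 1"
    using assms by (simp add: champagne_def)
  then obtain a where a: "(SUP k. ereal (r k / (1 - cmod (x k)))) < ereal a" "ereal a < 1"
    using ereal_dense2 by blast
  have le: "r k \<le> a * (1 - cmod (x k))" for k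
  proof -
    have "ereal (r k / (1 - cmod (x k))) < ereal a"
      using a(1) by (meson SUP_upper UNIV_I le_less_trans)
    then show ?thesis
      using champagne_bubble[OF assms, of k] by (simp add: divide_less_eq)
  qed
  have "0 < a * (1 - cmod (x 0))"
    using le[of 0] champagne_bubble[OF assms, of 0] by linarith
  then have "0 < a"
    using champagne_bubble[OF assms, of 0] by (simp add: zero_less_mult_iff)
  then show ?thesis using that[of a] a(2) le by simp
qed

lemma champagne_radius:
  assumes "champagne x r"
  shows "r k < 1 - cmod (x k)"
proof -
  obtain c where "0 < c" "c < 1" "r k \<le> c * (1 - cmod (x k))"
    using champagne_ratio[OF assms] by metis
  moreover have "c * (1 - cmod (x k)) < 1 * (1 - cmod (x k))"
    using \<open>c < 1\<close> champagne_bubble[OF assms, of k] by (intro mult_strict_right_mono) auto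
  ultimately show ?thesis by simp
qed

lemma champagne_log_pos:
  assumes "champagne x r"
  shows "0 < ln ((1 - cmod (x k)) / r k)"
  using champagne_bubble[OF assms, of k] champagne_radius[OF assms, of k] by (intro ln_gt_zero) simp

lemma champagne_finite:
  assumes "champagne x r" "0 < e"
  shows "finite {k. e \<le> 1 - cmod (x k)}"
proof -
  have "\<forall>\<^sub>F k in sequentially. 1 - e < cmod (x k)"
    using assms by (intro order_tendstoD(1)[of _ 1]) (auto simp: champagne_def)
  then have "finite {k. \<not> 1 - e < cmod (x k)}"
    by (simp add: eventually_cofinite flip: cofinite_eq_sequentially)
  then show ?thesis by (rule rev_finite_subset) auto
qed

lemma champagne_bubble_subset:
  assumes "champagne x r"
  shows "cball (x k) (r k) \<subseteq> ball 0 1"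
proof
  fix y assume "y \<in> cball (x k) (r k)"
  then have "cmod y \<le> cmod (x k) + r k"
    using norm_triangle_sub[of y "x k"] by (simp add: dist_norm norm_minus_commute)
  then show "y \<in> ball 0 1" using champagne_radius[OF assms, of k] by simp
qed

text \<open>The bubbles accumulate only at the circle: each radius is less than
  \<open>1 - cmod (x k)\<close>, so a bubble with \<open>1 - cmod (x k) < e\<close> lies within
  distance \<open>2 * e\<close> of the circle. Near a given point only finitely many closed discs
  are removed.\<close>

lemma champagne_open:
  assumes ch: "champagne x r"
  shows "open (ball 0 1 - bubbles x r)"
  unfolding open_subopen[of "ball 0 1 - bubbles x r"]
proof
  fix z assume z: "z \<in> ball 0 1 - bubbles x r"
  define e where "e = (1 - cmod z) / 4"
  have e: "e > 0" using z by (simp add: e_def)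
  define K where "K = {k. e \<le> 1 - cmod (x k)}"
  define U where "U = ball z (2 * e) - (\<Union>k\<in>K. cball (x k) (r k))"
  have "open U"
    unfolding U_def K_def using champagne_finite[OF ch e] by (intro open_Diff closed_UN) auto
  moreover have "z \<in> U"
    using z e by (auto simp: U_def bubbles_def)
  moreover have "U \<subseteq> ball 0 1 - bubbles x r"
  proof
    fix y assume y: "y \<in> U"
    then have "cmod y < cmod z + 2 * e"
      using norm_triangle_sub[of y z] by (simp add: U_def dist_norm norm_minus_commute)
    moreover have "4 * e = 1 - cmod z" by (simp add: e_def)
    ultimately have y1: "2 * e < 1 - cmod y" using e by linarith
    have "y \<notin> cball (x k) (r k)" for k
    proof (cases "k \<in> K")
      case True
      then show ?thesis using y by (auto simp: U_def)
    next
      case False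
      then have k: "1 - cmod (x k) < e" by (simp add: K_def)
      show ?thesis
      proof
        assume "y \<in> cball (x k) (r k)"
        then have "cmod (x k) \<le> cmod y + r k"
          using norm_triangle_sub[of "x k" y] by (simp add: dist_norm)
        then show False using k y1 champagne_radius[OF ch, of k] by linarith
      qed
    qed
    then show "y \<in> ball 0 1 - bubbles x r"
      using y1 e by (auto simp: bubbles_def)
  qed
  ultimately show "\<exists>T. open T \<and> z \<in> T \<and> T \<subseteq> ball 0 1 - bubbles x r" by blast
qed

subsection \<open>The Poisson kernel\<close>

definition poisson :: "complex \<Rightarrow> complex \<Rightarrow> real" where
  "poisson z y = (1 - (cmod z)\<^sup>2) / (cmod (y - z))\<^sup>2"

lemma poisson_nonneg: "cmod z \<le> 1 \<Longrightarrow> 0 \<le> poisson z y"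
  unfolding poisson_def by (intro divide_nonneg_nonneg) (auto simp: power_le_one_iff)

lemma measurable_poisson [measurable]: "poisson z \<in> borel_measurable borel"
  unfolding poisson_def[abs_def] by measurable

lemma poisson_eq_Re:
  assumes "cmod y = 1"
  shows "poisson z y = Re ((y + z) / (y - z))"
proof -
  have "Re ((y + z) * cnj (y - z)) = (cmod y)\<^sup>2 - (cmod z)\<^sup>2"
    unfolding cmod_power2 by (simp add: power2_eq_square algebra_simps)
  then show ?thesis
    using assms by (simp add: poisson_def Re_complex_div_eq_0 complex_div_cnj[of "y + z"] flip: of_real_power)
qed

lemma cmod_circle_diff_ge:
  assumes "cmod y = 1"
  shows "1 - cmod z \<le> cmod (y - z)"
  using norm_triangle_ineq2[of y z] assms by simp

lemma poisson_le:
  assumes "cmod y = 1" "cmod z \<le> R" "R < 1"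
  shows "poisson z y \<le> 1 / (1 - R)\<^sup>2"
proof -
  have "1 - R \<le> cmod (y - z)" using cmod_circle_diff_ge[OF assms(1), of z] assms by linarith
  then have "(1 - R)\<^sup>2 \<le> (cmod (y - z))\<^sup>2" using assms by (intro power_mono) auto
  then show ?thesis
    unfolding poisson_def using assms by (intro frac_le) auto
qed

lemma poisson_integral_1:
  assumes z: "cmod z < 1"
  shows "(LINT t|angle_measure. poisson z (cis t)) = 1"
proof -
  \<comment> \<open>As a function of \<open>y\<close>, the quotient (y + z) / (y - z) has a pole in
    the disc. On the circle its conjugate can be rewritten with \<open>y * cnj y = 1\<close> as
    \<open>F\<close>, which is holomorphic on the closed disc and equals 1 at 0.\<close>
  define F where "F y = (1 + cnj z * y) / (1 - cnj z * y)" for y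
  have nz: "1 - cnj z * y \<noteq> 0" if "y \<in> cball 0 1" for y
    using cmod_one_minus_cnj_mult_ge[of y z] that z by auto
  have hol: "F holomorphic_on cball 0 1"
    unfolding F_def using nz by (intro holomorphic_intros) auto
  have eq: "poisson z y = Re (F y)" if y: "cmod y = 1" for y
  proof -
    have yy: "y * cnj y = 1" using complex_norm_square[of y] y by simp
    have "cnj (F y) = (1 + z * cnj y) / (1 - z * cnj y)" by (simp add: F_def)
    also have "\<dots> = (y * (1 + z * cnj y)) / (y * (1 - z * cnj y))"
      using y by (subst mult_divide_mult_cancel_left) auto
    also have "y * (1 + z * cnj y) = y + z"
      using yy by (simp add: algebra_simps)
    also have "y * (1 - z * cnj y) = y - z"
      using yy by (simp add: algebra_simps)
    finally have "Re (F y) = Re ((y + z) / (y - z))" by (metis cnj.sel(1))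
    then show ?thesis using poisson_eq_Re[OF y] by simp
  qed
  have "(LINT t|angle_measure. poisson z (cis t)) = cmean (\<lambda>y. Re (F y)) 0 1"
    by (simp add: cmean_def eq)
  also have "\<dots> = 1"
    by (subst cmean_Re_holomorphic[OF hol]) (auto simp: F_def)
  finally show ?thesis .
qed

lemma poisson_mean_value:
  assumes y: "cmod y = 1" and z: "cball z \<rho> \<subseteq> ball 0 1" "0 < \<rho>"
  shows "cmean (\<lambda>z. poisson z y) z \<rho> = poisson z y"
proof -
  have "(\<lambda>z. (y + z) / (y - z)) holomorphic_on cball z \<rho>"
    using z y by (intro holomorphic_intros) auto
  then have "cmean (\<lambda>z. Re ((y + z) / (y - z))) z \<rho> = Re ((y + z) / (y - z))"
    by (rule cmean_Re_holomorphic) fact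
  then show ?thesis by (simp add: poisson_eq_Re[OF y] cmean_def)
qed

text \<open>The factor 4 compares the numerators, as \<open>1 - cmod z\<close> is at most twice
  \<open>1 - cmod x\<close>; the power of \<open>1 - c\<close> compares the denominators, as
  \<open>cmod (y - z)\<close> is at least \<open>(1 - c) * cmod (y - x)\<close>.\<close>

lemma poisson_harnack:
  assumes y: "cmod y = 1" and x: "cmod x < 1" and z: "cmod (z - x) \<le> c * (1 - cmod x)" and c: "0 \<le> c" "c < 1"
  shows "poisson z y \<le> 4 / (1 - c)\<^sup>2 * poisson x y"
proof -
  have d: "1 - cmod x \<le> cmod (y - x)" by (rule cmod_circle_diff_ge[OF y])
  have "c * (1 - cmod x) \<le> c * cmod (y - x)" using d c by (intro mult_left_mono) auto
  then have "cmod (z - x) \<le> c * cmod (y - x)" using z by linarith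
  then have *: "(1 - c) * cmod (y - x) \<le> cmod (y - z)"
    using norm_triangle_ineq[of "y - z" "z - x"] by (simp add: algebra_simps)
  have xpos: "0 < 1 - cmod x" using x by simp
  have cx: "c * (1 - cmod x) < 1 - cmod x" using xpos c by simp
  have "cmod z \<le> cmod x + c * (1 - cmod x)"
    using z norm_triangle_sub[of z x] by linarith
  then have z1: "cmod z < 1" using cx by linarith
  have "cmod x - c * (1 - cmod x) \<le> cmod z"
    using z norm_triangle_sub[of x z] by (simp add: norm_minus_commute)
  then have z2: "1 - cmod z \<le> 2 * (1 - cmod x)" using cx by simp
  have "1 - (cmod z)\<^sup>2 = (1 - cmod z) * (1 + cmod z)" by (simp add: power2_eq_square algebra_simps)
  also have "\<dots> \<le> (2 * (1 - cmod x)) * 2"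
    using z1 z2 xpos by (intro mult_mono) auto
  also have "\<dots> \<le> 4 * ((1 - cmod x) * (1 + cmod x))" 
  proof -
    have "(1 - cmod x) * 1 \<le> (1 - cmod x) * (1 + cmod x)"
      using xpos by (intro mult_left_mono) auto
    then show ?thesis by simp
  qed
  also have "\<dots> = 4 * (1 - (cmod x)\<^sup>2)" by (simp add: power2_eq_square algebra_simps)
  finally have num: "1 - (cmod z)\<^sup>2 \<le> 4 * (1 - (cmod x)\<^sup>2)" .
  have pos: "0 < (1 - c) * cmod (y - x)" using c d xpos by (intro mult_pos_pos) auto
  then have "((1 - c) * cmod (y - x))\<^sup>2 \<le> (cmod (y - z))\<^sup>2" using * by (intro power_mono) auto
  then have "poisson z y \<le> 4 * (1 - (cmod x)\<^sup>2) / ((1 - c) * cmod (y - x))\<^sup>2"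
    unfolding poisson_def using num pos x by (intro frac_le) (auto simp: power_le_one_iff)
  then show ?thesis by (simp add: poisson_def power_mult_distrib)
qed

definition poisson_int :: "real set \<Rightarrow> complex \<Rightarrow> real" where
  "poisson_int A z = (LINT t|angle_measure. indicator A t * poisson z (cis t))"

lemma integrable_poisson_int:
  assumes [measurable]: "A \<in> sets borel" and z: "cmod z < 1"
  shows "integrable angle_measure (\<lambda>t. indicator A t * poisson z (cis t))"
proof (rule angle.integrable_const_bound)
  show "AE t in angle_measure. norm (indicator A t * poisson z (cis t)) \<le> 1 / (1 - cmod z)\<^sup>2"
    using poisson_le[OF _ order_refl z] poisson_nonneg[of z] z by (auto simp: indicator_def)
  show "(\<lambda>t. indicator A t * poisson z (cis t)) \<in> borel_measurable angle_measure"
    by measurable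
qed

lemma poisson_int_nonneg: "cmod z < 1 \<Longrightarrow> 0 \<le> poisson_int A z"
  unfolding poisson_int_def by (intro integral_nonneg_AE AE_I2 mult_nonneg_nonneg poisson_nonneg) auto

lemma poisson_int_le_1:
  assumes "A \<in> sets borel" "cmod z < 1"
  shows "poisson_int A z \<le> 1"
proof -
  have "poisson_int A z \<le> poisson_int UNIV z"
    unfolding poisson_int_def using assms
    by (intro integral_mono integrable_poisson_int) (auto intro!: mult_right_mono poisson_nonneg simp: indicator_def)
  also have "\<dots> = 1" using poisson_integral_1[OF assms(2)] by (simp add: poisson_int_def)
  finally show ?thesis .
qed

lemma poisson_int_0:
  assumes "A \<in> sets borel"
  shows "poisson_int A 0 = measure angle_measure A"
  using assms by (simp add: poisson_int_def poisson_def)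

lemma poisson_int_harnack:
  assumes A: "A \<in> sets borel" and x: "cmod x < 1" and z: "cmod (z - x) \<le> c * (1 - cmod x)" "cmod z < 1"
    and c: "0 \<le> c" "c < 1"
  shows "poisson_int A z \<le> 4 / (1 - c)\<^sup>2 * poisson_int A x"
proof -
  have "poisson_int A z \<le> (LINT t|angle_measure. 4 / (1 - c)\<^sup>2 * (indicator A t * poisson x (cis t)))"
    unfolding poisson_int_def
  proof (rule integral_mono[OF integrable_poisson_int[OF A z(2)] integrable_mult_right[OF integrable_poisson_int[OF A x]]])
    show "indicator A t * poisson z (cis t) \<le> 4 / (1 - c)\<^sup>2 * (indicator A t * poisson x (cis t))" for t
      using poisson_harnack[OF _ x z(1) c, of "cis t"] by (simp add: indicator_def)
  qed
  then show ?thesis by (simp add: poisson_int_def)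
qed

lemma continuous_on_poisson_int:
  assumes [measurable]: "A \<in> sets borel"
  shows "continuous_on (ball 0 1) (poisson_int A)"
proof (rule continuous_on_unit_ball)
  fix R :: real assume R: "R < 1"
  show "continuous_on (cball 0 R) (poisson_int A)"
    unfolding continuous_on_sequentially comp_def
  proof (intro allI ballI impI, elim conjE)
    fix s a assume a: "a \<in> cball 0 R" and s: "\<forall>n. s n \<in> cball (0::complex) R" and lim: "s \<longlonglongrightarrow> a"
    show "(\<lambda>n. poisson_int A (s n)) \<longlonglongrightarrow> poisson_int A a"
      unfolding poisson_int_def
    proof (rule integral_dominated_convergence[where w="\<lambda>_. 1 / (1 - R)\<^sup>2"])
      show "AE t in angle_measure. (\<lambda>n. indicator A t * poisson (s n) (cis t)) \<longlonglongrightarrow> indicator A t * poisson a (cis t)"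
      proof (rule AE_I2)
        fix t
        have "cmod (cis t - a) \<noteq> 0"
          using cmod_circle_diff_ge[of "cis t" a] a R by auto
        then show "(\<lambda>n. indicator A t * poisson (s n) (cis t)) \<longlonglongrightarrow> indicator A t * poisson a (cis t)"
          unfolding poisson_def by (intro tendsto_intros lim) auto
      qed
      fix n
      have "\<bar>poisson (s n) (cis t)\<bar> \<le> 1 / (1 - R)\<^sup>2" for t
        using s R poisson_le[of "cis t" "s n" R] poisson_nonneg[of "s n" "cis t"] by (auto simp: abs_of_nonneg order_trans[of _ R 1])
      then show "AE t in angle_measure. norm (indicator A t * poisson (s n) (cis t)) \<le> 1 / (1 - R)\<^sup>2"
        by (auto simp: indicator_def)
    qed simp_all
  qed
qed

lemma cmean_poisson_int:
  assumes A [measurable]: "A \<in> sets borel" and z: "cball z \<rho> \<subseteq> ball 0 1" "0 < \<rho>"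
  shows "cmean (poisson_int A) z \<rho> = poisson_int A z"
proof -
  obtain R where R: "R < 1" "\<And>y. y \<in> cball z \<rho> \<Longrightarrow> cmod y \<le> R"
    using cball_in_unit_ball[OF z] by blast
  interpret P: pair_sigma_finite angle_measure angle_measure ..
  interpret PP: pair_prob_space angle_measure angle_measure ..
  define f where "f = (\<lambda>(s, t). indicator A t * poisson (z + of_real \<rho> * cis s) (cis t))"
  have m: "f \<in> borel_measurable (angle_measure \<Otimes>\<^sub>M angle_measure)"
    unfolding f_def poisson_def split_beta' by measurable
  have cm: "cmod (z + of_real \<rho> * cis s) \<le> R" for s
    using z(2) by (intro R(2)) (simp add: dist_norm norm_mult)
  have bd: "norm (f p) \<le> 1 / (1 - R)\<^sup>2" for p
  proof (cases p)
    case (Pair s t)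
    have "0 \<le> poisson (z + of_real \<rho> * cis s) (cis t)"
      using cm[of s] R(1) by (intro poisson_nonneg) auto
    then show ?thesis
      using poisson_le[OF _ cm[of s] R(1), of "cis t"] by (simp add: f_def Pair indicator_def)
  qed
  have int: "integrable (angle_measure \<Otimes>\<^sub>M angle_measure) f"
    by (rule PP.integrable_const_bound[OF _ m, where B="1 / (1 - R)\<^sup>2"]) (use bd in auto)
  have "cmean (poisson_int A) z \<rho> = (LINT s|angle_measure. LINT t|angle_measure. f (s, t))"
    by (simp add: cmean_def poisson_int_def f_def)
  also have "\<dots> = (LINT t|angle_measure. LINT s|angle_measure. f (s, t))"
    using P.Fubini_integral[of "\<lambda>s t. f (s, t)"] int by simp
  also have "\<dots> = (LINT t|angle_measure. indicator A t * cmean (\<lambda>z. poisson z (cis t)) z \<rho>)"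
    by (simp add: f_def cmean_def)
  also have "\<dots> = poisson_int A z"
    using poisson_mean_value[OF _ z] by (simp add: poisson_int_def)
  finally show ?thesis .
qed


subsection \<open>Unavoidable bubbles and the strong maximum principle\<close>

definition submean_disc :: "(complex \<Rightarrow> real) \<Rightarrow> bool" where
  "submean_disc w \<longleftrightarrow> (\<forall>z \<rho>. 0 < \<rho> \<longrightarrow> cball z \<rho> \<subseteq> ball 0 1 \<longrightarrow> w z \<le> cmean w z \<rho>)"

text \<open>Every \<open>v\<close> in the upper class satisfies \<open>w - c \<le> v\<close> off
  \<open>E\<close>: at the unit circle because \<open>w\<close> is at most 1, at the boundary of
  \<open>E\<close> because \<open>w\<close> is at most \<open>c\<close> there. The infimum over all
  \<open>v\<close> is the harmonic measure of the circle, which vanishes.\<close>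

lemma unavoidable_subharmonic_le:
  assumes un: "unavoidable E" and E: "open (ball 0 1 - E)"
    and w: "continuous_on (ball 0 1) w" "submean_disc w"
    and w1: "\<And>z. z \<in> ball 0 1 \<Longrightarrow> w z \<le> 1"
    and c: "0 \<le> c" "\<And>z. z \<in> ball 0 1 \<inter> E \<Longrightarrow> w z \<le> c"
    and z: "z \<in> ball 0 1"
  shows "w z \<le> c"
proof (cases "z \<in> E")
  case True
  then show ?thesis using c z by blast
next
  case False
  define \<Omega> where "\<Omega> = ball 0 1 - E"
  have z\<Omega>: "z \<in> \<Omega>" using z False by (simp add: \<Omega>_def)
  have op: "open \<Omega>" using E by (simp add: \<Omega>_def)
  have "ereal (w z - c) \<le> v z" if v: "v \<in> upper_class \<Omega> (\<lambda>y. ereal (indicator (sphere 0 1) y))" for v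
  proof (rule hyperharmonic_minimum_principle[where \<Omega>=\<Omega> and v=v and w="\<lambda>z. w z - c"])
    have hyp: "hyperharmonic_on \<Omega> v" using v by (simp add: upper_class_def)
    show "bounded \<Omega>" by (rule bounded_subset[OF bounded_ball[of 0 1]]) (auto simp: \<Omega>_def)
    show "continuous_on \<Omega> (\<lambda>z. w z - c)"
      by (intro continuous_intros continuous_on_subset[OF w(1)]) (auto simp: \<Omega>_def)
    fix p assume p: "p \<in> \<Omega>"
    show "v p \<le> Liminf (at p within \<Omega>) v" "v p \<noteq> -\<infinity>"
      using hyp p by (auto simp: hyperharmonic_on_def)
    have ev: "\<forall>\<^sub>F \<rho> in at_right 0. 0 < \<rho> \<and> cball p \<rho> \<subseteq> \<Omega>"
      by (rule eventually_cball_subset[OF op p])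
    then show "\<forall>\<^sub>F \<rho> in at_right 0. circle_mean v p \<rho> \<le> v p"
      by eventually_elim (use hyp in \<open>auto simp: hyperharmonic_on_def\<close>)
    show "\<forall>\<^sub>F \<rho> in at_right 0. w p - c \<le> cmean (\<lambda>z. w z - c) p \<rho>"
      using ev
    proof eventually_elim
      case (elim \<rho>)
      then have sub: "cball p \<rho> \<subseteq> ball 0 1" by (auto simp: \<Omega>_def)
      have "cmean (\<lambda>z. w z - c) p \<rho> = cmean w p \<rho> - c"
        using elim by (subst cmean_diff) (auto intro: continuous_on_sphere_in_ball[OF w(1) sub])
      then show ?case using w(2) sub elim by (simp add: submean_disc_def)
    qed
  next
    fix y and \<epsilon> :: real assume y: "y \<in> frontier \<Omega>" and \<epsilon>: "0 < \<epsilon>"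
    have lim: "ereal (indicator (sphere 0 1) y) \<le> Liminf (at y within \<Omega>) v"
      using v y by (simp add: upper_class_def)
    have "y \<notin> \<Omega>" using y op by (simp add: frontier_def interior_open)
    have "y \<in> closure (ball 0 1)"
      using y closure_mono[of \<Omega> "ball 0 1"] by (auto simp: \<Omega>_def frontier_def)
    then have y1: "cmod y \<le> 1" by simp
    show "\<forall>\<^sub>F z in at y within \<Omega>. ereal (w z - c - \<epsilon>) \<le> v z"
    proof (cases "cmod y = 1")
      case True
      then have "\<forall>\<^sub>F z in at y within \<Omega>. ereal (1 - \<epsilon>) < v z"
        using lim \<epsilon> unfolding le_Liminf_iff by auto
      moreover have "\<forall>\<^sub>F z in at y within \<Omega>. z \<in> \<Omega>"
        by (simp add: eventually_at_filter)
      ultimately show ?thesis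
      proof eventually_elim
        case (elim z)
        have "w z - c - \<epsilon> \<le> 1 - \<epsilon>" using w1[of z] elim c(1) by (simp add: \<Omega>_def)
        then show ?case using elim by (meson ereal_less_eq(3) less_imp_le order_trans)
      qed
    next
      case False
      then have yb: "y \<in> ball 0 1" using y1 by simp
      then have "w y \<le> c" using c \<open>y \<notin> \<Omega>\<close> by (simp add: \<Omega>_def)
      have "(w \<longlongrightarrow> w y) (at y)"
        using w(1) yb by (simp add: continuous_on_eq_continuous_at isCont_def)
      then have "(w \<longlongrightarrow> w y) (at y within \<Omega>)"
        by (rule tendsto_within_subset) simp
      then have "\<forall>\<^sub>F z in at y within \<Omega>. w z < c + \<epsilon> / 2"
        using \<open>w y \<le> c\<close> \<epsilon> by (intro order_tendstoD(2)[where y="w y"]) auto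
      moreover have "\<forall>\<^sub>F z in at y within \<Omega>. ereal (- \<epsilon> / 2) < v z"
        using lim \<epsilon> False unfolding le_Liminf_iff by (auto simp: indicator_def)
      ultimately show ?thesis
      proof eventually_elim
        case (elim z)
        then have "w z - c - \<epsilon> \<le> - \<epsilon> / 2" by simp
        then show ?case using elim by (meson ereal_less_eq(3) less_imp_le order_trans)
      qed
    qed
  qed (use op z\<Omega> in auto)
  then have "ereal (w z - c) \<le> harmonic_measure \<Omega> z (sphere 0 1)"
    unfolding harmonic_measure_def upper_solution_def by (intro INF_greatest)
  also have "\<dots> = 0" using un z\<Omega> by (simp add: unavoidable_def \<Omega>_def)
  finally show ?thesis by simp
qed

text \<open>Each point near a maximum point lies on a circle around it, and there the nonnegative
  function \<open>c - w\<close> has mean at most 0. So the set where the maximum is attained is open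
  as well as closed in the disc.\<close>

lemma strong_maximum_principle:
  assumes w: "continuous_on (ball 0 1) w" "submean_disc w"
    and le: "\<And>z. z \<in> ball 0 1 \<Longrightarrow> w z \<le> c"
    and p: "p \<in> ball 0 1" "w p = c" and z: "z \<in> ball 0 1"
  shows "w z = c"
proof -
  define Z where "Z = {z \<in> ball 0 1. w z = c}"
  have "closedin (top_of_set (ball 0 1)) Z"
    unfolding Z_def by (rule continuous_closedin_preimage_constant[OF w(1)])
  moreover have "open Z"
    unfolding open_contains_cball
  proof
    fix q assume q: "q \<in> Z"
    then have "q \<in> ball 0 1" by (simp add: Z_def)
    then obtain R where R: "R > 0" "cball q R \<subseteq> ball 0 1"
      using open_ball open_contains_cball by blast
    have "y \<in> Z" if y: "y \<in> cball q R" for y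
    proof (cases "y = q")
      case True
      then show ?thesis using q by simp
    next
      case False
      define \<rho> where "\<rho> = dist q y"
      have \<rho>: "0 < \<rho>" "cball q \<rho> \<subseteq> ball 0 1"
        using False y R subset_cball[of \<rho> R q] by (auto simp: \<rho>_def)
      have cs: "continuous_on (sphere q \<rho>) w" by (rule continuous_on_sphere_in_ball[OF w(1) \<rho>(2)])
      have sph: "sphere q \<rho> \<subseteq> ball 0 1" using \<rho>(2) sphere_cball by blast
      have "c - w y = 0"
      proof (rule cmean_nonneg_eq_0[where f="\<lambda>y. c - w y" and z=q and \<rho>=\<rho>])
        show "continuous_on (sphere q \<rho>) (\<lambda>y. c - w y)" by (intro continuous_intros cs)
        show "0 \<le> c - w y" if "y \<in> sphere q \<rho>" for y using le[of y] that sph by auto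
        have "cmean (\<lambda>y. c - w y) q \<rho> = c - cmean w q \<rho>"
          using \<rho>(1) cs by (subst cmean_diff) auto
        moreover have "w q \<le> cmean w q \<rho>" using w(2) \<rho> unfolding submean_disc_def by blast
        ultimately show "cmean (\<lambda>y. c - w y) q \<rho> \<le> 0" using q by (simp add: Z_def)
      qed (use \<rho>(1) in \<open>auto simp: \<rho>_def\<close>)
      then show ?thesis using y R by (auto simp: Z_def)
    qed
    then show "\<exists>e>0. cball q e \<subseteq> Z" using R by blast
  qed
  moreover have "Z \<subseteq> ball 0 1" by (auto simp: Z_def)
  ultimately have "openin (top_of_set (ball 0 1)) Z \<and> closedin (top_of_set (ball 0 1)) Z"
    by (simp add: open_subset)
  then have "Z = {} \<or> Z = ball 0 1"
    using connected_ball[of "0::complex" 1] unfolding connected_clopen by blast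
  moreover have "p \<in> Z" using p by (simp add: Z_def)
  ultimately have "z \<in> Z" using z by blast
  then show ?thesis by (simp add: Z_def)
qed

subsection \<open>Necessity of divergence\<close>

definition bubble_term :: "(nat \<Rightarrow> complex) \<Rightarrow> (nat \<Rightarrow> real) \<Rightarrow> nat \<Rightarrow> complex \<Rightarrow> real" where
  "bubble_term x r k y = (1 - cmod (x k))\<^sup>2 / (cmod (y - x k))\<^sup>2 * inverse (ln ((1 - cmod (x k)) / r k))"

lemma measurable_bubble_term [measurable]: "bubble_term x r k \<in> borel_measurable borel"
  unfolding bubble_term_def[abs_def] by measurable

lemma bubble_term_bounds:
  assumes ch: "champagne x r" and y: "cmod y = 1"
  shows "0 \<le> bubble_term x r k y" "bubble_term x r k y \<le> inverse (ln ((1 - cmod (x k)) / r k))"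
proof -
  have l: "0 < ln ((1 - cmod (x k)) / r k)" by (rule champagne_log_pos[OF ch])
  then show "0 \<le> bubble_term x r k y" by (simp add: bubble_term_def)
  have x: "cmod (x k) < 1" using champagne_bubble[OF ch] by simp
  have "(1 - cmod (x k))\<^sup>2 \<le> (cmod (y - x k))\<^sup>2"
    using x by (intro power_mono cmod_circle_diff_ge[OF y]) auto
  then have "(1 - cmod (x k))\<^sup>2 / (cmod (y - x k))\<^sup>2 \<le> 1"
    by (simp add: divide_le_eq_1)
  then show "bubble_term x r k y \<le> inverse (ln ((1 - cmod (x k)) / r k))"
    unfolding bubble_term_def using l by (intro mult_left_le_one_le) auto
qed

lemma integrable_bubble_term:
  assumes ch: "champagne x r" and [measurable]: "A \<in> sets borel"
  shows "integrable angle_measure (\<lambda>t. indicator A t * bubble_term x r k (cis t))"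
proof (rule angle.integrable_const_bound)
  show "AE t in angle_measure. norm (indicator A t * bubble_term x r k (cis t)) \<le> inverse (ln ((1 - cmod (x k)) / r k))"
    using bubble_term_bounds[OF ch, of "cis t" k for t] champagne_log_pos[OF ch, of k]
    by (intro AE_I2) (auto simp: indicator_def)
qed measurable

text \<open>The link between potential and series: integrated over a set \<open>A\<close> of angles,
  it bounds \<open>poisson_int A (x k)\<close> times the natural weight of the k-th Green function
  by the integral of the k-th term of the series.\<close>

lemma poisson_le_bubble_term:
  assumes ch: "champagne x r"
  shows "poisson (x k) y * (1 - cmod (x k)) / ln ((1 - cmod (x k)) / r k) \<le> 2 * bubble_term x r k y"
proof -
  have l: "0 < ln ((1 - cmod (x k)) / r k)" by (rule champagne_log_pos[OF ch])
  have x: "cmod (x k) < 1" using champagne_bubble[OF ch] by simp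
  have "(1 - (cmod (x k))\<^sup>2) * (1 - cmod (x k)) = (1 - cmod (x k))\<^sup>2 * (1 + cmod (x k))"
    by (simp add: power2_eq_square algebra_simps)
  also have "\<dots> \<le> (1 - cmod (x k))\<^sup>2 * 2" using x by (intro mult_left_mono) auto
  finally have "(1 - (cmod (x k))\<^sup>2) * (1 - cmod (x k)) / (cmod (y - x k))\<^sup>2 \<le> (1 - cmod (x k))\<^sup>2 * 2 / (cmod (y - x k))\<^sup>2"
    by (intro divide_right_mono) auto
  then have "(1 - (cmod (x k))\<^sup>2) * (1 - cmod (x k)) / (cmod (y - x k))\<^sup>2 / ln ((1 - cmod (x k)) / r k)
      \<le> (1 - cmod (x k))\<^sup>2 * 2 / (cmod (y - x k))\<^sup>2 / ln ((1 - cmod (x k)) / r k)"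
    by (rule divide_right_mono[OF _ less_imp_le[OF l]])
  then show ?thesis by (simp add: poisson_def bubble_term_def field_simps)
qed

text \<open>Uniform convergence on smaller discs carries the mean inequality of the partial sums to
  the limit, with an error that can be made arbitrarily small.\<close>

lemma superharmonic_series:
  fixes g :: "nat \<Rightarrow> complex \<Rightarrow> real"
  assumes g: "\<And>k. continuous_on (ball 0 1) (g k)" "\<And>k z. cmod z < 1 \<Longrightarrow> 0 \<le> g k z"
      "\<And>k. submean_disc (\<lambda>z. - g k z)"
    and unif: "\<And>R. R < 1 \<Longrightarrow> uniform_limit (cball 0 R) (\<lambda>n z. \<Sum>k<n. g k z) u sequentially"
  shows "continuous_on (ball 0 1) u" "\<And>n z. cmod z < 1 \<Longrightarrow> (\<Sum>k<n. g k z) \<le> u z"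
    "submean_disc (\<lambda>z. - u z)"
proof -
  show ucont: "continuous_on (ball 0 1) u"
  proof (rule continuous_on_unit_ball)
    fix R :: real assume R: "R < 1"
    show "continuous_on (cball 0 R) u"
    proof (rule uniform_limit_theorem[OF _ unif[OF R]])
      show "\<forall>\<^sub>F n in sequentially. continuous_on (cball 0 R) (\<lambda>z. \<Sum>k<n. g k z)"
        using R by (intro always_eventually allI continuous_on_sum continuous_on_subset[OF g(1)]) auto
    qed simp
  qed
  show upart: "(\<Sum>k<n. g k z) \<le> u z" if z: "cmod z < 1" for n z
  proof -
    have "(\<lambda>n. \<Sum>k<n. g k z) \<longlonglongrightarrow> u z"
      using tendsto_uniform_limitI[OF unif[OF z], of z] by simp
    moreover have "incseq (\<lambda>n. \<Sum>k<n. g k z)" using g(2)[OF z] by (intro incseq_SucI) simp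
    ultimately show ?thesis by (rule incseq_le[rotated])
  qed
  have umean: "cmean u z \<rho> \<le> u z" if z: "cball z \<rho> \<subseteq> ball 0 1" "0 < \<rho>" for z \<rho>
  proof (rule field_le_epsilon)
    fix e :: real assume e: "e > 0"
    obtain R where R: "R < 1" "\<And>y. y \<in> cball z \<rho> \<Longrightarrow> cmod y \<le> R"
      using cball_in_unit_ball[OF z] by blast
    obtain n where n: "\<And>y. y \<in> cball 0 R \<Longrightarrow> dist (\<Sum>k<n. g k y) (u y) < e"
      using uniform_limitD[OF unif[OF R(1)] e] unfolding eventually_sequentially by blast
    have cg: "continuous_on (sphere z \<rho>) (g k)" for k by (rule continuous_on_sphere_in_ball[OF g(1) z(1)])
    have cS: "continuous_on (sphere z \<rho>) (\<lambda>y. \<Sum>k<n. g k y)" by (intro continuous_on_sum cg)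
    have "cmean u z \<rho> \<le> cmean (\<lambda>y. (\<Sum>k<n. g k y) + e) z \<rho>"
    proof (rule cmean_mono)
      show "u y \<le> (\<Sum>k<n. g k y) + e" if "y \<in> sphere z \<rho>" for y
        using n[of y] R(2)[of y] that by (auto simp: dist_real_def abs_less_iff)
      show "continuous_on (sphere z \<rho>) u" by (rule continuous_on_sphere_in_ball[OF ucont z(1)])
      show "continuous_on (sphere z \<rho>) (\<lambda>y. (\<Sum>k<n. g k y) + e)" by (intro continuous_intros cS)
    qed (use z in simp)
    also have "\<dots> = (\<Sum>k<n. cmean (g k) z \<rho>) + e"
      using z(2) cg cS by (simp add: cmean_add cmean_sum)
    also have "\<dots> \<le> (\<Sum>k<n. g k z) + e"
      using g(3) z cmean_mult[of "-1"] by (intro add_right_mono sum_mono) (simp add: submean_disc_def)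
    also have "\<dots> \<le> u z + e"
      using upart[of z n] z by (auto simp: subset_iff)
    finally show "cmean u z \<rho> \<le> u z + e" .
  qed
  then show "submean_disc (\<lambda>z. - u z)"
    using cmean_mult[of "-1" u] by (simp add: submean_disc_def)
qed

lemma unavoidable_imp_divergent:
  assumes ch: "champagne x r" and un: "unavoidable (bubbles x r)"
  shows "AE t in angle_measure. (\<Sum>k. ennreal (bubble_term x r k (cis t))) = \<infinity>"
proof (rule ccontr)
  assume nAE: "\<not> ?thesis"
  define S where "S t = (\<Sum>k. ennreal (bubble_term x r k (cis t)))" for t
  have S [measurable]: "S \<in> borel_measurable borel" unfolding S_def by measurable
  obtain n :: nat where n: "emeasure angle_measure {t. S t \<le> of_nat n} \<noteq> 0"
    using ex_positive_sublevel[of S angle_measure] nAE by (auto simp: S_def[symmetric])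
  define A where "A = {t. S t \<le> of_nat n}"
  have A [measurable]: "A \<in> sets borel" unfolding A_def by measurable
  have Apos: "0 < measure angle_measure A"
    using n by (simp add: A_def angle.emeasure_eq_measure zero_less_measure_iff)
  \<comment> \<open>These numbers are summable because the series is at most \<open>n\<close> on
    \<open>A\<close>; they dominate the coefficients of the potential.\<close>
  define \<beta> where "\<beta> k = (LINT t|angle_measure. indicator A t * bubble_term x r k (cis t))" for k
  have \<beta>0: "0 \<le> \<beta> k" for k
    unfolding \<beta>_def by (intro integral_nonneg_AE AE_I2 mult_nonneg_nonneg bubble_term_bounds[OF ch]) auto
  have \<beta>nn: "ennreal (\<beta> k) = (\<integral>\<^sup>+ t. indicator A t * ennreal (bubble_term x r k (cis t)) \<partial>angle_measure)" for k
  proof -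
    have "ennreal (\<beta> k) = (\<integral>\<^sup>+ t. ennreal (indicator A t * bubble_term x r k (cis t)) \<partial>angle_measure)"
      unfolding \<beta>_def
      by (intro nn_integral_eq_integral[symmetric] integrable_bubble_term[OF ch A] AE_I2 mult_nonneg_nonneg bubble_term_bounds[OF ch]) auto
    also have "\<dots> = (\<integral>\<^sup>+ t. indicator A t * ennreal (bubble_term x r k (cis t)) \<partial>angle_measure)"
      by (intro nn_integral_cong) (auto simp: indicator_def)
    finally show ?thesis .
  qed
  have "(\<Sum>k. ennreal (\<beta> k)) = (\<integral>\<^sup>+ t. indicator A t * S t \<partial>angle_measure)"
    unfolding \<beta>nn S_def by (subst nn_integral_suminf[symmetric]) (auto simp: ennreal_suminf_cmult)
  also have "\<dots> \<le> (\<integral>\<^sup>+ t. of_nat n \<partial>angle_measure)"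
    by (intro nn_integral_mono) (auto simp: indicator_def A_def)
  also have "\<dots> = of_nat n"
    using angle.emeasure_space_1 by simp
  finally have "(\<Sum>k. ennreal (\<beta> k)) \<noteq> \<infinity>"
    by (metis ennreal_of_nat_neq_top infinity_ennreal_def top.extremum_unique)
  then have \<beta>sum: "summable \<beta>"
    using summable_suminf_not_top[OF \<beta>0] by (simp add: infinity_ennreal_def)
  obtain c where c: "0 < c" "c < 1" "\<And>k. r k \<le> c * (1 - cmod (x k))"
    using champagne_ratio[OF ch] by blast
  \<comment> \<open>The constant of \<open>poisson_int_harnack\<close>: \<open>C * h (x k)\<close>
    dominates \<open>h\<close> on the whole k-th bubble.\<close>
  define C where "C = 4 / (1 - c)\<^sup>2"
  have C: "C > 0" using c by (simp add: C_def)
  define lam where "lam k = ln ((1 - cmod (x k)) / r k)" for k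
  have lam: "lam k > 0" for k unfolding lam_def by (rule champagne_log_pos[OF ch])
  define h where "h = poisson_int A"
  have x: "cmod (x k) < 1" for k using champagne_bubble[OF ch] by simp
  have hx0: "0 \<le> h (x k)" for k unfolding h_def by (rule poisson_int_nonneg[OF x])
  have hx: "h (x k) * (1 - cmod (x k)) / lam k \<le> 2 * \<beta> k" for k
  proof -
    have "h (x k) * (1 - cmod (x k)) / lam k
        = (LINT t|angle_measure. (indicator A t * poisson (x k) (cis t)) * ((1 - cmod (x k)) / lam k))"
      by (simp add: h_def poisson_int_def)
    also have "\<dots> \<le> (LINT t|angle_measure. 2 * (indicator A t * bubble_term x r k (cis t)))"
    proof (intro integral_mono integrable_mult_left integrable_mult_right integrable_poisson_int[OF A x] integrable_bubble_term[OF ch A])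
      show "indicator A t * poisson (x k) (cis t) * ((1 - cmod (x k)) / lam k) \<le> 2 * (indicator A t * bubble_term x r k (cis t))" for t
        using poisson_le_bubble_term[OF ch, of k "cis t"] by (simp add: indicator_def lam_def)
    qed
    finally show ?thesis by (simp add: \<beta>_def)
  qed
  \<comment> \<open>With this level \<open>tgreen (x k) (m k)\<close> equals 1 on the entire bubble,
    by \<open>cmod_blaschke_le\<close>, and \<open>- ln (m k)\<close> is exactly
    \<open>lam k\<close>.\<close>
  define m where "m k = r k / (1 - cmod (x k))" for k
  have m: "0 < m k" "m k < 1" for k
    using champagne_bubble[OF ch, of k] champagne_radius[OF ch, of k] by (auto simp: m_def)
  have lnm: "- ln (m k) = lam k" for k
    using champagne_bubble[OF ch, of k] by (simp add: m_def lam_def ln_div)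
  define g where "g k z = C * h (x k) * tgreen (x k) (m k) z" for k z
  have g0: "0 \<le> g k z" if "cmod z < 1" for k z
    unfolding g_def using C hx0 tgreen_nonneg[OF x that m] by simp
  have gle: "g k z \<le> 8 * C * \<beta> k / (cmod (z - x k))\<^sup>2" if z: "cmod z < 1" "z \<noteq> x k" for k z
  proof -
    have "tgreen (x k) (m k) z \<le> (1 - (cmod (x k))\<^sup>2) * (1 - (cmod z)\<^sup>2) / (cmod (z - x k))\<^sup>2 / lam k"
      using tgreen_le_ratio[OF x z m] by (simp add: lnm)
    also have "\<dots> \<le> (2 * (1 - cmod (x k))) * 1 / (cmod (z - x k))\<^sup>2 / lam k"
    proof (intro divide_right_mono mult_mono)
      have "(1 - cmod (x k)) * (1 + cmod (x k)) \<le> (1 - cmod (x k)) * 2"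
        using x[of k] by (intro mult_left_mono) auto
      then show "1 - (cmod (x k))\<^sup>2 \<le> 2 * (1 - cmod (x k))" by (simp add: power2_eq_square algebra_simps)
    qed (use x[of k] z lam[of k] in \<open>auto simp: power_le_one_iff\<close>)
    finally have "h (x k) * tgreen (x k) (m k) z \<le> h (x k) * ((2 * (1 - cmod (x k))) * 1 / (cmod (z - x k))\<^sup>2 / lam k)"
      by (rule mult_left_mono[OF _ hx0])
    also have "\<dots> = 2 * (h (x k) * (1 - cmod (x k)) / lam k) / (cmod (z - x k))\<^sup>2" by (simp add: algebra_simps)
    also have "\<dots> \<le> 2 * (2 * \<beta> k) / (cmod (z - x k))\<^sup>2"
      by (intro divide_right_mono mult_left_mono hx) auto
    also have "\<dots> \<le> 8 * \<beta> k / (cmod (z - x k))\<^sup>2"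
      using \<beta>0[of k] by (intro divide_right_mono) auto
    finally have "C * (h (x k) * tgreen (x k) (m k) z) \<le> C * (8 * \<beta> k / (cmod (z - x k))\<^sup>2)"
      using C by (intro mult_left_mono) auto
    then show ?thesis by (simp add: g_def mult_ac)
  qed
  have gcont: "continuous_on (ball 0 1) (g k)" for k
    unfolding g_def by (intro continuous_intros continuous_on_tgreen x m)
  have gmean: "cmean (g k) z \<rho> \<le> g k z" if z: "cball z \<rho> \<subseteq> ball 0 1" "0 < \<rho>" for k z \<rho>
  proof -
    have "cmean (tgreen (x k) (m k)) z \<rho> \<le> tgreen (x k) (m k) z"
    proof (rule superharmonic_mean_le)
      show "continuous_on (cball z \<rho>) (tgreen (x k) (m k))"
        using continuous_on_subset[OF continuous_on_tgreen[OF x m] z(1)] .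
      show "superharmonic_at (tgreen (x k) (m k)) y" if "y \<in> ball z \<rho>" for y
        using that z ball_subset_cball by (intro superharmonic_at_tgreen x m) (auto simp: subset_iff)
    qed fact
    then have "C * h (x k) * cmean (tgreen (x k) (m k)) z \<rho> \<le> C * h (x k) * tgreen (x k) (m k) z"
      using C hx0 by (intro mult_left_mono) auto
    then show ?thesis unfolding g_def by (simp add: cmean_mult)
  qed
  \<comment> \<open>With all centres of the tail outside radius 1/2, \<open>g (k + N) 0\<close> is
    at most 32 C times the corresponding \<open>\<beta>\<close>. The denominator 64 C therefore
    makes the potential at 0 at most half of \<open>h 0\<close>.\<close>
  obtain N1 where N1: "\<And>j. j \<ge> N1 \<Longrightarrow> norm (\<Sum>i. \<beta> (i + j)) < measure angle_measure A / (64 * C)"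
    using suminf_exist_split[OF _ \<beta>sum, of "measure angle_measure A / (64 * C)"] Apos C by auto
  have "\<forall>\<^sub>F k in sequentially. 1/2 < cmod (x k)"
    using ch by (intro order_tendstoD(1)[of _ 1]) (auto simp: champagne_def)
  then obtain N2 where N2: "\<And>k. k \<ge> N2 \<Longrightarrow> 1/2 < cmod (x k)"
    by (auto simp: eventually_sequentially)
  \<comment> \<open>The 1 ensures that at least one bubble precedes the tail, so that the compact
    set \<open>F\<close> below is nonempty.\<close>
  define N where "N = max 1 (max N1 N2)"
  have N: "1 \<le> N" "norm (\<Sum>i. \<beta> (i + N)) < measure angle_measure A / (64 * C)" "\<And>k. 1/2 < cmod (x (k + N))"
    using N1[of N] N2[of "_ + N"] by (auto simp: N_def)
  define u where "u z = (\<Sum>k. g (k + N) z)" for z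
  have \<beta>N: "summable (\<lambda>k. \<beta> (k + N))" using \<beta>sum by (simp add: summable_iff_shift)
  have unif: "uniform_limit (cball 0 R) (\<lambda>n z. \<Sum>k<n. g (k + N) z) u sequentially" if R: "R < 1" for R
    unfolding u_def
  proof (rule Weierstrass_m_test_ev)
    define M where "M k = 8 * C * \<beta> (k + N) / ((1 - R) / 2)\<^sup>2" for k
    show "summable M"
      unfolding M_def using \<beta>N by (intro summable_divide summable_mult) auto
    have "(\<lambda>k. cmod (x (k + N))) \<longlonglongrightarrow> 1"
      using ch by (intro LIMSEQ_ignore_initial_segment) (simp add: champagne_def)
    then have "\<forall>\<^sub>F k in sequentially. (1 + R) / 2 < cmod (x (k + N))"
      using R by (intro order_tendstoD(1)) auto
    then show "\<forall>\<^sub>F k in sequentially. \<forall>z\<in>cball 0 R. norm (g (k + N) z) \<le> M k"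
    proof eventually_elim
      case (elim k)
      show ?case
      proof
        fix z :: complex assume z: "z \<in> cball 0 R"
        then have z1: "cmod z < 1" using R by simp
        have "(1 - R) / 2 \<le> cmod (x (k + N)) - cmod z" using elim z by (simp add: field_simps)
        also have "\<dots> \<le> cmod (z - x (k + N))"
          using norm_triangle_ineq2[of "x (k + N)" z] by (simp add: norm_minus_commute)
        finally have d: "(1 - R) / 2 \<le> cmod (z - x (k + N))" .
        then have "z \<noteq> x (k + N)" using R by auto
        from gle[OF z1 this]
        have "g (k + N) z \<le> 8 * C * \<beta> (k + N) / (cmod (z - x (k + N)))\<^sup>2" .
        also have "\<dots> \<le> M k"
          unfolding M_def using d R C \<beta>0 by (intro divide_left_mono power_mono mult_pos_pos) auto
        finally show "norm (g (k + N) z) \<le> M k" using g0[OF z1] by simp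
      qed
    qed
  qed
  have gsup: "submean_disc (\<lambda>z. - g k z)" for k
    using gmean cmean_mult[of "-1" "g k"] by (simp add: submean_disc_def)
  have gN: "0 \<le> g (k + N) z" if "cmod z < 1" for k z by (rule g0[OF that])
  have ucont: "continuous_on (ball 0 1) u"
    by (rule superharmonic_series(1)[OF gcont gN gsup unif])
  have umean: "submean_disc (\<lambda>z. - u z)"
    by (rule superharmonic_series(3)[OF gcont gN gsup unif])
  have upart: "(\<Sum>k<n. g (k + N) z) \<le> u z" if z: "cmod z < 1" for n z
  proof (rule superharmonic_series(2)[where g="\<lambda>k. g (k + N)"])
    show "uniform_limit (cball 0 R) (\<lambda>n z. \<Sum>k<n. g (k + N) z) u sequentially" if "R < 1" for R
      by (rule unif[OF that])
  qed (fact gcont gN gsup z)+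
  have usum: "summable (\<lambda>k. g (k + N) z)" if z: "cmod z < 1" for z
    using tendsto_uniform_limitI[OF unif[OF z], of z] by (auto simp: summable_iff_convergent convergent_def)
  have u0: "0 \<le> u z" if z: "cmod z < 1" for z
    using upart[OF z, of 0] by simp
  have uzero: "u 0 < measure angle_measure A"
  proof -
    have "u 0 \<le> (\<Sum>k. 32 * C * \<beta> (k + N))"
      unfolding u_def
    proof (rule suminf_le)
      show "g (k + N) 0 \<le> 32 * C * \<beta> (k + N)" for k
      proof -
        have "(1/2)\<^sup>2 \<le> (cmod (x (k + N)))\<^sup>2" using N(3)[of k] by (intro power_mono) auto
        then have q: "1 / (cmod (x (k + N)))\<^sup>2 \<le> 4"
          using N(3)[of k] by (subst divide_le_eq) (auto simp: power2_eq_square)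
        have "x (k + N) \<noteq> 0" using N(3)[of k] by auto
        then have "g (k + N) 0 \<le> 8 * C * \<beta> (k + N) / (cmod (x (k + N)))\<^sup>2"
          using gle[of 0 "k + N"] by simp
        also have "\<dots> = 8 * C * \<beta> (k + N) * (1 / (cmod (x (k + N)))\<^sup>2)" by simp
        also have "\<dots> \<le> 8 * C * \<beta> (k + N) * 4"
          using q C \<beta>0 by (intro mult_left_mono) auto
        finally show ?thesis by simp
      qed
      show "summable (\<lambda>k. g (k + N) 0)" by (rule usum) simp
      show "summable (\<lambda>k. 32 * C * \<beta> (k + N))" by (intro summable_mult \<beta>N)
    qed
    also have "\<dots> = 32 * C * (\<Sum>k. \<beta> (k + N))" by (rule suminf_mult[OF \<beta>N])
    also have "\<dots> \<le> 32 * C * (measure angle_measure A / (64 * C))"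
      using N(2) C by (intro mult_left_mono) auto
    also have "\<dots> = measure angle_measure A / 2" using C by (simp add: field_simps)
    also have "\<dots> < measure angle_measure A" using Apos by simp
    finally show ?thesis .
  qed
  define w where "w z = h z - u z" for z
  have hcont: "continuous_on (ball 0 1) h" unfolding h_def by (rule continuous_on_poisson_int[OF A])
  have wcont: "continuous_on (ball 0 1) w" unfolding w_def by (intro continuous_intros hcont ucont)
  have wsub: "submean_disc w"
    unfolding submean_disc_def
  proof (intro allI impI)
    fix z :: complex and \<rho> :: real assume z: "0 < \<rho>" "cball z \<rho> \<subseteq> ball 0 1"
    have "cmean w z \<rho> = cmean h z \<rho> - cmean u z \<rho>"
      unfolding w_def using z
      by (intro cmean_diff continuous_on_sphere_in_ball[OF hcont] continuous_on_sphere_in_ball[OF ucont]) auto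
    then show "w z \<le> cmean w z \<rho>"
      using umean z cmean_poisson_int[OF A z(2,1)] cmean_mult[of "-1" u]
      by (simp add: w_def h_def submean_disc_def)
  qed
  have w1: "w z \<le> 1" if "z \<in> ball 0 1" for z
    using poisson_int_le_1[OF A, of z] u0[of z] that by (simp add: w_def h_def)
  have wneg: "w z \<le> 0" if z: "z \<in> cball (x k) (r k)" and k: "N \<le> k" for z k
  proof -
    have zb: "cmod z < 1" using z champagne_bubble_subset[OF ch, of k] by auto
    have zx: "cmod (z - x k) \<le> r k" using z by (simp add: dist_norm norm_minus_commute)
    have "cmod (blaschke (x k) z) \<le> r k / (1 - cmod (x k))"
      using cmod_blaschke_le[OF x zb, of k] zx x[of k] by (meson diff_gt_0_iff_gt divide_right_mono less_imp_le order_trans)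
    then have "tgreen (x k) (m k) z = 1" by (intro tgreen_eq_1 m) (simp add: m_def)
    then have "g k z = C * h (x k)" by (simp add: g_def)
    moreover have "h z \<le> C * h (x k)"
      unfolding h_def C_def using c zx order_trans[OF zx c(3)[of k]]
      by (intro poisson_int_harnack A x zb) auto
    moreover have "g k z \<le> u z"
    proof -
      have "g k z = g ((k - N) + N) z" using k by simp
      also have "\<dots> \<le> (\<Sum>j<Suc (k - N). g (j + N) z)"
        using g0[OF zb] by (intro member_le_sum) auto
      also have "\<dots> \<le> u z" by (rule upart[OF zb])
      finally show ?thesis .
    qed
    ultimately show ?thesis by (simp add: w_def)
  qed
  define F where "F = (\<Union>k<N. cball (x k) (r k))"
  have F: "compact F" unfolding F_def by (intro compact_UN) auto
  have "x 0 \<in> F" unfolding F_def using N(1) champagne_bubble[OF ch, of 0] by (intro UN_I[of 0]) auto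
  then have Fne: "F \<noteq> {}" by blast
  have Fsub: "F \<subseteq> ball 0 1" using champagne_bubble_subset[OF ch] by (auto simp: F_def)
  obtain p where p: "p \<in> F" "\<And>y. y \<in> F \<Longrightarrow> w y \<le> w p"
    using continuous_attains_sup[OF F Fne continuous_on_subset[OF wcont Fsub]] by blast
  \<comment> \<open>As \<open>w 0 > 0\<close>, this bound turns out to be positive, hence to be the
    value of \<open>w\<close> at the interior point \<open>p\<close>. Then \<open>w\<close> is
    constant, although it is at most 0 at the centre \<open>x N\<close>.\<close>
  define c' where "c' = max 0 (w p)"
  have wc: "w z \<le> c'" if "z \<in> ball 0 1" for z
  proof (rule unavoidable_subharmonic_le[OF un champagne_open[OF ch] wcont wsub w1])
    fix y assume "y \<in> ball 0 1 \<inter> bubbles x r"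
    then obtain k where k: "y \<in> cball (x k) (r k)" by (auto simp: bubbles_def)
    show "w y \<le> c'"
    proof (cases "k < N")
      case True
      then have "y \<in> F" using k unfolding F_def by blast
      then show ?thesis using p(2)[of y] by (simp add: c'_def)
    next
      case False
      then show ?thesis using wneg[OF k] by (simp add: c'_def)
    qed
  qed (use that in \<open>auto simp: c'_def\<close>)
  have "0 < w 0" using uzero poisson_int_0[OF A] by (simp add: w_def h_def)
  then have "0 < c'" using wc[of 0] by simp
  then have "w p = c'" by (simp add: c'_def)
  then have "w (x N) = c'"
    using strong_maximum_principle[OF wcont wsub wc] p(1) Fsub x[of N] by (metis mem_ball_0 subsetD)
  moreover have "w (x N) \<le> 0" using wneg[of "x N" N] champagne_bubble[OF ch, of N] by simp
  ultimately show False using \<open>0 < c'\<close> by simp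
qed


subsection \<open>Iterating majorants\<close>

text \<open>Continuity and the bounds are required on the whole disc, bubbles included, so that the
  circles used for gluing may cross bubbles. Superharmonicity is required on \<open>\<Omega>\<close>
  only.\<close>

definition majorant :: "complex set \<Rightarrow> (complex \<Rightarrow> real) \<Rightarrow> bool" where
  "majorant \<Omega> v \<longleftrightarrow> continuous_on (ball 0 1) v \<and> (\<forall>z\<in>ball 0 1. 0 \<le> v z \<and> v z \<le> 1) \<and>
     (\<forall>z\<in>\<Omega>. superharmonic_at v z) \<and>
     (\<forall>\<epsilon>>0. \<exists>R<1. \<forall>z\<in>ball 0 1. R \<le> cmod z \<longrightarrow> 1 - \<epsilon> \<le> v z)"

lemma superharmonic_at_cong:
  assumes "open S" "z \<in> S" "\<And>y. y \<in> S \<Longrightarrow> f y = g y" "superharmonic_at f z"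
  shows "superharmonic_at g z"
  using eventually_cball_subset[OF assms(1,2)] assms(4)[unfolded superharmonic_at_def]
  unfolding superharmonic_at_def
proof eventually_elim
  case (elim \<rho>)
  have "cmean g z \<rho> = cmean f z \<rho>"
    using elim assms(3) by (intro cmean_cong) (auto simp: subset_iff)
  then show ?case using elim assms(2,3) by simp
qed

lemma eventually_continuous_on_sphere:
  fixes z :: complex
  assumes "continuous_on S f" "open S" "z \<in> S"
  shows "\<forall>\<^sub>F \<rho> in at_right 0. 0 < \<rho> \<and> continuous_on (sphere z \<rho>) f"
  using eventually_cball_subset[OF assms(2,3)]
proof eventually_elim
  case (elim \<rho>)
  then have "sphere z \<rho> \<subseteq> S" using sphere_cball by blast
  then show ?case using elim continuous_on_subset[OF assms(1)] by blast
qed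

lemma superharmonic_at_min:
  assumes f: "continuous_on S f" "superharmonic_at f z" and g: "continuous_on S g" "superharmonic_at g z"
    and S: "open S" "z \<in> S"
  shows "superharmonic_at (\<lambda>y. min (f y) (g y)) z"
  using eventually_continuous_on_sphere[OF f(1) S] eventually_continuous_on_sphere[OF g(1) S]
    f(2)[unfolded superharmonic_at_def] g(2)[unfolded superharmonic_at_def]
  unfolding superharmonic_at_def
proof eventually_elim
  case (elim \<rho>)
  have "cmean (\<lambda>y. min (f y) (g y)) z \<rho> \<le> cmean f z \<rho>" "cmean (\<lambda>y. min (f y) (g y)) z \<rho> \<le> cmean g z \<rho>"
    using elim by (auto intro!: cmean_mono continuous_intros)
  then show ?case using elim by simp
qed

lemma superharmonic_at_affine:
  assumes f: "continuous_on S f" "superharmonic_at f z" and S: "open S" "z \<in> S" and a: "0 \<le> a"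
  shows "superharmonic_at (\<lambda>y. a * (f y + b)) z"
  using eventually_continuous_on_sphere[OF f(1) S] f(2)[unfolded superharmonic_at_def]
  unfolding superharmonic_at_def
proof eventually_elim
  case (elim \<rho>)
  then show ?case using a by (simp add: cmean_mult cmean_add mult_left_mono)
qed

lemma majorant_1: "majorant \<Omega> (\<lambda>_. 1)"
  by (auto simp: majorant_def superharmonic_at_def intro: exI[of _ 0])

lemma majorant_min:
  assumes f: "majorant \<Omega> f" and g: "majorant \<Omega> g" and \<Omega>: "\<Omega> \<subseteq> ball 0 1"
  shows "majorant \<Omega> (\<lambda>y. min (f y) (g y))"
  unfolding majorant_def
proof (intro conjI ballI allI impI)
  show "continuous_on (ball 0 1) (\<lambda>y. min (f y) (g y))"
    using f g by (auto simp: majorant_def intro!: continuous_intros)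
  show "superharmonic_at (\<lambda>y. min (f y) (g y)) z" if "z \<in> \<Omega>" for z
    using f g that \<Omega> by (intro superharmonic_at_min[of "ball 0 1"]) (auto simp: majorant_def)
  fix \<epsilon> :: real assume "0 < \<epsilon>"
  then obtain R S where "R < 1" "\<forall>z\<in>ball 0 1. R \<le> cmod z \<longrightarrow> 1 - \<epsilon> \<le> f z"
    "S < 1" "\<forall>z\<in>ball 0 1. S \<le> cmod z \<longrightarrow> 1 - \<epsilon> \<le> g z"
    using f g unfolding majorant_def by metis
  then show "\<exists>R<1. \<forall>z\<in>ball 0 1. R \<le> cmod z \<longrightarrow> 1 - \<epsilon> \<le> min (f z) (g z)"
    by (intro exI[of _ "max R S"]) auto
qed (use f g in \<open>auto simp: majorant_def min_le_iff_disj\<close>)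

lemma majorant_finite_min:
  assumes "finite D" "\<And>d. d \<in> D \<Longrightarrow> majorant \<Omega> (f d)" and \<Omega>: "\<Omega> \<subseteq> ball 0 1"
  shows "\<exists>v. majorant \<Omega> v \<and> (\<forall>d\<in>D. \<forall>y. v y \<le> f d y)"
  using assms(1,2)
proof (induction D)
  case empty
  then show ?case using majorant_1 by auto
next
  case (insert d D)
  then obtain v where "majorant \<Omega> v" "\<forall>d\<in>D. \<forall>y. v y \<le> f d y" by auto
  then show ?case
    using insert.prems[of d] by (intro exI[of _ "\<lambda>y. min (v y) (f d y)"]) (auto intro: majorant_min[OF _ _ \<Omega>] min.coboundedI1)
qed

text \<open>Inside a circle near the boundary the new majorant follows a multiple of \<open>v1\<close>, outside it
  follows a finite minimum \<open>v2\<close> of the given majorants. On the circle \<open>v2\<close> is the smaller one, so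
  the two pieces fit together.\<close>

lemma majorant_improve:
  assumes \<Omega>: "open \<Omega>" "\<Omega> \<subseteq> ball 0 1" and c: "0 < c" "c < 1"
    and H: "\<And>z. z \<in> ball 0 1 \<Longrightarrow> \<exists>v. majorant \<Omega> v \<and> v z \<le> 1 - c"
    and v1: "majorant \<Omega> v1" and z: "z \<in> ball 0 1" and \<epsilon>: "0 < \<epsilon>"
  shows "\<exists>v. majorant \<Omega> v \<and> v z \<le> (1 - c / 2) * (v1 z + \<epsilon>)"
proof -
  obtain R0 where R0: "R0 < 1" "\<And>y. y \<in> ball 0 1 \<Longrightarrow> R0 \<le> cmod y \<Longrightarrow> 1 - \<epsilon> / 2 \<le> v1 y"
    using v1 \<epsilon> unfolding majorant_def by (metis half_gt_zero)
  \<comment> \<open>The circle is to enclose \<open>z\<close> and to lie where \<open>v1\<close> is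
    within \<open>\<epsilon> / 2\<close> of 1.\<close>
  define R where "R = max R0 ((1 + cmod z) / 2)"
  have R: "R < 1" "cmod z < R" "0 < R" "R0 \<le> R"
    using R0 z by (auto simp: R_def less_max_iff_disj add_pos_nonneg)
  obtain V where V: "\<And>y. y \<in> ball 0 1 \<Longrightarrow> majorant \<Omega> (V y) \<and> V y y \<le> 1 - c"
    using H by metis
  have Vc: "continuous_on (ball 0 1) (V y)" if "y \<in> ball 0 1" for y
    using V[OF that] by (simp add: majorant_def)
  have sph: "sphere 0 R \<subseteq> ball (0::complex) 1" using R by auto
  \<comment> \<open>By compactness finitely many of the majorants \<open>V y\<close> suffice for the
    circle. The price for working on neighbourhoods is \<open>c / 2\<close> instead of
    \<open>c\<close>.\<close>
  define N where "N y = V y -` {..<1 - c / 2} \<inter> ball 0 1" for y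
  have "compact (sphere (0::complex) R)" by simp
  moreover have "open (N y)" if "y \<in> sphere 0 R" for y
    unfolding N_def using Vc[of y] that sph continuous_on_open_vimage[of "ball 0 1" "V y"] by auto
  moreover have "sphere 0 R \<subseteq> (\<Union>y\<in>sphere 0 R. N y)"
  proof
    fix y :: complex assume y: "y \<in> sphere 0 R"
    then have "y \<in> N y" using V[of y] sph c by (auto simp: N_def)
    then show "y \<in> (\<Union>y\<in>sphere 0 R. N y)" using y by blast
  qed
  ultimately obtain D where D: "D \<subseteq> sphere 0 R" "finite D" "sphere 0 R \<subseteq> (\<Union>y\<in>D. N y)"
    by (rule compactE_image)
  obtain v2 where v2: "majorant \<Omega> v2" "\<And>d y. d \<in> D \<Longrightarrow> v2 y \<le> V d y"
    using majorant_finite_min[OF D(2), of \<Omega> V] V D(1) sph \<Omega>(2) by blast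
  have v2s: "v2 y < 1 - c / 2" if "y \<in> sphere 0 R" for y
  proof -
    obtain d where d: "d \<in> D" "y \<in> N d" using D(3) \<open>y \<in> sphere 0 R\<close> by blast
    then have "V d y < 1 - c / 2" by (simp add: N_def)
    then show ?thesis using v2(2)[OF d(1), of y] by simp
  qed
  define q where "q y = (1 - c / 2) * (v1 y + \<epsilon>)" for y
  have c1: "continuous_on (ball 0 1) v1" and c2: "continuous_on (ball 0 1) v2"
    using v1 v2 by (auto simp: majorant_def)
  have cq: "continuous_on (ball 0 1) q" unfolding q_def by (intro continuous_intros c1)
  have qs: "1 - c / 2 < q y" if "y \<in> sphere 0 R" for y
  proof -
    have "1 - \<epsilon> / 2 \<le> v1 y" using R0(2)[of y] that sph R by auto
    then have "1 < v1 y + \<epsilon>" using \<epsilon> by linarith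
    then have "(1 - c / 2) * 1 < (1 - c / 2) * (v1 y + \<epsilon>)" using c by (intro mult_strict_left_mono) auto
    then show ?thesis by (simp add: q_def)
  qed
  define v where "v y = (if cmod y < R then min (v2 y) (q y) else v2 y)" for y
  define O1 where "O1 = ball (0::complex) R"
  \<comment> \<open>The open sets \<open>O1\<close> and \<open>O2\<close> cover the disc, and on
    each of them \<open>v\<close> is given by a single formula: where they overlap,
    \<open>v2\<close> is less than \<open>q\<close>, so the minimum is \<open>v2\<close>. Hence
    continuity and superharmonicity are inherited locally.\<close>
  define O2 where "O2 = (ball 0 1 - cball 0 R) \<union> ((\<lambda>y. q y - v2 y) -` {0<..} \<inter> ball 0 1)"
  have O1: "open O1" "O1 \<subseteq> ball 0 1" using R by (auto simp: O1_def)
  have "continuous_on (ball 0 1) (\<lambda>y. q y - v2 y)" by (intro continuous_intros cq c2)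
  then have O2: "open O2" "O2 \<subseteq> ball 0 1"
    using continuous_on_open_vimage[OF open_ball, of 0 1 "\<lambda>y. q y - v2 y"]
    unfolding O2_def by (intro open_Un open_Diff) auto
  have v_O1: "v y = min (v2 y) (q y)" if "y \<in> O1" for y using that by (simp add: v_def O1_def)
  have v_O2: "v y = v2 y" if "y \<in> O2" for y using that by (auto simp: v_def O2_def)
  have cover: "ball 0 1 = O1 \<union> O2"
  proof
    show "ball 0 1 \<subseteq> O1 \<union> O2"
    proof
      fix y :: complex assume y: "y \<in> ball 0 1"
      consider "cmod y < R" | "cmod y = R" | "R < cmod y" by linarith
      then show "y \<in> O1 \<union> O2"
      proof cases
        case 2
        then have "y \<in> sphere 0 R" by simp
        then have "v2 y < q y" using v2s[of y] qs[of y] by linarith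
        then show ?thesis using y by (simp add: O2_def)
      qed (use y in \<open>auto simp: O1_def O2_def\<close>)
    qed
  qed (use O1 O2 in auto)
  have "majorant \<Omega> v"
    unfolding majorant_def
  proof (intro conjI ballI allI impI)
    have "continuous_on O1 v"
    proof (rule continuous_on_eq)
      show "continuous_on O1 (\<lambda>y. min (v2 y) (q y))"
        by (intro continuous_intros continuous_on_subset[OF c2 O1(2)] continuous_on_subset[OF cq O1(2)])
    qed (simp add: v_O1)
    moreover have "continuous_on O2 v"
      by (rule continuous_on_eq[OF continuous_on_subset[OF c2 O2(2)]]) (simp add: v_O2)
    ultimately show "continuous_on (ball 0 1) v"
      unfolding cover using O1(1) O2(1) by (intro continuous_on_open_Un) auto
    have q0: "0 \<le> q y" if "y \<in> ball 0 1" for y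
      using v1 that c \<epsilon> by (auto simp: q_def majorant_def)
    have v20: "0 \<le> v2 y \<and> v2 y \<le> 1" if "y \<in> ball 0 1" for y
      using v2(1) that by (auto simp: majorant_def)
    show "0 \<le> v y" if "y \<in> ball 0 1" for y using q0[OF that] v20[OF that] by (simp add: v_def)
    show "v y \<le> 1" if "y \<in> ball 0 1" for y using v20[OF that] by (auto simp: v_def min_le_iff_disj)
    show "superharmonic_at v y" if y: "y \<in> \<Omega>" for y
    proof (cases "y \<in> O1")
      case True
      have "superharmonic_at v1 y" using v1 y by (simp add: majorant_def)
      then have "superharmonic_at q y"
        unfolding q_def using y \<Omega>(2) c by (intro superharmonic_at_affine[OF c1]) auto
      then have "superharmonic_at (\<lambda>y. min (v2 y) (q y)) y"
        using y \<Omega>(2) v2(1) by (intro superharmonic_at_min[OF c2 _ cq]) (auto simp: majorant_def)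
      then show ?thesis by (rule superharmonic_at_cong[OF O1(1) True, rotated]) (simp add: v_O1)
    next
      case False
      then have O2y: "y \<in> O2" using y \<Omega>(2) cover by blast
      have "superharmonic_at v2 y" using v2 y by (simp add: majorant_def)
      then show ?thesis by (rule superharmonic_at_cong[OF O2(1) O2y, rotated]) (simp add: v_O2)
    qed
    fix e :: real assume "0 < e"
    then obtain S where "S < 1" "\<forall>z\<in>ball 0 1. S \<le> cmod z \<longrightarrow> 1 - e \<le> v2 z"
      using v2(1) unfolding majorant_def by metis
    then show "\<exists>R<1. \<forall>z\<in>ball 0 1. R \<le> cmod z \<longrightarrow> 1 - e \<le> v z"
      using R(1) by (intro exI[of _ "max R S"]) (auto simp: v_def)
  qed
  moreover have "v z \<le> (1 - c / 2) * (v1 z + \<epsilon>)"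
    using R(2) by (simp add: v_def q_def)
  ultimately show ?thesis by blast
qed

text \<open>A positive infimum \<open>m\<close> of the values at \<open>z\<close> would be improved
  by \<open>majorant_improve\<close>: with \<open>d = m * c / 8\<close> the bound
  \<open>(1 - c / 2) * (m + 2 * d)\<close> is below \<open>m\<close>.\<close>

lemma majorant_arbitrarily_small:
  assumes \<Omega>: "open \<Omega>" "\<Omega> \<subseteq> ball 0 1" and c: "0 < c" "c < 1"
    and H: "\<And>z. z \<in> ball 0 1 \<Longrightarrow> \<exists>v. majorant \<Omega> v \<and> v z \<le> 1 - c"
    and z: "z \<in> ball 0 1" and e: "0 < e"
  shows "\<exists>v. majorant \<Omega> v \<and> v z < e"
proof -
  define S where "S = {v z | v. majorant \<Omega> v}"
  have ne: "S \<noteq> {}" using majorant_1 by (auto simp: S_def)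
  have nn: "0 \<le> s" if "s \<in> S" for s using that z by (auto simp: S_def majorant_def)
  then have bb: "bdd_below S" by (meson bdd_below.I)
  define m where "m = Inf S"
  have m0: "0 \<le> m" unfolding m_def by (rule cInf_greatest[OF ne nn])
  have "m = 0"
  proof (rule ccontr)
    assume "m \<noteq> 0"
    then have mp: "0 < m" using m0 by simp
    define d where "d = m * c / 8"
    have d: "d > 0" using mp c by (simp add: d_def)
    obtain v1 where v1: "majorant \<Omega> v1" "v1 z < m + d"
      using cInf_lessD[OF ne, of "m + d"] d by (auto simp: S_def m_def)
    obtain v where v: "majorant \<Omega> v" "v z \<le> (1 - c / 2) * (v1 z + d)"
      using majorant_improve[OF \<Omega> c H v1(1) z d] by blast
    have "m \<le> v z" unfolding m_def using v(1) by (intro cInf_lower[OF _ bb]) (auto simp: S_def)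
    also have "v z \<le> (1 - c / 2) * (v1 z + d)" by fact
    also have "\<dots> \<le> (1 - c / 2) * (m + 2 * d)" using v1 c by (intro mult_left_mono) auto
    also have "\<dots> = m - m * c / 4 - m * c * c / 8" by (simp add: d_def field_simps)
    also have "\<dots> < m"
    proof -
      have "0 < m * c" "0 < m * c * c" using mp c by auto
      then show ?thesis by linarith
    qed
    finally show False by simp
  qed
  then show ?thesis
    using cInf_lessD[OF ne, of e] e by (auto simp: S_def m_def)
qed

lemma majorant_upper_class:
  assumes \<Omega>: "open \<Omega>" "\<Omega> \<subseteq> ball 0 1" and v: "majorant \<Omega> v"
  shows "(\<lambda>z. ereal (v z)) \<in> upper_class \<Omega> (\<lambda>y. ereal (indicator (sphere 0 1) y))"
proof -
  have vc: "continuous_on (ball 0 1) v" and v0: "\<And>z. z \<in> ball 0 1 \<Longrightarrow> 0 \<le> v z"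
    using v by (auto simp: majorant_def)
  have "hyperharmonic_on \<Omega> (\<lambda>z. ereal (v z))"
    unfolding hyperharmonic_on_def
  proof (intro conjI ballI allI impI)
    fix z assume z: "z \<in> \<Omega>"
    have zb: "z \<in> ball 0 1" using z \<Omega>(2) by blast
    have "isCont v z" using continuous_on_eq_continuous_at[of "ball 0 1" v] zb vc by simp
    then have "((\<lambda>z. ereal (v z)) \<longlongrightarrow> ereal (v z)) (at z)" by (simp add: isCont_def)
    then have "Liminf (at z) (\<lambda>z. ereal (v z)) = ereal (v z)"
      by (intro lim_imp_Liminf) auto
    then show "ereal (v z) \<le> Liminf (at z within \<Omega>) (\<lambda>z. ereal (v z))"
      by (simp add: at_within_open[OF z \<Omega>(1)])
  next
    fix z and \<rho> :: real assume \<rho>: "0 < \<rho>" and sub: "cball z \<rho> \<subseteq> \<Omega>"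
    have cc: "continuous_on (cball z \<rho>) v"
      using sub \<Omega>(2) continuous_on_subset[OF vc] by blast
    then have cs: "continuous_on (sphere z \<rho>) v" using continuous_on_subset sphere_cball by blast
    have "cmean v z \<rho> \<le> v z"
      using v sub ball_subset_cball[of z \<rho>]
      by (intro superharmonic_mean_le[OF cc \<rho>]) (auto simp: majorant_def subset_iff)
    then show "circle_mean (\<lambda>z. ereal (v z)) z \<rho> \<le> ereal (v z)"
      using circle_mean_ereal[OF _ cs] \<rho> by simp
  qed simp
  moreover have "ereal (indicator (sphere 0 1) y) \<le> Liminf (at y within \<Omega>) (\<lambda>z. ereal (v z))" for y
  proof (cases "y \<in> sphere 0 1")
    case False
    have "\<forall>\<^sub>F z in at y within \<Omega>. z \<in> \<Omega>" by (simp add: eventually_at_filter)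
    then have "\<forall>\<^sub>F z in at y within \<Omega>. 0 \<le> ereal (v z)"
      by (rule eventually_mono) (use v0 \<Omega>(2) in auto)
    then show ?thesis using False by (simp add: Liminf_bounded)
  next
    case True
    have "\<forall>\<^sub>F z in at y within \<Omega>. a < ereal (v z)" if a: "a < 1" for a
    proof -
      obtain b where b: "a < ereal b" "b < 1"
        using a ereal_dense2[of a 1] by (auto simp: one_ereal_def)
      then obtain R where R: "R < 1" "\<And>z. z \<in> ball 0 1 \<Longrightarrow> R \<le> cmod z \<Longrightarrow> 1 - (1 - b) \<le> v z"
        using v unfolding majorant_def by (metis diff_gt_0_iff_gt)
      have "(cmod \<longlongrightarrow> cmod y) (at y within \<Omega>)" by (intro tendsto_intros)
      then have "\<forall>\<^sub>F z in at y within \<Omega>. R < cmod z"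
        using True R(1) by (intro order_tendstoD(1)[where y="cmod y"]) auto
      moreover have "\<forall>\<^sub>F z in at y within \<Omega>. z \<in> \<Omega>" by (simp add: eventually_at_filter)
      ultimately show ?thesis
      proof eventually_elim
        case (elim z)
        then have "b \<le> v z" using R(2)[of z] \<Omega>(2) by auto
        then show ?case using b(1) by (meson ereal_less_eq(3) less_le_trans)
      qed
    qed
    then show ?thesis using True by (simp add: le_Liminf_iff one_ereal_def[symmetric])
  qed
  ultimately show ?thesis
    using v0 \<Omega>(2) by (auto simp: upper_class_def intro!: exI[of _ 0])
qed

text \<open>Unavoidability asks for harmonic measure equal to 0, and the extended real infimum is
  bounded below only by this comparison with the constant 0.\<close>

lemma hyperharmonic_upper_class_nonneg:
  assumes \<Omega>: "open \<Omega>" "bounded \<Omega>" and f: "\<And>y. 0 \<le> f y"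
    and v: "v \<in> upper_class \<Omega> f" and z: "z \<in> \<Omega>"
  shows "0 \<le> v z"
proof -
  have hyp: "hyperharmonic_on \<Omega> v" using v by (simp add: upper_class_def)
  have "ereal ((\<lambda>_. 0) z) \<le> v z"
  proof (rule hyperharmonic_minimum_principle[OF \<Omega>])
    fix p assume p: "p \<in> \<Omega>"
    show "v p \<le> Liminf (at p within \<Omega>) v" "v p \<noteq> -\<infinity>"
      using hyp p by (auto simp: hyperharmonic_on_def)
    show "\<forall>\<^sub>F \<rho> in at_right 0. circle_mean v p \<rho> \<le> v p"
      using eventually_cball_subset[OF \<Omega>(1) p]
      by eventually_elim (use hyp in \<open>auto simp: hyperharmonic_on_def\<close>)
  next
    fix y and \<epsilon> :: real assume "y \<in> frontier \<Omega>" "0 < \<epsilon>"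
    then have "0 \<le> Liminf (at y within \<Omega>) v"
      using v f[of y] by (auto simp: upper_class_def intro: order_trans)
    then have "\<forall>\<^sub>F z in at y within \<Omega>. ereal (- \<epsilon>) < v z"
      using \<open>0 < \<epsilon>\<close> unfolding le_Liminf_iff by auto
    then show "\<forall>\<^sub>F z in at y within \<Omega>. ereal (0 - \<epsilon>) \<le> v z"
      by eventually_elim simp
  qed (use z in auto)
  then show ?thesis by (simp add: zero_ereal_def)
qed

lemma unavoidable_if_majorants:
  assumes \<Omega>: "open (ball 0 1 - E)" and c: "0 < c" "c < 1"
    and H: "\<And>z. z \<in> ball 0 1 \<Longrightarrow> \<exists>v. majorant (ball 0 1 - E) v \<and> v z \<le> 1 - c"
  shows "unavoidable E"
  unfolding unavoidable_def
proof
  fix z assume z: "z \<in> ball 0 1 - E"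
  let ?\<Omega> = "ball 0 1 - E"
  let ?f = "\<lambda>y. ereal (indicator (sphere 0 1) y)"
  have bd: "bounded ?\<Omega>" using bounded_ball bounded_subset by blast
  have sub: "?\<Omega> \<subseteq> ball 0 1" by blast
  have "harmonic_measure ?\<Omega> z (sphere 0 1) \<le> 0"
  proof (rule ereal_le_epsilon2)
    fix e :: real assume "0 < e"
    then obtain v where v: "majorant ?\<Omega> v" "v z < e"
      using majorant_arbitrarily_small[OF \<Omega> sub c H, of z e] z by blast
    have "upper_solution ?\<Omega> ?f z \<le> ereal (v z)"
      unfolding upper_solution_def by (rule INF_lower2[OF majorant_upper_class[OF \<Omega> sub v(1)]]) simp
    also have "\<dots> \<le> 0 + ereal e" using v(2) by simp
    finally show "harmonic_measure ?\<Omega> z (sphere 0 1) \<le> 0 + ereal e"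
      by (simp add: harmonic_measure_def)
  qed
  moreover have "0 \<le> harmonic_measure ?\<Omega> z (sphere 0 1)"
    unfolding harmonic_measure_def upper_solution_def
    by (intro INF_greatest hyperharmonic_upper_class_nonneg[OF \<Omega> bd _ _ z]) auto
  ultimately show "harmonic_measure ?\<Omega> z (sphere 0 1) = 0" by (rule order_antisym)
qed


subsection \<open>Dyadic sums, disjoint discs and arcs\<close>

lemma geometric_half_sum_le: "(\<Sum>j<n. (1 / 2 :: real) ^ j) \<le> 2"
proof -
  have "(\<Sum>j<n. (1 / 2 :: real) ^ j) = (1 - (1/2) ^ n) / (1 - 1/2)"
    by (subst sum_gp_strict) simp
  then show ?thesis by simp
qed

lemma dyadic_group_sum:
  fixes f :: "'a \<Rightarrow> real" and m :: "'a \<Rightarrow> nat"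
  assumes K: "finite K" and D: "0 \<le> D"
    and le: "\<And>j. j \<in> m ` K \<Longrightarrow> (\<Sum>k | k \<in> K \<and> m k = j. f k) \<le> D * (1 / 2) ^ j"
  shows "sum f K \<le> 2 * D"
proof -
  obtain N where N: "m ` K \<subseteq> {..<N}"
    using finite_nat_iff_bounded[of "m ` K"] K by auto
  have "sum f K = (\<Sum>j<N. \<Sum>k | k \<in> K \<and> m k = j. f k)"
    by (rule sum.group[OF K _ N, symmetric]) simp
  also have "\<dots> \<le> (\<Sum>j<N. D * (1 / 2) ^ j)"
  proof (rule sum_mono)
    fix j
    show "(\<Sum>k | k \<in> K \<and> m k = j. f k) \<le> D * (1 / 2) ^ j"
    proof (cases "j \<in> m ` K")
      case False
      then have "{k. k \<in> K \<and> m k = j} = {}" by auto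
      then show ?thesis using D by (simp only: sum.empty) simp
    qed (rule le)
  qed
  also have "\<dots> = D * (\<Sum>j<N. (1 / 2) ^ j)" by (simp add: sum_distrib_left)
  also have "\<dots> \<le> D * 2" using D geometric_half_sum_le by (intro mult_left_mono)
  finally show ?thesis by simp
qed

lemma dyadic_level:
  fixes d :: real
  assumes "0 < d" "d \<le> 1"
  shows "\<exists>n. (1 / 2) ^ Suc n < d \<and> d \<le> (1 / 2) ^ n"
proof -
  have ex: "\<exists>n. (1 / 2) ^ Suc n < d"
  proof -
    obtain n where "(1 / 2 :: real) ^ n < d" using assms(1) real_arch_pow_inv[of d "1/2"] by auto
    moreover have "(1 / 2 :: real) ^ Suc n \<le> (1 / 2) ^ n" by simp
    ultimately show ?thesis by (intro exI[of _ n]) linarith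
  qed
  define n where "n = (LEAST n. (1 / 2) ^ Suc n < d)"
  have n: "(1 / 2) ^ Suc n < d" unfolding n_def by (rule LeastI_ex[OF ex])
  have "d \<le> (1 / 2) ^ n"
  proof (cases n)
    case (Suc j)
    then have "\<not> (1 / 2) ^ Suc j < d" using not_less_Least[of j "\<lambda>n. (1 / 2) ^ Suc n < d"] by (simp add: n_def)
    then show ?thesis using Suc by simp
  qed (use assms in simp)
  then show ?thesis using n by blast
qed

text \<open>Mass of linear growth, as in a Carleson condition, against decay of order 2: the dyadic
  shells outside radius \<open>s0\<close> contribute a geometric series dominated by the innermost
  one.\<close>

lemma sum_inverse_square_le:
  fixes b d :: "'a \<Rightarrow> real"
  assumes K: "finite K" and s0: "0 < s0" and d: "\<And>k. k \<in> K \<Longrightarrow> s0 \<le> d k" and b: "\<And>k. k \<in> K \<Longrightarrow> 0 \<le> b k"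
    and A: "0 \<le> A" and le: "\<And>s. s0 \<le> s \<Longrightarrow> (\<Sum>k | k \<in> K \<and> d k \<le> s. b k) \<le> A * s"
  shows "(\<Sum>k\<in>K. b k / (d k)\<^sup>2) \<le> 16 * A / s0"
proof -
  have "\<exists>n. (1 / 2) ^ Suc n < s0 / d k \<and> s0 / d k \<le> (1 / 2) ^ n" if "k \<in> K" for k
    using d[OF that] s0 by (intro dyadic_level) (auto simp: divide_le_eq)
  then obtain m where m: "\<And>k. k \<in> K \<Longrightarrow> (1 / 2) ^ Suc (m k) < s0 / d k \<and> s0 / d k \<le> (1 / 2) ^ m k"
    by metis
  have "(\<Sum>k\<in>K. b k / (d k)\<^sup>2) \<le> 2 * (2 * A / s0)"
  proof (rule dyadic_group_sum[OF K, where m=m])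
    show "0 \<le> 2 * A / s0" using A s0 by simp
    fix j
    have *: "b k / (d k)\<^sup>2 \<le> b k * ((1 / 4) ^ j / s0\<^sup>2)" "d k \<le> 2 * 2 ^ j * s0" if k: "k \<in> K" "m k = j" for k
    proof -
      have dk: "0 < d k" using d[OF k(1)] s0 by linarith
      have "(s0 / d k)\<^sup>2 \<le> ((1 / 2) ^ j)\<^sup>2" using m[OF k(1)] k(2) s0 dk by (intro power_mono) auto
      then have "1 / (d k)\<^sup>2 \<le> (1 / 4) ^ j / s0\<^sup>2"
        using s0 dk by (simp add: power_divide power2_eq_square field_simps flip: power_mult_distrib)
      then have "b k * (1 / (d k)\<^sup>2) \<le> b k * ((1 / 4) ^ j / s0\<^sup>2)" by (rule mult_left_mono[OF _ b[OF k(1)]])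
      then show "b k / (d k)\<^sup>2 \<le> b k * ((1 / 4) ^ j / s0\<^sup>2)" by simp
      have "(1 / 2) ^ Suc j < s0 / d k" using m[OF k(1)] k(2) by simp
      then show "d k \<le> 2 * 2 ^ j * s0" using dk by (simp add: field_simps power_divide)
    qed
    have "(\<Sum>k | k \<in> K \<and> m k = j. b k / (d k)\<^sup>2) \<le> (\<Sum>k | k \<in> K \<and> m k = j. b k * ((1 / 4) ^ j / s0\<^sup>2))"
      by (intro sum_mono *) auto
    also have "\<dots> = (\<Sum>k | k \<in> K \<and> m k = j. b k) * ((1 / 4) ^ j / s0\<^sup>2)" by (simp only: sum_distrib_right)
    also have "\<dots> \<le> (\<Sum>k | k \<in> K \<and> d k \<le> 2 * 2 ^ j * s0. b k) * ((1 / 4) ^ j / s0\<^sup>2)"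
      using K b * by (intro mult_right_mono sum_mono2) auto
    also have "\<dots> \<le> (A * (2 * 2 ^ j * s0)) * ((1 / 4) ^ j / s0\<^sup>2)"
    proof (intro mult_right_mono le)
      have "1 * s0 \<le> 2 * 2 ^ j * s0" using s0 one_le_power[of "2::real" j] by (intro mult_right_mono) linarith+
      then show "s0 \<le> 2 * 2 ^ j * s0" by simp
    qed simp
    also have "\<dots> = 2 * A / s0 * (1 / 2) ^ j"
    proof -
      have "(2::real) ^ j * (1 / 4) ^ j = (1 / 2) ^ j" by (simp flip: power_mult_distrib)
      then have "(A * (2 * 2 ^ j * s0)) * ((1 / 4) ^ j / s0\<^sup>2) = 2 * A * (1 / 2) ^ j * s0 / s0\<^sup>2"
        by (simp add: mult_ac flip: \<open>(2::real) ^ j * (1 / 4) ^ j = (1 / 2) ^ j\<close>)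
      then show ?thesis using s0 by (simp add: power2_eq_square)
    qed
    finally show "(\<Sum>k | k \<in> K \<and> m k = j. b k / (d k)\<^sup>2) \<le> 2 * A / s0 * (1 / 2) ^ j" .
  qed
  also have "\<dots> \<le> 16 * A / s0" using A s0 by (simp add: divide_right_mono)
  finally show ?thesis .
qed

text \<open>Mass of quadratic growth, as for area, against a singularity of order 1: the dyadic
  shells inside radius \<open>s1\<close> contribute a geometric series dominated by the outermost
  one.\<close>

lemma sum_inverse_le:
  fixes b d :: "'a \<Rightarrow> real"
  assumes K: "finite K" and d: "\<And>k. k \<in> K \<Longrightarrow> 0 < d k \<and> d k \<le> s1" and b: "\<And>k. k \<in> K \<Longrightarrow> 0 \<le> b k"
    and A: "0 \<le> A" and s1: "0 < s1" and le: "\<And>s. 0 < s \<Longrightarrow> (\<Sum>k | k \<in> K \<and> d k \<le> s. b k) \<le> A * s\<^sup>2"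
  shows "(\<Sum>k\<in>K. b k / d k) \<le> 4 * A * s1"
proof -
  have "\<exists>n. (1 / 2) ^ Suc n < d k / s1 \<and> d k / s1 \<le> (1 / 2) ^ n" if "k \<in> K" for k
    using d[OF that] s1 by (intro dyadic_level) (auto simp: divide_le_eq)
  then obtain m where m: "\<And>k. k \<in> K \<Longrightarrow> (1 / 2) ^ Suc (m k) < d k / s1 \<and> d k / s1 \<le> (1 / 2) ^ m k"
    by metis
  have "(\<Sum>k\<in>K. b k / d k) \<le> 2 * (2 * A * s1)"
  proof (rule dyadic_group_sum[OF K, where m=m])
    show "0 \<le> 2 * A * s1" using A s1 by simp
    fix j
    have *: "b k / d k \<le> b k * (2 * 2 ^ j / s1)" "d k \<le> (1 / 2) ^ j * s1" if k: "k \<in> K" "m k = j" for k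
    proof -
      have dk: "0 < d k" using d[OF k(1)] by simp
      have "(1 / 2) ^ Suc j < d k / s1" using m[OF k(1)] k(2) by simp
      then have "1 / d k \<le> 2 * 2 ^ j / s1" using dk s1 by (simp add: field_simps power_divide)
      then have "b k * (1 / d k) \<le> b k * (2 * 2 ^ j / s1)" by (rule mult_left_mono[OF _ b[OF k(1)]])
      then show "b k / d k \<le> b k * (2 * 2 ^ j / s1)" by simp
      have "d k / s1 \<le> (1 / 2) ^ j" using m[OF k(1)] k(2) by simp
      then show "d k \<le> (1 / 2) ^ j * s1" using s1 by (simp add: divide_le_eq)
    qed
    have "(\<Sum>k | k \<in> K \<and> m k = j. b k / d k) \<le> (\<Sum>k | k \<in> K \<and> m k = j. b k * (2 * 2 ^ j / s1))"
      by (intro sum_mono *) auto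
    also have "\<dots> = (\<Sum>k | k \<in> K \<and> m k = j. b k) * (2 * 2 ^ j / s1)" by (simp only: sum_distrib_right)
    also have "\<dots> \<le> (\<Sum>k | k \<in> K \<and> d k \<le> (1 / 2) ^ j * s1. b k) * (2 * 2 ^ j / s1)"
      using K b * s1 by (intro mult_right_mono sum_mono2) auto
    also have "\<dots> \<le> (A * ((1 / 2) ^ j * s1)\<^sup>2) * (2 * 2 ^ j / s1)"
      using s1 by (intro mult_right_mono le) auto
    also have "\<dots> = 2 * A * s1 * (1 / 2) ^ j"
      using s1 by (simp add: power2_eq_square power_divide field_simps)
    finally show "(\<Sum>k | k \<in> K \<and> m k = j. b k / d k) \<le> 2 * A * s1 * (1 / 2) ^ j" .
  qed
  then show ?thesis by simp
qed

lemma disjoint_discs_sum_squares: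
  fixes x :: "'a \<Rightarrow> complex" and \<rho> :: "'a \<Rightarrow> real"
  assumes K: "finite K" and dis: "disjoint_family_on (\<lambda>k. ball (x k) (\<rho> k)) K"
    and \<rho>: "\<And>k. k \<in> K \<Longrightarrow> 0 \<le> \<rho> k" and sub: "\<And>k. k \<in> K \<Longrightarrow> ball (x k) (\<rho> k) \<subseteq> ball p R" and R: "0 \<le> R"
  shows "(\<Sum>k\<in>K. (\<rho> k)\<^sup>2) \<le> R\<^sup>2"
proof -
  define c where "c = measure lborel (ball (0::complex) 1)"
  have c: "c > 0" unfolding c_def by (intro content_ball_pos) simp
  have ball: "measure lborel (ball (y::complex) s) = s\<^sup>2 * c" if "0 \<le> s" for y s
    using content_ball_conv_unit_ball[of s y] that by (simp add: c_def)
  have fin: "emeasure lborel (ball (y::complex) s) < \<infinity>" for y s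
    by (rule emeasure_bounded_finite[OF bounded_ball])
  have "c * (\<Sum>k\<in>K. (\<rho> k)\<^sup>2) = (\<Sum>k\<in>K. measure lborel (ball (x k) (\<rho> k)))"
    using \<rho> by (simp add: ball sum_distrib_left mult.commute)
  also have "\<dots> = measure lborel (\<Union>k\<in>K. ball (x k) (\<rho> k))"
    using K dis by (intro measure_finite_Union[symmetric]) (use fin in \<open>auto simp: less_top\<close>)
  also have "\<dots> \<le> measure lborel (ball p R)"
    using sub K by (intro measure_mono_fmeasurable) (use fin in \<open>auto simp: fmeasurable_def\<close>)
  also have "\<dots> = c * R\<^sup>2" using ball[OF R] by simp
  finally show ?thesis using c by simp
qed

section \<open>Caps of the circle, estimated by the Poisson kernel\<close>

lemma radial_shrink:
  fixes x :: complex
  assumes "0 < d" "d < 1" "1 - d \<le> cmod x" "cmod x \<le> 1"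
  obtains x' where "cmod x' = 1 - d" "cmod (x - x') \<le> d"
proof
  have x0: "x \<noteq> 0" using assms by auto
  show "cmod (of_real (1 - d) * sgn x) = 1 - d"
    using assms x0 by (simp add: norm_mult norm_sgn del: of_real_diff)
  have "x - of_real (1 - d) * sgn x = of_real (cmod x - (1 - d)) * sgn x"
  proof -
    have "x = of_real (cmod x) * sgn x" using x0 by (simp add: sgn_eq)
    then show ?thesis by (metis left_diff_distrib of_real_diff)
  qed
  then show "cmod (x - of_real (1 - d) * sgn x) \<le> d"
    using assms x0 by (simp add: norm_mult norm_sgn del: of_real_diff)
qed

lemma nn_integral_poisson:
  assumes "cmod z < 1"
  shows "(\<integral>\<^sup>+ t. ennreal (poisson z (cis t)) \<partial>angle_measure) = 1"
proof -
  have "integrable angle_measure (\<lambda>t. poisson z (cis t))"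
    using integrable_poisson_int[of UNIV z] assms by simp
  then show ?thesis
    using assms poisson_integral_1[OF assms] poisson_nonneg[of z]
    by (subst nn_integral_eq_integral) auto
qed

lemma poisson_one_minus_ge:
  assumes d: "0 < d" "d < 1" and x: "cmod x' = 1 - d" and y: "cmod (y - x') \<le> 2 * q" "y \<noteq> x'"
  shows "d / (4 * q\<^sup>2) \<le> poisson x' y"
proof -
  have "d * 1 \<le> d * (2 - d)" using d by (intro mult_left_mono) auto
  then have num: "d \<le> 1 - (cmod x')\<^sup>2" by (simp add: x power2_eq_square algebra_simps)
  have pos: "0 < cmod (y - x')" using y by simp
  have "(cmod (y - x'))\<^sup>2 \<le> (2 * q)\<^sup>2" using y by (intro power_mono) auto
  then show ?thesis
    unfolding poisson_def using num pos d by (intro frac_le) (auto simp: power2_eq_square)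
qed

text \<open>Comparison with the Poisson kernel of the point at distance \<open>d\<close> from the circle on the
  same radius.\<close>

lemma nn_integral_inverse_square_le:
  assumes A [measurable]: "A \<in> sets borel" and x: "cmod x < 1" and d: "1 - cmod x \<le> d" "0 < d"
    and far: "\<And>t. t \<in> A \<Longrightarrow> d \<le> cmod (cis t - x)"
  shows "(\<integral>\<^sup>+ t. indicator A t * ennreal (1 / (cmod (cis t - x))\<^sup>2) \<partial>angle_measure) \<le> ennreal (4 / d)"
proof (cases "d < 1")
  case True
  obtain x' where x': "cmod x' = 1 - d" "cmod (x - x') \<le> d"
    using radial_shrink[of d x] True d x by auto
  have "(\<integral>\<^sup>+ t. indicator A t * ennreal (1 / (cmod (cis t - x))\<^sup>2) \<partial>angle_measure)
      \<le> (\<integral>\<^sup>+ t. ennreal (4 / d) * ennreal (poisson x' (cis t)) \<partial>angle_measure)"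
  proof (rule nn_integral_mono)
    fix t
    show "indicator A t * ennreal (1 / (cmod (cis t - x))\<^sup>2) \<le> ennreal (4 / d) * ennreal (poisson x' (cis t))"
    proof (cases "t \<in> A")
      case t: True
      define q where "q = cmod (cis t - x)"
      have q: "d \<le> q" "0 < q" using far[OF t] d by (auto simp: q_def)
      have "cmod (cis t - x') \<le> 2 * q"
        using norm_triangle_ineq[of "cis t - x" "x - x'"] x' q by (simp add: q_def)
      moreover have "cis t \<noteq> x'"
      proof
        assume "cis t = x'"
        then have "cmod x' = 1" by (metis norm_cis)
        then show False using x' d by simp
      qed
      ultimately have "d / (4 * q\<^sup>2) \<le> poisson x' (cis t)"
        using poisson_one_minus_ge[OF d(2) True x'(1)] by blast
      then have "4 / d * (d / (4 * q\<^sup>2)) \<le> 4 / d * poisson x' (cis t)"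
        using d by (intro mult_left_mono) auto
      then have "1 / q\<^sup>2 \<le> 4 / d * poisson x' (cis t)" using d by simp
      then show ?thesis using t d by (simp add: q_def ennreal_mult'[symmetric] ennreal_leI)
    qed simp
  qed
  also have "\<dots> = ennreal (4 / d)"
    using x' d True by (subst nn_integral_cmult) (auto simp: nn_integral_poisson)
  finally show ?thesis .
next
  case False
  have "(\<integral>\<^sup>+ t. indicator A t * ennreal (1 / (cmod (cis t - x))\<^sup>2) \<partial>angle_measure)
      \<le> (\<integral>\<^sup>+ t. ennreal (4 / d) \<partial>angle_measure)"
  proof (rule nn_integral_mono)
    fix t
    show "indicator A t * ennreal (1 / (cmod (cis t - x))\<^sup>2) \<le> ennreal (4 / d)"
    proof (cases "t \<in> A")
      case t: True
      have "d * 1 \<le> cmod (cis t - x) * cmod (cis t - x)"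
        using far[OF t] False by (intro mult_mono) auto
      then have "1 / (cmod (cis t - x))\<^sup>2 \<le> 1 / d"
        using d by (intro divide_left_mono mult_pos_pos) (auto simp: power2_eq_square)
      also have "\<dots> \<le> 4 / d" using d by (intro divide_right_mono) auto
      finally show ?thesis using t by (simp add: ennreal_leI)
    qed simp
  qed
  also have "\<dots> = ennreal (4 / d)" using angle.emeasure_space_1 by simp
  finally show ?thesis .
qed

text \<open>On the cap, \<open>4 * s\<close> times the Poisson kernel of a point at distance
  \<open>s\<close> from the circle is at least 1, and the kernel has integral 1. Such a point exists
  for small \<open>s\<close>; for \<open>s\<close> at least 1/4 the bound exceeds the total
  mass.\<close>

lemma measure_circle_cap_le:
  assumes w: "cmod w < 1" and s: "0 < s"
  shows "measure angle_measure {t. cmod (cis t - w) \<le> s} \<le> 4 * s"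
proof (cases "s < 1/4 \<and> {t. cmod (cis t - w) \<le> s} \<noteq> {}")
  case False
  show ?thesis
  proof (cases "s < 1/4")
    case True
    then have "{t. cmod (cis t - w) \<le> s} = {}" using False by blast
    then show ?thesis using s by (simp only: measure_empty)
  next
    case False
    then have "1 \<le> 4 * s" by simp
    then show ?thesis using angle.prob_le_1 order_trans by blast
  qed
next
  case True
  then obtain t0 where "cmod (cis t0 - w) \<le> s" by blast
  then have "1 - s \<le> cmod w" using cmod_circle_diff_ge[of "cis t0" w] by simp
  then obtain w' where w': "cmod w' = 1 - s" "cmod (w - w') \<le> s"
    using radial_shrink[of s w] True s w by auto
  have [measurable]: "{t. cmod (cis t - w) \<le> s} \<in> sets borel" by measurable
  have "emeasure angle_measure {t. cmod (cis t - w) \<le> s} = (\<integral>\<^sup>+ t. indicator {t. cmod (cis t - w) \<le> s} t \<partial>angle_measure)"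
    by simp
  also have "\<dots> \<le> (\<integral>\<^sup>+ t. ennreal (4 * s) * ennreal (poisson w' (cis t)) \<partial>angle_measure)"
  proof (rule nn_integral_mono)
    fix t
    show "indicator {t. cmod (cis t - w) \<le> s} t \<le> ennreal (4 * s) * ennreal (poisson w' (cis t))"
    proof (cases "cmod (cis t - w) \<le> s")
      case t: True
      have "cmod (cis t - w') \<le> 2 * s"
        using norm_triangle_ineq[of "cis t - w" "w - w'"] w' t by simp
      moreover have "cis t \<noteq> w'"
      proof
        assume "cis t = w'"
        then have "cmod w' = 1" by (metis norm_cis)
        then show False using w' s by simp
      qed
      ultimately have "s / (4 * s\<^sup>2) \<le> poisson w' (cis t)"
        using poisson_one_minus_ge[OF s _ w'(1)] True by auto
      then have "4 * s * (s / (4 * s\<^sup>2)) \<le> 4 * s * poisson w' (cis t)"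
        using s by (intro mult_left_mono) auto
      then have "1 \<le> 4 * s * poisson w' (cis t)" using s by (simp add: power2_eq_square)
      then show ?thesis using t s by (simp add: ennreal_mult'[symmetric] ennreal_leI ennreal_1[symmetric] del: ennreal_1)
    qed simp
  qed
  also have "\<dots> = ennreal (4 * s)"
    using w' s True by (subst nn_integral_cmult) (auto simp: nn_integral_poisson)
  finally show ?thesis using s by (simp add: angle.emeasure_eq_measure)
qed

lemma cmod_cis_diff_le: "cmod (cis s - cis t) \<le> \<bar>s - t\<bar>"
proof -
  have "cis s - cis t = cis t * (exp (\<i> * of_real (s - t)) - 1)"
    by (simp add: cis_mult[symmetric] cis_conv_exp algebra_simps flip: exp_add)
  then have "cmod (cis s - cis t) = 2 * \<bar>sin ((s - t) / 2)\<bar>"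
    by (simp add: norm_mult dist_exp_i_1 del: of_real_diff)
  also have "\<dots> \<le> 2 * \<bar>(s - t) / 2\<bar>" using abs_sin_x_le_abs_x[of "(s - t) / 2"] by simp
  finally show ?thesis by simp
qed

section \<open>Dyadic cells of the angle\<close>

definition cell_index :: "nat \<Rightarrow> real \<Rightarrow> int" where
  "cell_index n t = \<lfloor>2 ^ n * (t / (2 * pi))\<rfloor>"

text \<open>As classes of equal index, cells of one generation are disjoint by construction, and
  nesting reduces to integer division of indices in \<open>cell_mono\<close>.\<close>

definition cell :: "nat \<Rightarrow> real \<Rightarrow> real set" where
  "cell n t = {s. cell_index n s = cell_index n t}"

lemma cell_self [simp]: "t \<in> cell n t" by (simp add: cell_def)

lemma cell_sym: "s \<in> cell n t \<Longrightarrow> t \<in> cell n s" by (simp add: cell_def)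

lemma cell_trans: "s \<in> cell n t \<Longrightarrow> t \<in> cell n u \<Longrightarrow> s \<in> cell n u" by (simp add: cell_def)

lemma cell_mono:
  assumes "m \<le> n" "s \<in> cell n t"
  shows "s \<in> cell m t"
proof -
  have "cell_index m u = cell_index n u div 2 ^ (n - m)" for u
  proof -
    have "(2 ^ n :: real) = 2 ^ m * 2 ^ (n - m)"
      using assms(1) by (simp flip: power_add)
    then have "2 ^ m * (u / (2 * pi)) = 2 ^ n * (u / (2 * pi)) / real_of_int (2 ^ (n - m))"
      by simp
    then show ?thesis
      using floor_divide_real_eq_div[of "2 ^ (n - m)" "2 ^ n * (u / (2 * pi))"] by (simp add: cell_index_def)
  qed
  then show ?thesis using assms(2) by (simp add: cell_def)
qed

lemma measurable_cell_index [measurable]: "cell_index n \<in> measurable borel (count_space UNIV)"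
  unfolding cell_index_def[abs_def] by measurable

lemma sets_cell [measurable]: "cell n t \<in> sets borel"
  unfolding cell_def by measurable

lemma cell_eq: "cell n t = {2 * pi * of_int (cell_index n t) / 2 ^ n ..< 2 * pi * (of_int (cell_index n t) + 1) / 2 ^ n}"
proof -
  have "cell_index n s = j \<longleftrightarrow> 2 * pi * of_int j / 2 ^ n \<le> s \<and> s < 2 * pi * (of_int j + 1) / 2 ^ n" for s j
    unfolding cell_index_def floor_eq_iff by (auto simp: field_simps)
  then show ?thesis by (auto simp: cell_def)
qed

lemma cell_diff_le:
  assumes "s \<in> cell n t"
  shows "cmod (cis s - cis t) \<le> 7 * (1 / 2) ^ n"
proof -
  have "\<bar>s - t\<bar> \<le> 2 * pi / 2 ^ n"
    using assms cell_self[of t n] unfolding cell_eq by (simp add: distrib_left add_divide_distrib abs_le_iff)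
  \<comment> \<open>The constant 7 is a round upper bound for \<open>2 * pi\<close>.\<close>
  also have "\<dots> \<le> 7 / 2 ^ n" using pi_less_4 pi_approx by (intro divide_right_mono) auto
  finally show ?thesis using cmod_cis_diff_le[of s t] by (simp add: power_divide)
qed

lemma cell_subset:
  assumes "0 \<le> t" "t < 2 * pi"
  shows "cell n t \<subseteq> {0..<2 * pi}"
proof -
  define j where "j = cell_index n t"
  have "0 \<le> t / (2 * pi)" "t / (2 * pi) < 1" using assms by auto
  then have "0 \<le> 2 ^ n * (t / (2 * pi))" "2 ^ n * (t / (2 * pi)) < 2 ^ n * 1"
    by (intro mult_nonneg_nonneg mult_strict_left_mono; simp)+
  then have j: "0 \<le> j" "j < 2 ^ n" unfolding j_def cell_index_def by (auto simp: floor_less_iff)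
  then have "j + 1 \<le> 2 ^ n" by simp
  then have "of_int (j + 1) \<le> (of_int (2 ^ n) :: real)" by (simp only: of_int_le_iff)
  then have j2: "of_int j + 1 \<le> (2 ^ n :: real)" by simp
  have "2 * pi * (of_int j + 1) / 2 ^ n \<le> 2 * pi" using j2 by (simp add: divide_le_eq)
  moreover have "0 \<le> 2 * pi * of_int j / 2 ^ n" using j by simp
  ultimately show ?thesis
    unfolding cell_eq j_def[symmetric] by auto
qed

lemma measure_cell:
  assumes "0 \<le> t" "t < 2 * pi"
  shows "measure angle_measure (cell n t) = (1 / 2) ^ n"
proof -
  have "{0..2 * pi} \<inter> cell n t = cell n t"
    using cell_subset[OF assms, of n] by auto
  then have "emeasure angle_measure (cell n t) = emeasure lborel (cell n t) / ennreal (2 * pi)"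
    by (simp add: emeasure_angle_measure)
  also have "emeasure lborel (cell n t) = ennreal (2 * pi / 2 ^ n)"
    unfolding cell_eq by (simp add: distrib_left add_divide_distrib)
  also have "ennreal (2 * pi / 2 ^ n) / ennreal (2 * pi) = ennreal ((1 / 2) ^ n)"
    by (subst divide_ennreal) (auto simp: power_divide)
  finally show ?thesis by (simp add: angle.emeasure_eq_measure)
qed


subsection \<open>Separated bubbles\<close>

text \<open>\<open>L\<close> is a lower bound for the logarithms. The separation constant appears as
  \<open>2 * a\<close> so that each of two centres can claim a disc of half the distance; the upper
  bound on \<open>a\<close> keeps these discs at radius at most \<open>delta k / 2\<close>.\<close>

locale separated_champagne =
  fixes x :: "nat \<Rightarrow> complex" and r :: "nat \<Rightarrow> real" and L a :: real
  assumes ch: "champagne x r"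
    and L: "0 < L" "\<And>k. L \<le> ln ((1 - cmod (x k)) / r k)"
    and a: "0 < a" "a \<le> sqrt L / 2"
    and sep: "\<And>j k. j \<noteq> k \<Longrightarrow>
      2 * a * (1 - cmod (x k)) \<le> cmod (x k - x j) * sqrt (ln ((1 - cmod (x k)) / r k))"
begin

definition delta :: "nat \<Rightarrow> real" where "delta k = 1 - cmod (x k)"

definition lam :: "nat \<Rightarrow> real" where "lam k = ln ((1 - cmod (x k)) / r k)"

definition gen :: "nat \<Rightarrow> nat" where
  "gen k = (SOME n. (1 / 2) ^ Suc n < delta k \<and> delta k \<le> (1 / 2) ^ n)"

text \<open>The separation condition says that the discs of these radii are disjoint; their area is
  comparable to \<open>(delta k)\<^sup>2 / lam k\<close>, so that sums with weights \<open>1 / lam k\<close> can be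
  estimated by areas.\<close>

definition disc_rad :: "nat \<Rightarrow> real" where "disc_rad k = a * delta k / sqrt (lam k)"

text \<open>The bound that comparison of areas gives for the sum of \<open>1 / lam k\<close> over
  one generation in a nontangential region of aperture \<open>\<beta>\<close>. The 4 arises because
  \<open>delta k\<close> varies by a factor 2 within a generation.\<close>

definition area_const :: "real \<Rightarrow> real" where "area_const \<beta> = 4 * (\<beta> + 1)\<^sup>2 / a\<^sup>2"

lemma norm_x: "cmod (x k) < 1"
  using champagne_bubble[OF ch] by simp

lemma delta: "0 < delta k" "delta k \<le> 1"
  using norm_x[of k] by (auto simp: delta_def)

lemma lam: "L \<le> lam k" "0 < lam k"
  using L(2)[of k] L(1) by (auto simp: lam_def)

lemma gen: "(1 / 2) ^ Suc (gen k) < delta k" "delta k \<le> (1 / 2) ^ gen k"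
  using someI_ex[OF dyadic_level[OF delta], of k] by (auto simp: gen_def)

lemma power_gen_less: "(1 / 2) ^ gen k < 2 * delta k"
  using gen(1)[of k] by simp

lemma finite_gen: "finite {k. gen k < n}"
proof (rule finite_subset)
  show "{k. gen k < n} \<subseteq> {k. (1 / 2) ^ n \<le> 1 - cmod (x k)}"
  proof
    fix k assume "k \<in> {k. gen k < n}"
    then have "(1 / 2 :: real) ^ n \<le> (1 / 2) ^ Suc (gen k)"
      by (intro power_decreasing) auto
    then show "k \<in> {k. (1 / 2) ^ n \<le> 1 - cmod (x k)}"
      using gen(1)[of k] by (simp add: delta_def)
  qed
  show "finite {k. (1 / 2) ^ n \<le> 1 - cmod (x k)}"
    by (rule champagne_finite[OF ch]) simp
qed

lemma area_const_pos: "0 \<le> \<beta> \<Longrightarrow> 0 < area_const \<beta>"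
  using a by (simp add: area_const_def)

lemma disc_rad: "0 < disc_rad k" "disc_rad k \<le> delta k / 2"
proof -
  show "0 < disc_rad k" using a delta lam by (simp add: disc_rad_def)
  have "a \<le> sqrt (lam k) / 2" using a(2) lam(1)[of k] real_sqrt_le_mono[of L "lam k"] by linarith
  then have "a / sqrt (lam k) \<le> 1 / 2" using lam(2)[of k] by (simp add: divide_le_eq)
  then have "delta k * (a / sqrt (lam k)) \<le> delta k * (1 / 2)"
    using delta(1)[of k] by (intro mult_left_mono) auto
  then show "disc_rad k \<le> delta k / 2" by (simp add: disc_rad_def mult.commute)
qed

lemma disc_rad_sq: "(disc_rad k)\<^sup>2 = a\<^sup>2 * (delta k)\<^sup>2 / lam k"
  using lam(2)[of k] by (simp add: disc_rad_def power_mult_distrib power_divide)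

lemma disc_rad_sep:
  assumes "j \<noteq> k"
  shows "disc_rad j + disc_rad k \<le> dist (x j) (x k)"
proof -
  have "2 * disc_rad i \<le> cmod (x i - x l)" if "l \<noteq> i" for i l
  proof -
    have "2 * a * delta i \<le> cmod (x i - x l) * sqrt (lam i)"
      using sep[OF that] by (simp only: delta_def lam_def)
    then show ?thesis using lam(2)[of i] by (simp add: disc_rad_def divide_le_eq)
  qed
  from this[of j k] this[of k j] assms show ?thesis
    by (simp add: dist_norm norm_minus_commute)
qed

lemma disjoint_discs: "disjoint_family_on (\<lambda>k. ball (x k) (disc_rad k)) K"
  unfolding disjoint_family_on_def
proof (intro ballI impI)
  fix j k :: nat assume "j \<noteq> k"
  show "ball (x j) (disc_rad j) \<inter> ball (x k) (disc_rad k) = {}"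
    using disc_rad_sep[OF \<open>j \<noteq> k\<close>] by (rule disjoint_ballI)
qed

lemma sum_inverse_lam_le:
  assumes K: "finite K" and R: "0 \<le> R" and d: "0 < d" and dd: "\<And>k. k \<in> K \<Longrightarrow> d \<le> delta k"
    and sub: "\<And>k. k \<in> K \<Longrightarrow> dist p (x k) + disc_rad k \<le> R"
  shows "(\<Sum>k\<in>K. 1 / lam k) \<le> R\<^sup>2 / (a\<^sup>2 * d\<^sup>2)"
proof -
  have "(\<Sum>k\<in>K. (disc_rad k)\<^sup>2) \<le> R\<^sup>2"
  proof (rule disjoint_discs_sum_squares[OF K disjoint_discs _ _ R])
    show "0 \<le> disc_rad k" for k using disc_rad(1)[of k] by simp
    show "ball (x k) (disc_rad k) \<subseteq> ball p R" if "k \<in> K" for k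
    proof
      fix y assume "y \<in> ball (x k) (disc_rad k)"
      then show "y \<in> ball p R" using sub[OF that] dist_triangle[of p y "x k"] by (simp add: dist_commute)
    qed
  qed
  moreover have "a\<^sup>2 * d\<^sup>2 * (1 / lam k) \<le> (disc_rad k)\<^sup>2" if "k \<in> K" for k
  proof -
    have "d\<^sup>2 \<le> (delta k)\<^sup>2" using dd[OF that] d by (intro power_mono) auto
    then have "a\<^sup>2 * d\<^sup>2 / lam k \<le> a\<^sup>2 * (delta k)\<^sup>2 / lam k"
      using lam(2)[of k] by (intro divide_right_mono mult_left_mono) auto
    then show ?thesis by (simp add: disc_rad_sq)
  qed
  then have "a\<^sup>2 * d\<^sup>2 * (\<Sum>k\<in>K. 1 / lam k) \<le> (\<Sum>k\<in>K. (disc_rad k)\<^sup>2)"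
    unfolding sum_distrib_left by (rule sum_mono)
  ultimately have "a\<^sup>2 * d\<^sup>2 * (\<Sum>k\<in>K. 1 / lam k) \<le> R\<^sup>2" by linarith
  then show ?thesis using a d by (simp add: pos_le_divide_eq mult.commute)
qed

lemma sum_generation_le:
  assumes K: "finite K" and \<beta>: "0 \<le> \<beta>"
    and k: "\<And>k. k \<in> K \<Longrightarrow> gen k = n \<and> cmod (y - x k) \<le> \<beta> * delta k"
  shows "(\<Sum>k\<in>K. 1 / lam k) \<le> area_const \<beta>"
proof -
  have "(\<Sum>k\<in>K. 1 / lam k) \<le> ((\<beta> + 1) * (1 / 2) ^ n)\<^sup>2 / (a\<^sup>2 * ((1 / 2) ^ Suc n)\<^sup>2)"
  proof (rule sum_inverse_lam_le[OF K, where p=y])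
    fix k assume kK: "k \<in> K"
    show "(1 / 2) ^ Suc n \<le> delta k" using k[OF kK] gen(1)[of k] by auto
    have "dist y (x k) + disc_rad k \<le> (\<beta> + 1) * delta k"
      using k[OF kK] disc_rad(2)[of k] delta(1)[of k] by (simp add: dist_norm distrib_right)
    also have "\<dots> \<le> (\<beta> + 1) * (1 / 2) ^ n"
      using gen(2)[of k] k[OF kK] \<beta> by (intro mult_left_mono) auto
    finally show "dist y (x k) + disc_rad k \<le> (\<beta> + 1) * (1 / 2) ^ n" .
  qed (use \<beta> in auto)
  also have "\<dots> = area_const \<beta>" by (simp add: area_const_def power_mult_distrib power_divide field_simps)
  finally show ?thesis .
qed

text \<open>Each generation contributes at most \<open>area_const \<beta>\<close> times its dyadic
  size, so the sum is geometric and the coarsest generation dominates; its size is below twice some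
  \<open>delta k\<close>, hence at most \<open>2 * e\<close>.\<close>

lemma sum_delta_lam_le:
  assumes K: "finite K" and \<beta>: "0 \<le> \<beta>" and e: "0 < e"
    and k: "\<And>k. k \<in> K \<Longrightarrow> cmod (y - x k) \<le> \<beta> * delta k \<and> delta k \<le> e"
  shows "(\<Sum>k\<in>K. delta k / lam k) \<le> 4 * area_const \<beta> * e"
proof (cases "K = {}")
  case True
  then show ?thesis using area_const_pos[OF \<beta>] e by simp
next
  case False
  define n0 where "n0 = Min (gen ` K)"
  have n0: "n0 \<le> gen k" if "k \<in> K" for k using that K by (simp add: n0_def)
  have "n0 \<in> gen ` K" unfolding n0_def using K False by (intro Min_in) auto
  then obtain k0 where k0: "k0 \<in> K" "gen k0 = n0" by auto
  have n0e: "(1 / 2) ^ n0 \<le> 2 * e" using power_gen_less[of k0] k0 k[OF k0(1)] by simp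
  have "(\<Sum>k\<in>K. delta k / lam k) \<le> 2 * (area_const \<beta> * (1 / 2) ^ n0)"
  proof (rule dyadic_group_sum[OF K, where m="\<lambda>k. gen k - n0"])
    show "0 \<le> area_const \<beta> * (1 / 2) ^ n0" using area_const_pos[OF \<beta>] by simp
    fix j
    define K' where "K' = {k. k \<in> K \<and> gen k - n0 = j}"
    have gk: "gen k = n0 + j" if "k \<in> K'" for k using that n0[of k] by (auto simp: K'_def)
    have fK': "finite K'" using K by (simp add: K'_def)
    have "(\<Sum>k\<in>K'. delta k / lam k) \<le> (\<Sum>k\<in>K'. (1 / 2) ^ (n0 + j) * (1 / lam k))"
    proof (rule sum_mono)
      fix k assume "k \<in> K'"
      then have "delta k * (1 / lam k) \<le> (1 / 2) ^ (n0 + j) * (1 / lam k)"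
        using gen(2)[of k] gk[of k] lam(2)[of k] by (intro mult_right_mono) auto
      then show "delta k / lam k \<le> (1 / 2) ^ (n0 + j) * (1 / lam k)" by simp
    qed
    also have "\<dots> = (1 / 2) ^ (n0 + j) * (\<Sum>k\<in>K'. 1 / lam k)" by (simp only: sum_distrib_left)
    also have "\<dots> \<le> (1 / 2) ^ (n0 + j) * area_const \<beta>"
    proof (rule mult_left_mono)
      show "(\<Sum>k\<in>K'. 1 / lam k) \<le> area_const \<beta>"
      proof (rule sum_generation_le[OF fK' \<beta>])
        show "gen k = n0 + j \<and> cmod (y - x k) \<le> \<beta> * delta k" if "k \<in> K'" for k
          using gk[OF that] k[of k] that unfolding K'_def by blast
      qed
    qed simp
    finally show "(\<Sum>k | k \<in> K \<and> gen k - n0 = j. delta k / lam k) \<le> area_const \<beta> * (1 / 2) ^ n0 * (1 / 2) ^ j"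
      by (simp add: K'_def power_add mult_ac)
  qed
  also have "\<dots> \<le> 2 * (area_const \<beta> * (2 * e))"
    using n0e area_const_pos[OF \<beta>] by (intro mult_left_mono) auto
  finally show ?thesis by simp
qed

subsection \<open>Dyadic nontangential divergence\<close>

text \<open>The nontangential condition is made constant on the cells of generation \<open>gen k\<close>.\<close>

definition near :: "nat \<Rightarrow> real \<Rightarrow> bool" where
  "near k t \<longleftrightarrow> (\<exists>s\<in>cell (gen k) t. cmod (cis s - x k) \<le> 28 * delta k)"

lemma near_cell: "near k t \<Longrightarrow> s \<in> cell (gen k) t \<Longrightarrow> near k s"
  unfolding near_def using cell_sym cell_trans by blast

text \<open>Here 42 = 28 + 14, since two points of a cell of generation \<open>gen k\<close> are
  less than \<open>14 * delta k\<close> apart on the circle.\<close>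

lemma near_dist: 
  assumes "near k t"
  shows "cmod (cis t - x k) \<le> 42 * delta k"
proof -
  obtain s where s: "s \<in> cell (gen k) t" "cmod (cis s - x k) \<le> 28 * delta k"
    using assms by (auto simp: near_def)
  have "cmod (cis t - x k) \<le> cmod (cis t - cis s) + cmod (cis s - x k)"
    using norm_triangle_ineq[of "cis t - cis s" "cis s - x k"] by simp
  also have "cmod (cis t - cis s) \<le> 7 * (1 / 2) ^ gen k"
    using cell_diff_le[OF cell_sym[OF s(1)]] by simp
  finally show ?thesis using s(2) power_gen_less[of k] by linarith
qed

text \<open>The predicate depends on \<open>t\<close> through the integer
  \<open>cell_index (gen k) t\<close> only, and every set of integers is measurable.\<close>

lemma measurable_near [measurable]: "Measurable.pred borel (near k)"
proof -
  have "near k = (\<lambda>t. cell_index (gen k) t \<in> {j. \<exists>s. cell_index (gen k) s = j \<and> cmod (cis s - x k) \<le> 28 * delta k})"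
    by (auto simp: near_def cell_def fun_eq_iff)
  also have "Measurable.pred borel \<dots>" by measurable
  finally show ?thesis .
qed

definition near_sum :: "real \<Rightarrow> ennreal" where
  "near_sum t = (\<Sum>k. ennreal (if near k t then 1 / lam k else 0))"

lemma measurable_near_sum [measurable]: "near_sum \<in> borel_measurable borel"
  unfolding near_sum_def[abs_def] by measurable

lemma sum_le_near_sum:
  assumes "finite K" "\<And>k. k \<in> K \<Longrightarrow> near k t"
  shows "ennreal (\<Sum>k\<in>K. 1 / lam k) \<le> near_sum t"
proof -
  have "ennreal (\<Sum>k\<in>K. 1 / lam k) = (\<Sum>k\<in>K. ennreal (1 / lam k))"
    using lam(2) by (intro sum_ennreal[symmetric]) (simp add: less_imp_le)
  also have "\<dots> = (\<Sum>k\<in>K. ennreal (if near k t then 1 / lam k else 0))"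
    using assms(2) by (intro sum.cong) auto
  also have "\<dots> \<le> near_sum t"
    unfolding near_sum_def by (intro sum_le_suminf assms(1)) auto
  finally show ?thesis .
qed

lemma bubble_term_eq: "bubble_term x r k y = (delta k)\<^sup>2 / lam k * (1 / (cmod (y - x k))\<^sup>2)"
  by (simp add: bubble_term_def delta_def lam_def divide_inverse mult_ac)

lemma polar:
  obtains t where "0 \<le> t" "t < 2 * pi" "z = of_real (cmod z) * cis t"
  using that[OF Arg2pi_ge_0[of z] Arg2pi_lt_2pi[of z]] Arg2pi_eq[of z] by (simp add: cis_conv_exp)

lemma polar_dist:
  assumes "z = of_real (cmod z) * cis t" "cmod z < 1"
  shows "cmod (cis t - z) = 1 - cmod z"
proof -
  have "cis t - z = of_real (1 - cmod z) * cis t"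
    by (subst assms(1)) (simp add: algebra_simps)
  then show ?thesis using assms(2) by (simp add: norm_mult del: of_real_diff)
qed

text \<open>On a set \<open>A\<close> where the nontangential sum is bounded the full series has a finite integral.
  The bubbles near some point of \<open>A\<close> are counted along nested cells, which contain a point of
  \<open>A\<close>; for the others the distance to \<open>A\<close> dominates \<open>delta k\<close> and the sum over generations
  is geometric, as in Marcinkiewicz's integral.\<close>

lemma near_sum_infinite:
  assumes div: "AE t in angle_measure. (\<Sum>k. ennreal (bubble_term x r k (cis t))) = \<infinity>"
  shows "AE t in angle_measure. near_sum t = \<infinity>"
proof (rule ccontr)
  assume nAE: "\<not> ?thesis"
  obtain n :: nat where n: "emeasure angle_measure {t. near_sum t \<le> of_nat n} \<noteq> 0"
    using ex_positive_sublevel[of near_sum angle_measure] nAE by auto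
  define A where "A = {t. 0 \<le> t \<and> t < 2 * pi \<and> near_sum t \<le> of_nat n}"
  have A [measurable]: "A \<in> sets borel" unfolding A_def by measurable
  have "emeasure angle_measure A = emeasure angle_measure {t. near_sum t \<le> of_nat n}"
    using AE_angle_measure by (intro emeasure_eq_AE) (auto elim: eventually_mono simp: A_def)
  then have n: "emeasure angle_measure A \<noteq> 0" using n by simp
  have Ane: "A \<noteq> {}" using n by auto
  have A0: "0 \<le> t" "t < 2 * pi" "near_sum t \<le> of_nat n" if "t \<in> A" for t
    using that by (auto simp: A_def)
  define c1 where "c1 k \<longleftrightarrow> (\<exists>t\<in>A. near k t)" for k
  have "\<exists>t. 0 \<le> t \<and> t < 2 * pi \<and> (if c1 k then t \<in> A \<and> near k t else x k = of_real (cmod (x k)) * cis t)" for k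
  proof (cases "c1 k")
    case True
    then show ?thesis using A0 by (auto simp: c1_def)
  next
    case False
    then show ?thesis using polar[of "x k"] by auto
  qed
  \<comment> \<open>The base point of the cell \<open>V k\<close> is a point of \<open>A\<close> if
    some point of \<open>A\<close> is near the bubble, and the radial projection of the centre
    otherwise.\<close>
  then obtain \<tau> where \<tau>: "\<And>k. 0 \<le> \<tau> k" "\<And>k. \<tau> k < 2 * pi"
    "\<And>k. if c1 k then \<tau> k \<in> A \<and> near k (\<tau> k) else x k = of_real (cmod (x k)) * cis (\<tau> k)"
    by metis
  define V where "V k = cell (gen k) (\<tau> k)" for k
  have V [measurable]: "V k \<in> sets borel" for k by (simp add: V_def)
  have emV: "emeasure angle_measure (V k) = ennreal ((1 / 2) ^ gen k)" for k
    using measure_cell[OF \<tau>(1,2)] by (simp add: V_def angle.emeasure_eq_measure)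
  define d where "d k = (INF t\<in>A. cmod (cis t - x k))" for k
  have bdd: "bdd_below ((\<lambda>t. cmod (cis t - y)) ` A)" for y by (intro bdd_belowI[of _ 0]) auto
  have d_le: "d k \<le> cmod (cis t - x k)" if "t \<in> A" for k t
    unfolding d_def by (rule cINF_lower[OF bdd that])
  have d_ge: "b \<le> d k" if "\<And>t. t \<in> A \<Longrightarrow> b \<le> cmod (cis t - x k)" for b k
    unfolding d_def by (rule cINF_greatest[OF Ane that])
  have d_delta: "delta k \<le> d k" for k
    by (rule d_ge) (simp add: delta_def cmod_circle_diff_ge)
  have d_pos: "0 < d k" for k using d_delta[of k] delta(1)[of k] by linarith
  have d_far: "28 * delta k \<le> d k" if "\<not> c1 k" for k
  proof (rule d_ge)
    fix t assume "t \<in> A"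
    then have "\<not> near k t" using that by (auto simp: c1_def)
    then show "28 * delta k \<le> cmod (cis t - x k)"
      unfolding near_def using cell_self[of t "gen k"] linear by blast
  qed
  \<comment> \<open>Chosen so that \<open>c k\<close> times the measure of \<open>V k\<close> bounds
    the integral of the k-th term over \<open>A\<close>, namely
    \<open>(delta k)\<^sup>2 / lam k\<close> times the bound \<open>4 / d k\<close> from
    \<open>nn_integral_inverse_square_le\<close>. Each term is thereby replaced by a density on a
    single cell.\<close>
  define c where "c k = 4 * delta k / (lam k * d k)" for k
  have c0: "0 \<le> c k" for k unfolding c_def using delta lam d_pos by (intro divide_nonneg_nonneg) (auto simp: less_imp_le)
  have tm: "(\<integral>\<^sup>+ t. indicator A t * ennreal (bubble_term x r k (cis t)) \<partial>angle_measure)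
      \<le> (\<integral>\<^sup>+ t. ennreal (c k) * indicator (V k) t \<partial>angle_measure)" for k
  proof -
    have "(\<integral>\<^sup>+ t. indicator A t * ennreal (bubble_term x r k (cis t)) \<partial>angle_measure)
        = (\<integral>\<^sup>+ t. ennreal ((delta k)\<^sup>2 / lam k) * (indicator A t * ennreal (1 / (cmod (cis t - x k))\<^sup>2)) \<partial>angle_measure)"
      using lam(2)[of k] by (intro nn_integral_cong) (auto simp: bubble_term_eq indicator_def ennreal_mult'[symmetric])
    also have "\<dots> = ennreal ((delta k)\<^sup>2 / lam k) * (\<integral>\<^sup>+ t. indicator A t * ennreal (1 / (cmod (cis t - x k))\<^sup>2) \<partial>angle_measure)"
      by (rule nn_integral_cmult) measurable
    also have "\<dots> \<le> ennreal ((delta k)\<^sup>2 / lam k) * ennreal (4 / d k)"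
      using d_delta[of k] d_pos[of k] norm_x[of k] d_le
      by (intro mult_left_mono nn_integral_inverse_square_le) (auto simp: delta_def)
    also have "\<dots> = ennreal (c k * delta k)"
    proof -
      have "(delta k)\<^sup>2 / lam k * (4 / d k) = c k * delta k"
        by (simp add: c_def power2_eq_square mult_ac)
      then show ?thesis using lam(2)[of k] by (subst ennreal_mult'[symmetric]) auto
    qed
    also have "\<dots> \<le> ennreal (c k * (1 / 2) ^ gen k)"
      using c0 gen(2) by (intro ennreal_leI mult_left_mono)
    also have "\<dots> = (\<integral>\<^sup>+ t. ennreal (c k) * indicator (V k) t \<partial>angle_measure)"
      using c0[of k] by (simp add: nn_integral_cmult emV ennreal_mult')
    finally show ?thesis .
  qed
  \<comment> \<open>All these cells contain \<open>t\<close>, so they are nested. The base point of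
    the finest one lies in \<open>A\<close> and in all the others, hence is near every bubble in
    \<open>K\<close>, and \<open>near_sum\<close> is at most \<open>n\<close> at that point.\<close>
  have part1: "(\<Sum>k\<in>K. c k) \<le> 4 * real n" if K: "finite K" "\<And>k. k \<in> K \<Longrightarrow> c1 k \<and> t \<in> V k" for K t
  proof (cases "K = {}")
    case False
    have "Max (gen ` K) \<in> gen ` K" using K False by (intro Max_in) auto
    then obtain k0 where k0: "k0 \<in> K" "gen k0 = Max (gen ` K)" by auto
    have max: "gen k \<le> gen k0" if "k \<in> K" for k using that K(1) k0(2) by simp
    have t0: "\<tau> k0 \<in> A" using \<tau>(3)[of k0] K(2)[OF k0(1)] by simp
    have "near k (\<tau> k0)" if k: "k \<in> K" for k
    proof -
      have "\<tau> k0 \<in> cell (gen k0) t" using K(2)[OF k0(1)] cell_sym by (simp add: V_def)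
      then have "\<tau> k0 \<in> cell (gen k) t" using max[OF k] cell_mono by blast
      moreover have "t \<in> cell (gen k) (\<tau> k)" using K(2)[OF k] by (simp add: V_def)
      ultimately have "\<tau> k0 \<in> cell (gen k) (\<tau> k)" using cell_trans by blast
      moreover have "near k (\<tau> k)" using \<tau>(3)[of k] K(2)[OF k] by simp
      ultimately show ?thesis using near_cell by blast
    qed
    then have "ennreal (\<Sum>k\<in>K. 1 / lam k) \<le> near_sum (\<tau> k0)" by (intro sum_le_near_sum K(1))
    also have "\<dots> \<le> of_nat n" by (rule A0(3)[OF t0])
    finally have "(\<Sum>k\<in>K. 1 / lam k) \<le> real n" by (simp add: ennreal_of_nat_eq_real_of_nat)
    moreover have "c k \<le> 4 * (1 / lam k)" for k
    proof -
      have "delta k / d k \<le> 1" using d_delta[of k] d_pos[of k] by (simp add: divide_le_eq)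
      then have "4 / lam k * (delta k / d k) \<le> 4 / lam k * 1" using lam(2)[of k] by (intro mult_left_mono) auto
      then show ?thesis by (simp add: c_def)
    qed
    then have "(\<Sum>k\<in>K. c k) \<le> 4 * (\<Sum>k\<in>K. 1 / lam k)" unfolding sum_distrib_left by (rule sum_mono)
    ultimately show ?thesis by linarith
  qed simp
  have part2: "(\<Sum>k\<in>K. c k) \<le> 32 * area_const 15" if K: "finite K" "\<And>k. k \<in> K \<Longrightarrow> \<not> c1 k \<and> t \<in> V k" for K t
  proof (cases "K = {}")
    case True
    then show ?thesis using area_const_pos[of 15] by simp
  next
    case False
    \<comment> \<open>The distance from \<open>cis t\<close> to the image of \<open>A\<close>. Every
      centre in \<open>K\<close> is within \<open>15 * delta k\<close> of \<open>cis t\<close>, so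
      \<open>d k\<close> and \<open>e\<close> differ by at most that much.\<close>
    define e where "e = (INF s\<in>A. cmod (cis s - cis t))"
    have near15: "cmod (cis t - x k) \<le> 15 * delta k" if k: "k \<in> K" for k
    proof -
      have "cmod (cis (\<tau> k) - x k) = delta k"
        using \<tau>(3)[of k] K(2)[OF k] polar_dist[OF _ norm_x] by (simp add: delta_def)
      moreover have "cmod (cis t - cis (\<tau> k)) \<le> 7 * (1 / 2) ^ gen k"
        using K(2)[OF k] by (intro cell_diff_le) (simp add: V_def)
      ultimately show ?thesis
        using norm_triangle_ineq[of "cis t - cis (\<tau> k)" "cis (\<tau> k) - x k"] power_gen_less[of k] by simp
    qed
    have e1: "d k \<le> e + 15 * delta k" if k: "k \<in> K" for k
    proof -
      have "d k - 15 * delta k \<le> e"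
        unfolding e_def
      proof (rule cINF_greatest[OF Ane])
        fix s assume "s \<in> A"
        then have "d k \<le> cmod (cis s - x k)" by (rule d_le)
        also have "\<dots> \<le> cmod (cis s - cis t) + cmod (cis t - x k)"
          using norm_triangle_ineq[of "cis s - cis t" "cis t - x k"] by simp
        finally show "d k - 15 * delta k \<le> cmod (cis s - cis t)" using near15[OF k] by simp
      qed
      then show ?thesis by simp
    qed
    have e2: "e \<le> d k + 15 * delta k" if k: "k \<in> K" for k
    proof -
      have "e - 15 * delta k \<le> d k"
      proof (rule d_ge)
        fix s assume "s \<in> A"
        then have "e \<le> cmod (cis s - cis t)" unfolding e_def by (rule cINF_lower[OF bdd])
        also have "\<dots> \<le> cmod (cis s - x k) + cmod (cis t - x k)"
          using norm_triangle_ineq4[of "cis s - x k" "cis t - x k"] by simp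
        finally show "e - 15 * delta k \<le> cmod (cis s - x k)" using near15[OF k] by simp
      qed
      then show ?thesis by simp
    qed
    \<comment> \<open>Here the aperture 28 in \<open>near\<close> matters: \<open>d k\<close> is at
      least \<open>28 * delta k\<close>, which absorbs the error \<open>15 * delta k\<close> in both
      directions.\<close>
    have e3: "delta k \<le> e" "2 * e \<le> 4 * d k" "0 < e" if k: "k \<in> K" for k
      using e1[OF k] e2[OF k] d_far[of k] K(2)[OF k] delta(1)[of k] by auto
    have e0: "0 < e" using e3(3) False by blast
    have "(\<Sum>k\<in>K. c k) \<le> (\<Sum>k\<in>K. 8 / e * (delta k / lam k))"
    proof (rule sum_mono)
      fix k assume k: "k \<in> K"
      have "1 / d k \<le> 2 / e" using e3(2)[OF k] e0 d_pos[of k] by (simp add: field_simps)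
      then have "4 * (delta k / lam k) * (1 / d k) \<le> 4 * (delta k / lam k) * (2 / e)"
        using delta(1)[of k] lam(2)[of k] by (intro mult_left_mono) auto
      then show "c k \<le> 8 / e * (delta k / lam k)" by (simp add: c_def mult_ac)
    qed
    also have "\<dots> = 8 / e * (\<Sum>k\<in>K. delta k / lam k)" by (simp only: sum_distrib_left)
    also have "\<dots> \<le> 8 / e * (4 * area_const 15 * e)"
      using e0 e3(1) near15 by (intro mult_left_mono sum_delta_lam_le[OF K(1), where y="cis t"]) auto
    also have "\<dots> = 32 * area_const 15" using e0 by simp
    finally show ?thesis .
  qed
  define C where "C = 4 * real n + 32 * area_const 15"
  have "(\<Sum>k. ennreal (c k) * indicator (V k) t) \<le> ennreal C" for t
  proof (rule suminf_le_const)
    show "summable (\<lambda>k. ennreal (c k) * indicator (V k) t)" by simp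
    fix j
    define K1 where "K1 = {k. k < j \<and> t \<in> V k \<and> c1 k}"
    define K2 where "K2 = {k. k < j \<and> t \<in> V k \<and> \<not> c1 k}"
    have "(\<Sum>k<j. ennreal (c k) * indicator (V k) t) = (\<Sum>k\<in>K1 \<union> K2. ennreal (c k))"
      by (rule sum.mono_neutral_cong_right) (auto simp: K1_def K2_def indicator_def)
    also have "\<dots> = ennreal (\<Sum>k\<in>K1 \<union> K2. c k)" by (rule sum_ennreal) (rule c0)
    also have "(\<Sum>k\<in>K1 \<union> K2. c k) = (\<Sum>k\<in>K1. c k) + (\<Sum>k\<in>K2. c k)"
      by (rule sum.union_disjoint) (auto simp: K1_def K2_def)
    also have "\<dots> \<le> C"
      unfolding C_def by (intro add_mono part1[of K1 t] part2[of K2 t]) (auto simp: K1_def K2_def)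
    finally show "(\<Sum>k<j. ennreal (c k) * indicator (V k) t) \<le> ennreal C" by (simp add: ennreal_leI)
  qed
  then have bound: "(\<integral>\<^sup>+ t. (\<Sum>k. ennreal (c k) * indicator (V k) t) \<partial>angle_measure) \<le> ennreal C"
    using nn_integral_mono[of angle_measure "\<lambda>t. (\<Sum>k. ennreal (c k) * indicator (V k) t)" "\<lambda>_. ennreal C"]
      angle.emeasure_space_1 by simp
  define S where "S t = (\<Sum>k. ennreal (bubble_term x r k (cis t)))" for t
  have S [measurable]: "S \<in> borel_measurable borel" unfolding S_def by measurable
  have "(\<integral>\<^sup>+ t. indicator A t * S t \<partial>angle_measure)
      = (\<Sum>k. \<integral>\<^sup>+ t. indicator A t * ennreal (bubble_term x r k (cis t)) \<partial>angle_measure)"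
    unfolding S_def by (subst nn_integral_suminf[symmetric]) (auto simp: ennreal_suminf_cmult)
  also have "\<dots> \<le> (\<Sum>k. \<integral>\<^sup>+ t. ennreal (c k) * indicator (V k) t \<partial>angle_measure)"
    by (intro suminf_le tm) auto
  also have "\<dots> = (\<integral>\<^sup>+ t. (\<Sum>k. ennreal (c k) * indicator (V k) t) \<partial>angle_measure)"
    by (rule nn_integral_suminf[symmetric]) measurable
  also have "\<dots> < \<infinity>" using bound le_less_trans ennreal_less_top by (metis infinity_ennreal_def)
  finally have "(\<integral>\<^sup>+ t. indicator A t * S t \<partial>angle_measure) \<noteq> \<infinity>" by simp
  then have "AE t in angle_measure. indicator A t * S t \<noteq> \<infinity>"
    by (intro nn_integral_PInf_AE) auto
  with div have "AE t in angle_measure. t \<notin> A"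
    unfolding S_def[symmetric]
    by eventually_elim (auto simp: indicator_def)
  then have "emeasure angle_measure A = 0"
    by (subst (asm) AE_iff_measurable[OF _ refl]) auto
  then show False using n by simp
qed

end


subsection \<open>A stopping time construction\<close>

context separated_champagne
begin

definition level_sum :: "nat \<Rightarrow> nat \<Rightarrow> real \<Rightarrow> real" where
  "level_sum n0 n t = (\<Sum>k | n0 \<le> gen k \<and> gen k < n \<and> near k t. 1 / lam k)"

text \<open>The stopping rule counts strictly coarser generations only. Hence it is constant on
  cells of generation \<open>gen k\<close>, and a generation is always taken as a whole. The
  starting generation \<open>n0\<close> serves to keep the selected bubbles small compared with the
  distance of a given point from the circle.\<close>

definition chosen :: "nat \<Rightarrow> nat \<Rightarrow> real \<Rightarrow> bool" where
  "chosen n0 k t \<longleftrightarrow> n0 \<le> gen k \<and> near k t \<and> level_sum n0 (gen k) t < 1"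

lemma finite_level: "finite {k. n0 \<le> gen k \<and> gen k < n \<and> near k t}"
  by (rule finite_subset[OF _ finite_gen[of n]]) auto

lemma chosen_cell:
  assumes "chosen n0 k t" "s \<in> cell (gen k) t"
  shows "chosen n0 k s"
proof -
  have "near j s \<longleftrightarrow> near j t" if "gen j < gen k" for j
  proof -
    have "s \<in> cell (gen j) t" using assms(2) that by (intro cell_mono[of "gen j" "gen k"]) auto
    then show ?thesis using near_cell cell_sym by blast
  qed
  then have "{j. n0 \<le> gen j \<and> gen j < gen k \<and> near j s} = {j. n0 \<le> gen j \<and> gen j < gen k \<and> near j t}"
    by blast
  then have "level_sum n0 (gen k) s = level_sum n0 (gen k) t" by (simp add: level_sum_def)
  then show ?thesis using assms near_cell[OF _ assms(2)] by (simp add: chosen_def)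
qed

text \<open>Below the finest generation occurring in \<open>F\<close> the sum is less than 1 by the
  rule itself; that last generation is bounded by area with the aperture 42 of
  \<open>near_dist\<close>.\<close>

lemma chosen_sum_le:
  assumes F: "finite F" "\<And>k. k \<in> F \<Longrightarrow> chosen n0 k t"
  shows "(\<Sum>k\<in>F. 1 / lam k) \<le> 1 + area_const 42"
proof (cases "F = {}")
  case True
  then show ?thesis using area_const_pos[of 42] by simp
next
  case False
  have "Max (gen ` F) \<in> gen ` F" using F False by (intro Max_in) auto
  then obtain k0 where k0: "k0 \<in> F" "gen k0 = Max (gen ` F)" by auto
  have max: "gen k \<le> gen k0" if "k \<in> F" for k using that F(1) k0(2) by simp
  define F1 where "F1 = {k \<in> F. gen k < gen k0}"
  define F2 where "F2 = {k \<in> F. gen k = gen k0}"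
  have "F = F1 \<union> F2" using max by (force simp: F1_def F2_def)
  then have "(\<Sum>k\<in>F. 1 / lam k) = (\<Sum>k\<in>F1. 1 / lam k) + (\<Sum>k\<in>F2. 1 / lam k)"
    using F(1) by (simp only:) (rule sum.union_disjoint, auto simp: F1_def F2_def)
  moreover have "(\<Sum>k\<in>F1. 1 / lam k) \<le> level_sum n0 (gen k0) t"
    unfolding level_sum_def
  proof (rule sum_mono2[OF finite_level])
    show "F1 \<subseteq> {k. n0 \<le> gen k \<and> gen k < gen k0 \<and> near k t}"
      using F(2) by (auto simp: F1_def chosen_def)
    show "0 \<le> 1 / lam k" for k using lam(2)[of k] by simp
  qed
  moreover have "level_sum n0 (gen k0) t < 1" using F(2)[OF k0(1)] by (simp add: chosen_def)
  moreover have "(\<Sum>k\<in>F2. 1 / lam k) \<le> area_const 42"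
  proof (rule sum_generation_le)
    show "finite F2" using F(1) by (simp add: F2_def)
    show "gen k = gen k0 \<and> cmod (cis t - x k) \<le> 42 * delta k" if "k \<in> F2" for k
      using that F(2)[of k] near_dist[of k t] by (simp add: F2_def chosen_def)
  qed simp
  ultimately show ?thesis by linarith
qed

text \<open>At the first \<open>n\<close> with level sum at least 1, every near bubble of a
  generation between \<open>n0\<close> and \<open>n\<close> has been chosen. Such an
  \<open>n\<close> exists because only finitely many bubbles have generation below
  \<open>n0\<close>.\<close>

lemma chosen_sum_ge:
  assumes inf: "near_sum t = \<infinity>"
  shows "\<exists>F. finite F \<and> (\<forall>k\<in>F. chosen n0 k t) \<and> 1 \<le> (\<Sum>k\<in>F. 1 / lam k)"
proof -
  have "\<exists>n. 1 \<le> level_sum n0 n t"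
  proof (rule ccontr)
    assume "\<nexists>n. 1 \<le> level_sum n0 n t"
    then have less: "level_sum n0 n t < 1" for n by (simp add: not_le)
    define c where "c = (\<Sum>k | gen k < n0. 1 / lam k)"
    have "near_sum t \<le> ennreal (c + 1)"
      unfolding near_sum_def
    proof (rule suminf_le_const)
      show "summable (\<lambda>k. ennreal (if near k t then 1 / lam k else 0))" by simp
      fix j
      define n where "n = Suc (Max (gen ` {..j}))"
      have n: "gen k < n" if "k < j" for k
        using that unfolding n_def less_Suc_eq_le by (intro Max_ge) auto
      have "(\<Sum>k<j. if near k t then 1 / lam k else 0) = (\<Sum>k | k < j \<and> near k t. 1 / lam k)"
        by (rule sum.mono_neutral_cong_right) auto
      also have "\<dots> \<le> (\<Sum>k\<in>{k. gen k < n0} \<union> {k. n0 \<le> gen k \<and> gen k < n \<and> near k t}. 1 / lam k)"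
      proof (rule sum_mono2)
        show "finite ({k. gen k < n0} \<union> {k. n0 \<le> gen k \<and> gen k < n \<and> near k t})"
          using finite_gen finite_level by blast
        show "{k. k < j \<and> near k t} \<subseteq> {k. gen k < n0} \<union> {k. n0 \<le> gen k \<and> gen k < n \<and> near k t}"
          using n by auto
        show "0 \<le> 1 / lam k" for k using lam(2)[of k] by simp
      qed
      also have "\<dots> = c + level_sum n0 n t"
        unfolding c_def level_sum_def by (rule sum.union_disjoint[OF finite_gen finite_level]) auto
      also have "\<dots> \<le> c + 1" using less[of n] by simp
      finally have le: "(\<Sum>k<j. if near k t then 1 / lam k else 0) \<le> c + 1" .
      have "(\<Sum>k<j. ennreal (if near k t then 1 / lam k else 0)) = ennreal (\<Sum>k<j. if near k t then 1 / lam k else 0)"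
        using lam(2) by (intro sum_ennreal) (simp add: less_imp_le)
      then show "(\<Sum>k<j. ennreal (if near k t then 1 / lam k else 0)) \<le> ennreal (c + 1)"
        using ennreal_leI[OF le] by (simp only:)
    qed
    then show False using inf by (simp add: top_unique)
  qed
  define n where "n = (LEAST n. 1 \<le> level_sum n0 n t)"
  have n: "1 \<le> level_sum n0 n t"
    unfolding n_def by (rule LeastI_ex) fact
  have n': "level_sum n0 m t < 1" if "m < n" for m
    using not_less_Least[of m "\<lambda>n. 1 \<le> level_sum n0 n t"] that by (simp add: n_def)
  show ?thesis
  proof (intro exI conjI ballI)
    show "finite {k. n0 \<le> gen k \<and> gen k < n \<and> near k t}" by (rule finite_level)
    show "chosen n0 k t" if "k \<in> {k. n0 \<le> gen k \<and> gen k < n \<and> near k t}" for k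
      using that n' by (simp add: chosen_def)
    show "1 \<le> (\<Sum>k | n0 \<le> gen k \<and> gen k < n \<and> near k t. 1 / lam k)"
      using n by (simp add: level_sum_def)
  qed
qed

text \<open>Here 844 = 4 * 211, where 4 belongs to \<open>measure_circle_cap_le\<close> and 211 = 42
  * 5 + 1 is the factor by which the cap in \<open>carleson\<close> exceeds
  \<open>s\<close>.\<close>

definition carleson_const :: real where "carleson_const = 844 * (1 + area_const 42)"

lemma carleson_const_ge: "844 \<le> carleson_const"
  using area_const_pos[of 42] by (simp add: carleson_const_def)

text \<open>The mass \<open>delta k / lam k\<close> is at most the integral of
  \<open>1 / lam k\<close> over a cell on which \<open>k\<close> is chosen. These cells lie in a cap
  of radius \<open>211 * s\<close>, and at each point \<open>chosen_sum_le\<close> bounds the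
  overlap. The condition on \<open>1 - cmod w\<close> gives
  \<open>delta k \<le> 5 * s\<close>.\<close>

lemma carleson:
  assumes K: "finite K" "\<And>k. k \<in> K \<Longrightarrow> \<exists>t. 0 \<le> t \<and> t < 2 * pi \<and> chosen n0 k t"
    and w: "cmod w < 1" and s: "0 < s" "1 - cmod w \<le> 4 * s" and near: "\<And>k. k \<in> K \<Longrightarrow> cmod (w - x k) \<le> s"
  shows "(\<Sum>k\<in>K. delta k / lam k) \<le> carleson_const * s"
proof -
  obtain \<tau> where \<tau>: "\<And>k. k \<in> K \<Longrightarrow> 0 \<le> \<tau> k \<and> \<tau> k < 2 * pi \<and> chosen n0 k (\<tau> k)"
    using K(2) by metis
  define U where "U k = cell (gen k) (\<tau> k)" for k
  have U [measurable]: "U k \<in> sets borel" for k by (simp add: U_def)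
  define Z where "Z = {t. cmod (cis t - w) \<le> 211 * s}"
  have Z [measurable]: "Z \<in> sets borel" unfolding Z_def by measurable
  have UZ: "t \<in> Z" "chosen n0 k t" if k: "k \<in> K" and t: "t \<in> U k" for k t
  proof -
    show ch: "chosen n0 k t" using chosen_cell[of n0 k "\<tau> k" t] \<tau>[OF k] t by (simp add: U_def)
    have "delta k \<le> 5 * s"
      using near[OF k] s(2) norm_triangle_ineq2[of w "x k"] by (simp add: delta_def)
    moreover have "cmod (cis t - x k) \<le> 42 * delta k" using near_dist ch by (simp add: chosen_def)
    moreover have "cmod (cis t - w) \<le> cmod (cis t - x k) + cmod (w - x k)"
      using norm_triangle_ineq4[of "cis t - x k" "w - x k"] by simp
    ultimately show "t \<in> Z" using near[OF k] by (simp add: Z_def)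
  qed
  have int: "integrable angle_measure (\<lambda>t. 1 / lam k * indicator (U k) t)" for k
    by (intro integrable_mult_right integrable_real_indicator) (auto simp: less_top[symmetric])
  have "(\<Sum>k\<in>K. delta k / lam k) \<le> (\<Sum>k\<in>K. 1 / lam k * measure angle_measure (U k))"
  proof (rule sum_mono)
    fix k assume k: "k \<in> K"
    have "1 / lam k * delta k \<le> 1 / lam k * (1 / 2) ^ gen k"
      using gen(2)[of k] lam(2)[of k] by (intro mult_left_mono) auto
    then show "delta k / lam k \<le> 1 / lam k * measure angle_measure (U k)"
      using \<tau>[OF k] by (simp add: U_def measure_cell)
  qed
  also have "\<dots> = (LINT t|angle_measure. (\<Sum>k\<in>K. 1 / lam k * indicator (U k) t))"
    by (subst Bochner_Integration.integral_sum[OF int]) simp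
  also have "\<dots> \<le> (LINT t|angle_measure. (1 + area_const 42) * indicator Z t)"
  proof (rule integral_mono)
    show "integrable angle_measure (\<lambda>t. \<Sum>k\<in>K. 1 / lam k * indicator (U k) t)"
      by (intro Bochner_Integration.integrable_sum int)
    show "integrable angle_measure (\<lambda>t. (1 + area_const 42) * indicator Z t)"
      by (intro integrable_mult_right integrable_real_indicator) (auto simp: less_top[symmetric])
    fix t
    have "(\<Sum>k\<in>K. 1 / lam k * indicator (U k) t) = (\<Sum>k | k \<in> K \<and> t \<in> U k. 1 / lam k)"
      using K(1) by (intro sum.mono_neutral_cong_right) (auto simp: indicator_def)
    also have "\<dots> \<le> (1 + area_const 42) * indicator Z t"
    proof (cases "t \<in> Z")
      case True
      have "(\<Sum>k | k \<in> K \<and> t \<in> U k. 1 / lam k) \<le> 1 + area_const 42"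
        by (rule chosen_sum_le[where t=t and ?n0.0=n0]) (use K(1) UZ in auto)
      then show ?thesis using True by simp
    next
      case False
      then have "{k. k \<in> K \<and> t \<in> U k} = {}" using UZ(1) by blast
      then show ?thesis using False by (simp only: sum.empty indicator_simps) simp
    qed
    finally show "(\<Sum>k\<in>K. 1 / lam k * indicator (U k) t) \<le> (1 + area_const 42) * indicator Z t" .
  qed
  also have "\<dots> = (1 + area_const 42) * measure angle_measure Z" by simp
  also have "\<dots> \<le> (1 + area_const 42) * (4 * (211 * s))"
    unfolding Z_def using area_const_pos[of 42] s(1) by (intro mult_left_mono measure_circle_cap_le w) auto
  finally show ?thesis by (simp add: carleson_const_def algebra_simps)
qed

text \<open>The chosen sums reach 1 almost everywhere on the cell \<open>J\<close> under
  \<open>z\<close>, whose measure is at least \<open>1 - cmod z\<close>. A chosen bubble contributes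
  only on a cap of measure at most \<open>168 * delta k\<close>, where 168 = 4 * 42.\<close>

lemma chosen_mass:
  assumes inf: "AE t in angle_measure. near_sum t = \<infinity>" and z: "cmod z < 1"
  shows "\<exists>K. finite K \<and>
    (\<forall>k\<in>K. \<exists>t. 0 \<le> t \<and> t < 2 * pi \<and> chosen n0 k t \<and> cmod (cis t - z) \<le> 15 * (1 - cmod z)) \<and>
    1 - cmod z \<le> 336 * (\<Sum>k\<in>K. delta k / lam k)"
proof -
  define dz where "dz = 1 - cmod z"
  have dz: "0 < dz" "dz \<le> 1" using z by (auto simp: dz_def)
  obtain n1 where n1: "(1 / 2) ^ Suc n1 < dz" "dz \<le> (1 / 2) ^ n1" using dyadic_level[OF dz] by blast
  obtain \<tau> where \<tau>: "0 \<le> \<tau>" "\<tau> < 2 * pi" "z = of_real (cmod z) * cis \<tau>" by (rule polar)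
  define J where "J = cell n1 \<tau>"
  have J [measurable]: "J \<in> sets borel" by (simp add: J_def)
  have J1: "0 \<le> t" "t < 2 * pi" "cmod (cis t - z) \<le> 15 * dz" if "t \<in> J" for t
  proof -
    have "t \<in> {0..<2 * pi}" using that cell_subset[OF \<tau>(1,2)] unfolding J_def by blast
    then show "0 \<le> t" "t < 2 * pi" by simp_all
    have "cmod (cis t - cis \<tau>) \<le> 7 * (1 / 2) ^ n1" using cell_diff_le that by (simp add: J_def)
    moreover have "cmod (cis \<tau> - z) = dz" using polar_dist[OF \<tau>(3) z] by (simp add: dz_def)
    moreover have "cmod (cis t - z) \<le> cmod (cis t - cis \<tau>) + cmod (cis \<tau> - z)"
      using norm_triangle_ineq[of "cis t - cis \<tau>" "cis \<tau> - z"] by simp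
    ultimately show "cmod (cis t - z) \<le> 15 * dz" using n1(1) by simp
  qed
  define KI where "KI = {k. \<exists>t\<in>J. chosen n0 k t}"
  define cap where "cap k = {t. cmod (cis t - x k) \<le> 42 * delta k}" for k
  have cap [measurable]: "cap k \<in> sets borel" for k unfolding cap_def by measurable
  define f where "f k t = (if k \<in> KI then ennreal (1 / lam k) else 0) * indicator (cap k) t" for k t
  have f [measurable]: "f k \<in> borel_measurable borel" for k unfolding f_def by measurable
  have ge1: "1 \<le> (\<Sum>k. f k t)" if t: "t \<in> J" "near_sum t = \<infinity>" for t
  proof -
    obtain F where F: "finite F" "\<And>k. k \<in> F \<Longrightarrow> chosen n0 k t" "1 \<le> (\<Sum>k\<in>F. 1 / lam k)"
      using chosen_sum_ge[OF t(2), of n0] by auto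
    have fk: "f k t = ennreal (1 / lam k)" if "k \<in> F" for k
    proof -
      have "k \<in> KI" using F(2)[OF that] t(1) by (auto simp: KI_def)
      moreover have "t \<in> cap k" using F(2)[OF that] near_dist by (simp add: cap_def chosen_def)
      ultimately show ?thesis by (simp add: f_def)
    qed
    have "1 \<le> ennreal (\<Sum>k\<in>F. 1 / lam k)" using F(3) by (simp add: ennreal_1[symmetric] ennreal_leI del: ennreal_1)
    also have "\<dots> = (\<Sum>k\<in>F. ennreal (1 / lam k))"
      using lam(2) by (intro sum_ennreal[symmetric]) (simp add: less_imp_le)
    also have "\<dots> = (\<Sum>k\<in>F. f k t)" by (simp add: fk)
    also have "\<dots> \<le> (\<Sum>k. f k t)" by (intro sum_le_suminf F(1)) auto
    finally show ?thesis .
  qed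
  have "ennreal ((1 / 2) ^ n1) = emeasure angle_measure J"
    using measure_cell[OF \<tau>(1,2)] by (simp add: J_def angle.emeasure_eq_measure)
  also have "\<dots> = (\<integral>\<^sup>+ t. indicator J t \<partial>angle_measure)" by simp
  also have "\<dots> \<le> (\<integral>\<^sup>+ t. (\<Sum>k. f k t) \<partial>angle_measure)"
  proof (rule nn_integral_mono_AE, rule eventually_mono[OF inf])
    show "indicator J t \<le> (\<Sum>k. f k t)" if "near_sum t = \<infinity>" for t
      using ge1[OF _ that] by (cases "t \<in> J") simp_all
  qed
  also have "\<dots> = (\<Sum>k. \<integral>\<^sup>+ t. f k t \<partial>angle_measure)"
    by (rule nn_integral_suminf) measurable
  also have "\<dots> \<le> (\<Sum>k. ennreal (if k \<in> KI then 168 * (delta k / lam k) else 0))"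
  proof (intro suminf_le)
    fix k
    show "(\<integral>\<^sup>+ t. f k t \<partial>angle_measure) \<le> ennreal (if k \<in> KI then 168 * (delta k / lam k) else 0)"
    proof (cases "k \<in> KI")
      case True
      have "(\<integral>\<^sup>+ t. f k t \<partial>angle_measure) = ennreal (1 / lam k) * emeasure angle_measure (cap k)"
        using True by (simp add: f_def nn_integral_cmult)
      also have "\<dots> = ennreal (1 / lam k * measure angle_measure (cap k))"
        using lam(2)[of k] unfolding angle.emeasure_eq_measure by (subst ennreal_mult') auto
      also have "\<dots> \<le> ennreal (1 / lam k * (4 * (42 * delta k)))"
        unfolding cap_def using lam(2)[of k] delta(1)[of k]
        by (intro ennreal_leI mult_left_mono measure_circle_cap_le norm_x) auto
      finally show ?thesis using True by (simp add: mult_ac)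
    qed (simp add: f_def)
  qed simp_all
  finally have "ennreal ((1 / 2) ^ n1) \<le> (\<Sum>k. ennreal (if k \<in> KI then 168 * (delta k / lam k) else 0))" .
  \<comment> \<open>A factor 2 is given away to make the inequality strict, so that a finite partial
    sum already exceeds the bound.\<close>
  moreover have "ennreal (dz / 2) < ennreal ((1 / 2) ^ n1)"
    using n1(2) dz by (intro ennreal_lessI) auto
  ultimately have "ennreal (dz / 2) < (\<Sum>k. ennreal (if k \<in> KI then 168 * (delta k / lam k) else 0))"
    by simp
  then obtain j where j: "ennreal (dz / 2) < (\<Sum>k<j. ennreal (if k \<in> KI then 168 * (delta k / lam k) else 0))"
    unfolding suminf_eq_SUP less_SUP_iff by blast
  define K where "K = {k. k < j \<and> k \<in> KI}"
  have "(\<Sum>k<j. ennreal (if k \<in> KI then 168 * (delta k / lam k) else 0))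
      = ennreal (\<Sum>k<j. if k \<in> KI then 168 * (delta k / lam k) else 0)"
    by (intro sum_ennreal) (auto intro!: divide_nonneg_nonneg mult_nonneg_nonneg less_imp_le[OF delta(1)] less_imp_le[OF lam(2)])
  also have "(\<Sum>k<j. if k \<in> KI then 168 * (delta k / lam k) else 0) = (\<Sum>k\<in>K. 168 * (delta k / lam k))"
    by (rule sum.mono_neutral_cong_right) (auto simp: K_def)
  also have "\<dots> = 168 * (\<Sum>k\<in>K. delta k / lam k)" by (simp only: sum_distrib_left)
  finally have "dz / 2 < 168 * (\<Sum>k\<in>K. delta k / lam k)"
    using j dz by (simp add: ennreal_less_iff)
  then have "dz \<le> 336 * (\<Sum>k\<in>K. delta k / lam k)" by simp
  moreover have "finite K" by (simp add: K_def)
  moreover have "\<exists>t. 0 \<le> t \<and> t < 2 * pi \<and> chosen n0 k t \<and> cmod (cis t - z) \<le> 15 * dz" if "k \<in> K" for k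
    using that J1 by (auto simp: K_def KI_def)
  ultimately show ?thesis unfolding dz_def by blast
qed

end


subsection \<open>Green potentials of separated bubbles\<close>

lemma tgreen_boundary:
  assumes x: "cmod x < 1" and m: "0 < m" "m < 1" and e: "0 < e"
  shows "\<exists>R<1. \<forall>z\<in>ball 0 1. R \<le> cmod z \<longrightarrow> tgreen x m z \<le> e"
proof -
  define d where "d = 1 - cmod x"
  have d: "0 < d" using x by (simp add: d_def)
  define M where "M = - ln m"
  have M: "0 < M" using m by (simp add: M_def)
  have dM: "0 < d\<^sup>2 * M" using d M by (intro mult_pos_pos) auto
  define \<eta> where "\<eta> = min (d / 2) (e * (d\<^sup>2 * M) / 8)"
  have "0 < e * (d\<^sup>2 * M) / 8" using dM e by simp
  then have \<eta>: "0 < \<eta>" unfolding \<eta>_def using d by simp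
  have "tgreen x m z \<le> e" if z: "cmod z < 1" "1 - \<eta> \<le> cmod z" for z
  proof -
    have "\<eta> \<le> d / 2" by (simp add: \<eta>_def)
    then have dist: "d / 2 \<le> cmod (z - x)"
      using z norm_triangle_ineq2[of z x] by (simp add: d_def)
    then have "z \<noteq> x" using d by auto
    have "1 - (cmod z)\<^sup>2 = (1 - cmod z) * (1 + cmod z)" by (simp add: power2_eq_square algebra_simps)
    also have "\<dots> \<le> \<eta> * 2" using z \<eta> by (intro mult_mono) auto
    finally have num: "(1 - (cmod x)\<^sup>2) * (1 - (cmod z)\<^sup>2) \<le> 1 * (\<eta> * 2)"
      using x z \<eta> by (intro mult_mono) (auto simp: power_le_one_iff)
    have "tgreen x m z \<le> (1 - (cmod x)\<^sup>2) * (1 - (cmod z)\<^sup>2) / (cmod (z - x))\<^sup>2 / M"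
      unfolding M_def by (rule tgreen_le_ratio[OF x z(1) \<open>z \<noteq> x\<close> m])
    also have "\<dots> \<le> (1 * (\<eta> * 2)) / (d / 2)\<^sup>2 / M"
      using num dist d \<eta> M by (intro divide_right_mono frac_le power_mono) auto
    also have "\<dots> = 8 * \<eta> / (d\<^sup>2 * M)" by (simp add: power2_eq_square)
    also have "\<dots> \<le> e"
    proof -
      have "\<eta> \<le> e * (d\<^sup>2 * M) / 8" unfolding \<eta>_def by (rule min.cobounded2)
      then have "8 * \<eta> \<le> e * (d\<^sup>2 * M)" by simp
      then show ?thesis using dM by (simp only: pos_divide_le_eq)
    qed
    finally show ?thesis .
  qed
  then show ?thesis using \<eta> by (intro exI[of _ "1 - \<eta>"]) auto
qed

text \<open>By \<open>out\<close> no term is truncated on \<open>\<Omega>\<close>, so the sum has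
  exact means on small circles there. Truncation makes the sum superharmonic, which is the wrong
  sign for its negative, but this happens only outside \<open>\<Omega>\<close>.\<close>

lemma majorant_green_sum:
  fixes x :: "nat \<Rightarrow> complex" and m :: "nat \<Rightarrow> real"
  assumes K: "finite K" and x: "\<And>k. cmod (x k) < 1" and m: "\<And>k. 0 < m k \<and> m k < 1"
    and \<Omega>: "\<Omega> \<subseteq> ball 0 1" and out: "\<And>k z. z \<in> \<Omega> \<Longrightarrow> m k < cmod (blaschke (x k) z)"
    and G: "0 < G" "\<And>z. z \<in> ball 0 1 \<Longrightarrow> (\<Sum>k\<in>K. tgreen (x k) (m k) z) \<le> G"
  shows "majorant \<Omega> (\<lambda>z. 1 - (\<Sum>k\<in>K. tgreen (x k) (m k) z) / G)" (is "majorant \<Omega> ?v")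
  unfolding majorant_def
proof (intro conjI ballI allI impI)
  have ct: "continuous_on (ball 0 1) (tgreen (x k) (m k))" for k
    using continuous_on_tgreen[OF x] m by blast
  show "continuous_on (ball 0 1) ?v" using G(1) by (intro continuous_intros ct) auto
  show "0 \<le> ?v z" if "z \<in> ball 0 1" for z using G(2)[OF that] G(1) by (simp add: divide_le_eq)
  have nn: "0 \<le> (\<Sum>k\<in>K. tgreen (x k) (m k) z)" if "z \<in> ball 0 1" for z
    using that m by (intro sum_nonneg tgreen_nonneg[OF x]) auto
  show "?v z \<le> 1" if "z \<in> ball 0 1" for z using nn[OF that] G(1) by simp
  show "superharmonic_at ?v z" if z: "z \<in> \<Omega>" for z
  proof -
    have zb: "cmod z < 1" using z \<Omega> by auto
    have "\<forall>\<^sub>F \<rho> in at_right 0. \<forall>k\<in>K. cmean (tgreen (x k) (m k)) z \<rho> = tgreen (x k) (m k) z"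
      using K m out[OF z] by (intro eventually_ball_finite ballI tgreen_mean_value[OF x zb]) auto
    moreover have "\<forall>\<^sub>F \<rho> in at_right 0. 0 < \<rho> \<and> cball z \<rho> \<subseteq> ball 0 1"
      by (rule eventually_cball_subset) (use zb in auto)
    ultimately show ?thesis
      unfolding superharmonic_at_def
    proof eventually_elim
      case (elim \<rho>)
      have cs: "continuous_on (sphere z \<rho>) (tgreen (x k) (m k))" for k
        using continuous_on_sphere_in_ball[OF ct] elim by blast
      have cS: "continuous_on (sphere z \<rho>) (\<lambda>z. \<Sum>k\<in>K. tgreen (x k) (m k) z)"
        by (intro continuous_on_sum cs)
      have "cmean ?v z \<rho> = 1 - cmean (\<lambda>z. (1 / G) * (\<Sum>k\<in>K. tgreen (x k) (m k) z)) z \<rho>"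
      proof -
        have "continuous_on (sphere z \<rho>) (\<lambda>z. (1 / G) * (\<Sum>k\<in>K. tgreen (x k) (m k) z))"
          by (intro continuous_on_mult continuous_on_const cS)
        from cmean_diff[OF continuous_on_const this, of 1] elim show ?thesis by simp
      qed
      also have "\<dots> = 1 - (1 / G) * (\<Sum>k\<in>K. cmean (tgreen (x k) (m k)) z \<rho>)"
        using elim cs by (simp only: cmean_mult cmean_sum less_imp_le)
      also have "\<dots> = ?v z" using elim by simp
      finally show ?case by simp
    qed
  qed
  fix e :: real assume e: "0 < e"
  define e' where "e' = e * G / (real (card K) + 1)"
  have e': "0 < e'" unfolding e'_def using e G(1) by (intro divide_pos_pos mult_pos_pos) auto
  have "\<exists>R<1. \<forall>z\<in>ball 0 1. R \<le> cmod z \<longrightarrow> tgreen (x k) (m k) z \<le> e'" for k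
    using tgreen_boundary[OF x _ _ e'] m by blast
  then obtain R where R: "\<And>k. R k < 1" "\<And>k z. z \<in> ball 0 1 \<Longrightarrow> R k \<le> cmod z \<Longrightarrow> tgreen (x k) (m k) z \<le> e'"
    by metis
  define R' where "R' = Max (insert 0 (R ` K))"
  have "R' < 1" unfolding R'_def using K R(1) by (subst Max_less_iff) auto
  moreover have "1 - e \<le> ?v z" if z: "z \<in> ball 0 1" "R' \<le> cmod z" for z
  proof -
    have "(\<Sum>k\<in>K. tgreen (x k) (m k) z) \<le> (\<Sum>k\<in>K. e')"
    proof (rule sum_mono)
      fix k assume "k \<in> K"
      then have "R k \<le> R'" unfolding R'_def using K by (intro Max_ge) auto
      then show "tgreen (x k) (m k) z \<le> e'" using R(2)[OF z(1), of k] z(2) by simp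
    qed
    also have "\<dots> = real (card K) * e'" by simp
    also have "\<dots> \<le> (real (card K) + 1) * e'" using e' by (intro mult_right_mono) auto
    also have "\<dots> = e * G" by (simp add: e'_def field_simps add_nonneg_eq_0_iff)
    finally show ?thesis using G(1) by (simp add: divide_le_eq)
  qed
  ultimately show "\<exists>R<1. \<forall>z\<in>ball 0 1. R \<le> cmod z \<longrightarrow> 1 - e \<le> ?v z" by blast
qed

context separated_champagne
begin

text \<open>The level of \<open>cmod_blaschke_gt\<close>, so that truncation is confined to the
  bubble. It is smaller than the level \<open>r k / delta k\<close> that reaches over the whole
  bubble.\<close>

definition cut :: "nat \<Rightarrow> real" where "cut k = r k / (r k + 2 * delta k)"

lemma r_pos: "0 < r k"
  using champagne_bubble[OF ch] by simp

lemma cut: "0 < cut k" "cut k < 1"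
  using r_pos[of k] delta(1)[of k] by (auto simp: cut_def divide_less_eq)

lemma lam_le_cut: "lam k \<le> - ln (cut k)"
proof -
  have "delta k / r k \<le> (r k + 2 * delta k) / r k"
    using r_pos[of k] delta(1)[of k] by (intro divide_right_mono) auto
  then have "ln (delta k / r k) \<le> ln ((r k + 2 * delta k) / r k)"
    using r_pos[of k] delta(1)[of k] by (intro ln_mono) auto
  then show ?thesis
    using r_pos[of k] delta(1)[of k] by (simp add: lam_def delta_def[symmetric] cut_def ln_div)
qed

text \<open>From \<open>r k < delta k\<close> one gets that \<open>- ln (cut k)\<close> is at most
  \<open>ln 3 + lam k\<close>, and the lower bound \<open>L\<close> for \<open>lam k\<close> absorbs
  the additive constant.\<close>

definition cut_const :: real where "cut_const = 1 + ln 3 / L"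

lemma cut_const_ge: "1 \<le> cut_const"
  using L(1) by (simp add: cut_const_def)

lemma cut_le_lam: "- ln (cut k) \<le> cut_const * lam k"
proof -
  have "r k < delta k" using champagne_radius[OF ch] by (simp add: delta_def)
  then have "(r k + 2 * delta k) / r k \<le> 3 * (delta k / r k)"
    using r_pos[of k] divide_right_mono[of "r k + 2 * delta k" "3 * delta k" "r k"] by simp
  then have "ln ((r k + 2 * delta k) / r k) \<le> ln (3 * (delta k / r k))"
    using r_pos[of k] delta(1)[of k] by (intro ln_mono) auto
  also have "\<dots> = ln 3 + lam k"
    using r_pos[of k] delta(1)[of k] by (subst ln_mult) (auto simp: lam_def delta_def)
  also have "ln 3 = ln 3 / L * L" using L(1) by simp
  also have "\<dots> \<le> ln 3 / L * lam k"
    using lam(1)[of k] L(1) by (intro mult_left_mono) auto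
  finally have "ln ((r k + 2 * delta k) / r k) \<le> cut_const * lam k"
    by (simp add: cut_const_def algebra_simps)
  then show ?thesis
    using r_pos[of k] delta(1)[of k] by (simp add: cut_def ln_div)
qed

lemma tgreen_le_lam:
  assumes "t \<le> s / (- ln (cut k))" "0 \<le> s"
  shows "t \<le> s / lam k"
proof -
  have "s / (- ln (cut k)) \<le> s / lam k"
    using lam_le_cut[of k] lam(2)[of k] assms(2) by (intro divide_left_mono mult_pos_pos) auto
  then show ?thesis using assms(1) by linarith
qed

lemma one_minus_norm_sq:
  fixes z :: complex
  assumes "cmod z < 1"
  shows "1 - cmod z \<le> 1 - (cmod z)\<^sup>2" "1 - (cmod z)\<^sup>2 \<le> 2 * (1 - cmod z)"
proof -
  have eq: "1 - (cmod z)\<^sup>2 = (1 - cmod z) * (1 + cmod z)" by (simp add: power2_eq_square algebra_simps)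
  have "(1 - cmod z) * 1 \<le> (1 - cmod z) * (1 + cmod z)" "(1 - cmod z) * (1 + cmod z) \<le> (1 - cmod z) * 2"
    using assms by (intro mult_left_mono; simp)+
  then show "1 - cmod z \<le> 1 - (cmod z)\<^sup>2" "1 - (cmod z)\<^sup>2 \<le> 2 * (1 - cmod z)" unfolding eq by simp_all
qed

text \<open>The three summands bound the contributions of far poles, of near poles whose discs avoid
  the point, and of the at most one pole whose disc contains it.\<close>

definition green_const :: real where
  "green_const = 256 * carleson_const + 64 / a\<^sup>2 + 1"

lemma green_const_ge: "1 \<le> green_const"
  using carleson_const_ge by (simp add: green_const_def)

lemma green_sum_le:
  assumes K: "finite K" "\<And>k. k \<in> K \<Longrightarrow> \<exists>t. 0 \<le> t \<and> t < 2 * pi \<and> chosen n0 k t"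
    and w: "w \<in> ball 0 1"
  shows "(\<Sum>k\<in>K. tgreen (x k) (cut k) w) \<le> green_const"
proof -
  define dw where "dw = 1 - cmod w"
  have w1: "cmod w < 1" using w by simp
  have dw: "0 < dw" using w1 by (simp add: dw_def)
  define g where "g k = tgreen (x k) (cut k) w" for k
  define d where "d k = cmod (w - x k)" for k
  have d0: "0 \<le> d k" for k by (simp add: d_def)
  have sq: "0 \<le> 1 - (cmod (x k))\<^sup>2" "1 - (cmod (x k))\<^sup>2 \<le> 2 * delta k" "0 \<le> 1 - (cmod w)\<^sup>2" "1 - (cmod w)\<^sup>2 \<le> 2 * dw" for k
    using one_minus_norm_sq[OF norm_x, of k] one_minus_norm_sq[OF w1] norm_x[of k] w1 by (auto simp: delta_def dw_def)
  have prod: "(1 - (cmod (x k))\<^sup>2) * (1 - (cmod w)\<^sup>2) \<le> 4 * delta k * dw" for k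
    using mult_mono[OF sq(2)[of k] sq(4)] sq delta(1)[of k] by simp
  \<comment> \<open>The cut at \<open>dw / 4\<close> matches the condition of
    \<open>carleson\<close>, which applies at radii from \<open>dw / 4\<close> on. Below it
    \<open>delta k\<close> is comparable to \<open>dw\<close>, so that areas control the sums of
    \<open>1 / lam k\<close>.\<close>
  define K1 where "K1 = {k \<in> K. dw / 4 \<le> d k}"
  define K2 where "K2 = {k \<in> K. d k < dw / 4 \<and> disc_rad k \<le> d k}"
  define K3 where "K3 = {k \<in> K. d k < dw / 4 \<and> d k < disc_rad k}"
  have KK: "K = K1 \<union> (K2 \<union> K3)" by (auto simp: K1_def K2_def K3_def)
  have fin: "finite K1" "finite K2" "finite K3" using K(1) by (auto simp: K1_def K2_def K3_def)
  have "sum g K = sum g K1 + sum g (K2 \<union> K3)"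
    unfolding KK by (rule sum.union_disjoint) (use fin in \<open>auto simp: K1_def K2_def K3_def\<close>)
  also have "sum g (K2 \<union> K3) = sum g K2 + sum g K3"
    by (rule sum.union_disjoint) (use fin in \<open>auto simp: K2_def K3_def\<close>)
  finally have split: "sum g K = sum g K1 + (sum g K2 + sum g K3)" .
  have "sum g K1 \<le> (\<Sum>k\<in>K1. 4 * dw * (delta k / lam k / (d k)\<^sup>2))"
  proof (rule sum_mono)
    fix k assume "k \<in> K1"
    then have dk: "0 < d k" using dw by (auto simp: K1_def)
    then have "w \<noteq> x k" by (auto simp: d_def)
    then have "g k \<le> (1 - (cmod (x k))\<^sup>2) * (1 - (cmod w)\<^sup>2) / (d k)\<^sup>2 / (- ln (cut k))"
      unfolding g_def d_def by (rule tgreen_le_ratio[OF norm_x w1 _ cut])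
    then have "g k \<le> (1 - (cmod (x k))\<^sup>2) * (1 - (cmod w)\<^sup>2) / (d k)\<^sup>2 / lam k"
      using sq by (intro tgreen_le_lam) auto
    also have "\<dots> \<le> 4 * delta k * dw / (d k)\<^sup>2 / lam k"
      using prod lam(2)[of k] by (intro divide_right_mono) auto
    finally show "g k \<le> 4 * dw * (delta k / lam k / (d k)\<^sup>2)" by (simp add: mult_ac)
  qed
  also have "\<dots> = 4 * dw * (\<Sum>k\<in>K1. delta k / lam k / (d k)\<^sup>2)" by (simp only: sum_distrib_left)
  also have "(\<Sum>k\<in>K1. delta k / lam k / (d k)\<^sup>2) \<le> 16 * carleson_const / (dw / 4)"
  proof (rule sum_inverse_square_le)
    fix s assume s: "dw / 4 \<le> s"
    show "(\<Sum>k | k \<in> K1 \<and> d k \<le> s. delta k / lam k) \<le> carleson_const * s"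
    proof (rule carleson)
      show "\<exists>t. 0 \<le> t \<and> t < 2 * pi \<and> chosen n0 k t" if "k \<in> {k. k \<in> K1 \<and> d k \<le> s}" for k
        using that K(2) by (simp add: K1_def)
    qed (use fin w1 s dw in \<open>auto simp: d_def dw_def\<close>)
  qed (use fin dw carleson_const_ge delta(1) lam(2) in \<open>auto simp: K1_def less_imp_le intro!: divide_nonneg_nonneg\<close>)
  also have "4 * dw * (16 * carleson_const / (dw / 4)) = 256 * carleson_const" using dw by simp
  finally have b1: "sum g K1 \<le> 256 * carleson_const" using dw by simp
  have deltaK: "3 / 4 * dw \<le> delta k" "delta k \<le> 5 / 4 * dw" if "d k < dw / 4" for k
    using that norm_triangle_ineq2[of w "x k"] norm_triangle_ineq2[of "x k" w]
    by (auto simp: d_def dw_def delta_def norm_minus_commute)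
  \<comment> \<open>With mass of quadratic growth, the bound of order 2 used for \<open>K1\<close>
    would lose a logarithm here; the square root bound has order 1 and is summable.\<close>
  have "sum g K2 \<le> (\<Sum>k\<in>K2. 3 * dw * (1 / lam k / d k))"
  proof (rule sum_mono)
    fix k assume k: "k \<in> K2"
    then have dk: "0 < d k" using disc_rad(1)[of k] by (auto simp: K2_def)
    then have "w \<noteq> x k" by (auto simp: d_def)
    then have "g k \<le> sqrt ((1 - (cmod (x k))\<^sup>2) * (1 - (cmod w)\<^sup>2)) / d k / (- ln (cut k))"
      unfolding g_def d_def by (rule tgreen_le_sqrt_ratio[OF norm_x w1 _ cut])
    then have "g k \<le> sqrt ((1 - (cmod (x k))\<^sup>2) * (1 - (cmod w)\<^sup>2)) / d k / lam k"
      using sq d0 by (intro tgreen_le_lam) auto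
    also have "\<dots> \<le> 3 * dw / d k / lam k"
    proof (intro divide_right_mono)
      have "(1 - (cmod (x k))\<^sup>2) * (1 - (cmod w)\<^sup>2) \<le> 4 * delta k * dw" by (rule prod)
      also have "\<dots> \<le> 4 * (5 / 4 * dw) * dw"
        using deltaK(2)[of k] k dw by (intro mult_right_mono mult_left_mono) (auto simp: K2_def)
      also have "\<dots> \<le> (3 * dw)\<^sup>2" by (simp add: power2_eq_square)
      finally show "sqrt ((1 - (cmod (x k))\<^sup>2) * (1 - (cmod w)\<^sup>2)) \<le> 3 * dw"
        using dw by (intro real_le_lsqrt) auto
    qed (use d0 lam(2)[of k] in auto)
    finally show "g k \<le> 3 * dw * (1 / lam k / d k)" by (simp add: mult_ac)
  qed
  also have "\<dots> = 3 * dw * (\<Sum>k\<in>K2. 1 / lam k / d k)" by (simp only: sum_distrib_left)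
  also have "(\<Sum>k\<in>K2. 1 / lam k / d k) \<le> 4 * (64 / (9 * a\<^sup>2 * dw\<^sup>2)) * (dw / 4)"
  proof (rule sum_inverse_le)
    fix s :: real assume s: "0 < s"
    have "(\<Sum>k | k \<in> K2 \<and> d k \<le> s. 1 / lam k) \<le> (2 * s)\<^sup>2 / (a\<^sup>2 * (3 / 4 * dw)\<^sup>2)"
    proof (rule sum_inverse_lam_le[where p=w])
      \<comment> \<open>For \<open>K2\<close> the point \<open>w\<close> is outside the disc around
        \<open>x k\<close>, so the disc radius is at most the distance \<open>d k\<close>.\<close>
      show "dist w (x k) + disc_rad k \<le> 2 * s" if "k \<in> {k. k \<in> K2 \<and> d k \<le> s}" for k
        using that by (auto simp: K2_def d_def dist_norm)
    qed (use K(1) s dw deltaK in \<open>auto simp: K2_def\<close>)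
    also have "\<dots> = 64 / (9 * a\<^sup>2 * dw\<^sup>2) * s\<^sup>2"
      using a(1) dw by (simp add: power2_eq_square field_simps)
    finally show "(\<Sum>k | k \<in> K2 \<and> d k \<le> s. 1 / lam k) \<le> 64 / (9 * a\<^sup>2 * dw\<^sup>2) * s\<^sup>2" .
  next
    show "0 < d k \<and> d k \<le> dw / 4" if "k \<in> K2" for k
      using that disc_rad(1)[of k] by (auto simp: K2_def)
  qed (use fin dw lam(2) a(1) in \<open>auto simp: less_imp_le\<close>)
  also have "3 * dw * (4 * (64 / (9 * a\<^sup>2 * dw\<^sup>2)) * (dw / 4)) \<le> 64 / a\<^sup>2"
    using dw a(1) by (simp add: power2_eq_square field_simps)
  finally have b2: "sum g K2 \<le> 64 / a\<^sup>2" using dw by simp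
  have "sum g K3 \<le> (\<Sum>k\<in>K3. 1)" unfolding g_def by (intro sum_mono tgreen_le_1 cut)
  also have "\<dots> = real (card K3)" by simp
  also have "card K3 \<le> 1"
  proof -
    have "j = k" if "j \<in> K3" "k \<in> K3" for j k
    proof (rule ccontr)
      assume "j \<noteq> k"
      then have "disc_rad j + disc_rad k \<le> dist (x j) (x k)" by (rule disc_rad_sep)
      also have "\<dots> \<le> d j + d k"
        using norm_triangle_ineq4[of "w - x k" "w - x j"] by (simp add: dist_norm d_def)
      finally show False using that by (auto simp: K3_def)
    qed
    then show ?thesis using fin(3) by (simp add: card_le_Suc0_iff_eq)
  qed
  finally have b3: "sum g K3 \<le> 1" by simp
  have "sum g K \<le> green_const" using split b1 b2 b3 by (simp add: green_const_def)
  then show ?thesis by (simp add: g_def)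
qed

text \<open>At a point outside the bubbles each selected pole contributes at least
  \<open>delta k / (1024 * cut_const * dz * lam k)\<close>, and the masses add up to at least
  \<open>dz / 336\<close>; the product of 1024 and 336 is 344064.\<close>

lemma green_sum_ge:
  assumes inf: "AE t in angle_measure. near_sum t = \<infinity>"
    and z: "z \<in> ball 0 1 - bubbles x r"
  shows "\<exists>K n0. finite K \<and> (\<forall>k\<in>K. \<exists>t. 0 \<le> t \<and> t < 2 * pi \<and> chosen n0 k t) \<and>
    1 / (344064 * cut_const) \<le> (\<Sum>k\<in>K. tgreen (x k) (cut k) z)"
proof -
  define dz where "dz = 1 - cmod z"
  have z1: "cmod z < 1" using z by simp
  have dz: "0 < dz" using z1 by (simp add: dz_def)
  \<comment> \<open>So fine a start gives \<open>84 * delta k \<le> dz\<close> for every chosen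
    \<open>k\<close>. Then the distance of the centre from \<open>z\<close> is between
    \<open>dz / 2\<close> and \<open>16 * dz\<close>, and the ratio \<open>q\<close> is at most 1,
    as \<open>tgreen_ge_ratio_quarter\<close> requires.\<close>
  obtain n0 where n0: "(1 / 2) ^ n0 < dz / 84" using real_arch_pow_inv[of "dz / 84" "1 / 2"] dz by auto
  obtain K where K: "finite K"
    "\<And>k. k \<in> K \<Longrightarrow> \<exists>t. 0 \<le> t \<and> t < 2 * pi \<and> chosen n0 k t \<and> cmod (cis t - z) \<le> 15 * dz"
    "dz \<le> 336 * (\<Sum>k\<in>K. delta k / lam k)"
    using chosen_mass[OF inf z1, of n0] unfolding dz_def by blast
  have g: "1 / (1024 * cut_const * dz) * (delta k / lam k) \<le> tgreen (x k) (cut k) z" if kK: "k \<in> K" for k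
  proof -
    obtain t where t: "chosen n0 k t" "cmod (cis t - z) \<le> 15 * dz" using K(2)[OF kK] by blast
    have "n0 \<le> gen k" using t(1) by (simp add: chosen_def)
    then have "(1 / 2 :: real) ^ gen k \<le> (1 / 2) ^ n0" by (intro power_decreasing) auto
    then have dk: "84 * delta k \<le> dz" using gen(2)[of k] n0 by linarith
    define D where "D = cmod (z - x k)"
    have "D \<le> cmod (cis t - x k) + cmod (cis t - z)"
      using norm_triangle_ineq4[of "cis t - x k" "cis t - z"] by (simp add: D_def)
    moreover have "cmod (cis t - x k) \<le> 42 * delta k" using t(1) near_dist by (simp add: chosen_def)
    ultimately have D1: "D \<le> 16 * dz" using t(2) dk dz by linarith
    have "dz - delta k \<le> D"
      using norm_triangle_ineq2[of "x k" z] by (simp add: D_def dz_def delta_def norm_minus_commute)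
    then have D2: "dz / 2 \<le> D" using dk delta(1)[of k] by linarith
    have D0: "0 < D" using D2 dz by linarith
    then have zx: "z \<noteq> x k" by (auto simp: D_def)
    define q where "q = (1 - (cmod (x k))\<^sup>2) * (1 - (cmod z)\<^sup>2) / D\<^sup>2"
    have sq: "delta k \<le> 1 - (cmod (x k))\<^sup>2" "1 - (cmod (x k))\<^sup>2 \<le> 2 * delta k" "dz \<le> 1 - (cmod z)\<^sup>2" "1 - (cmod z)\<^sup>2 \<le> 2 * dz"
      using one_minus_norm_sq[OF norm_x, of k] one_minus_norm_sq[OF z1] by (auto simp: delta_def dz_def)
    have num: "delta k * dz \<le> (1 - (cmod (x k))\<^sup>2) * (1 - (cmod z)\<^sup>2)"
      "(1 - (cmod (x k))\<^sup>2) * (1 - (cmod z)\<^sup>2) \<le> (2 * delta k) * (2 * dz)"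
      using sq dz delta(1)[of k] by (intro mult_mono; linarith)+
    have Dsq: "D\<^sup>2 \<le> (16 * dz)\<^sup>2" "(dz / 2)\<^sup>2 \<le> D\<^sup>2"
      using D1 D2 D0 dz by (intro power_mono; linarith)+
    have num0: "0 \<le> (1 - (cmod (x k))\<^sup>2) * (1 - (cmod z)\<^sup>2)"
      using num(1) dz delta(1)[of k] by (meson less_imp_le mult_nonneg_nonneg order_trans)
    have "q \<le> (2 * delta k) * (2 * dz) / (dz / 2)\<^sup>2"
      unfolding q_def using num(2) Dsq(2) dz delta(1)[of k] by (intro frac_le) auto
    also have "\<dots> = 16 * delta k / dz" using dz by (simp add: power2_eq_square)
    also have "\<dots> \<le> 1" using dk dz delta(1)[of k] by (simp add: divide_le_eq)
    finally have q1: "q \<le> 1" .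
    have "delta k * dz / (16 * dz)\<^sup>2 \<le> q"
      unfolding q_def using num(1) num0 Dsq(1) D0 dz delta(1)[of k] by (intro frac_le zero_less_power)
    then have q2: "delta k / (256 * dz) \<le> q" using dz by (simp add: power2_eq_square)
    have "z \<notin> cball (x k) (r k)" using z by (auto simp: bubbles_def)
    then have "r k < cmod (z - x k)" by (simp add: dist_norm norm_minus_commute)
    then have "cut k < cmod (blaschke (x k) z)"
      unfolding cut_def delta_def by (rule cmod_blaschke_gt[OF norm_x z1 r_pos])
    then have "q / (4 * (- ln (cut k))) \<le> tgreen (x k) (cut k) z"
      using tgreen_ge_ratio_quarter[OF norm_x z1 zx cut(1)] q1 by (simp add: q_def D_def)
    moreover have "delta k / (256 * dz) / (4 * (cut_const * lam k)) \<le> q / (4 * (- ln (cut k)))"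
    proof (intro frac_le)
      show "0 < 4 * (- ln (cut k))" using cut[of k] by simp
      show "4 * (- ln (cut k)) \<le> 4 * (cut_const * lam k)" using cut_le_lam[of k] by simp
      have "0 \<le> delta k / (256 * dz)" using delta(1)[of k] dz by simp
      then show "0 \<le> q" using q2 by linarith
    qed (rule q2)
    ultimately show ?thesis by (simp add: mult_ac)
  qed
  have "1 / (344064 * cut_const) = 1 / (1024 * cut_const * dz) * (dz / 336)" using dz by simp
  also have "\<dots> \<le> 1 / (1024 * cut_const * dz) * (\<Sum>k\<in>K. delta k / lam k)"
    using K(3) dz cut_const_ge by (intro mult_left_mono) auto
  also have "\<dots> = (\<Sum>k\<in>K. 1 / (1024 * cut_const * dz) * (delta k / lam k))" by (rule sum_distrib_left)
  also have "\<dots> \<le> (\<Sum>k\<in>K. tgreen (x k) (cut k) z)" by (intro sum_mono g)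
  finally have "1 / (344064 * cut_const) \<le> (\<Sum>k\<in>K. tgreen (x k) (cut k) z)" .
  moreover have "\<forall>k\<in>K. \<exists>t. 0 \<le> t \<and> t < 2 * pi \<and> chosen n0 k t" using K(2) by blast
  ultimately show ?thesis using K(1) by (intro exI[of _ K] exI[of _ n0] conjI)
qed

text \<open>Gluing needs a majorant that is small at every point of the disc. Inside a bubble a
  single pole suffices, as the Green function is at least \<open>lam k\<close> there.\<close>

lemma tgreen_bubble_ge:
  assumes "z \<in> cball (x k) (r k)"
  shows "1 / cut_const \<le> tgreen (x k) (cut k) z"
proof -
  have z: "cmod z < 1" using assms champagne_bubble_subset[OF ch, of k] by auto
  have rd: "r k < delta k" using champagne_radius[OF ch] by (simp add: delta_def)
  have "cmod (blaschke (x k) z) \<le> cmod (z - x k) / delta k"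
    using cmod_blaschke_le[OF norm_x z] by (simp add: delta_def)
  also have "\<dots> \<le> r k / delta k"
    using assms delta(1)[of k] by (intro divide_right_mono) (auto simp: dist_norm norm_minus_commute)
  finally have "cmod (blaschke (x k) z) \<le> r k / delta k" .
  moreover have "cut k \<le> r k / delta k"
    unfolding cut_def using r_pos[of k] delta(1)[of k] by (intro divide_left_mono) auto
  moreover have "r k / delta k < 1" using rd delta(1)[of k] by simp
  ultimately have "ln (r k / delta k) / ln (cut k) \<le> tgreen (x k) (cut k) z"
    by (intro tgreen_ge_ratio cut)
  moreover have "ln (r k / delta k) = - lam k"
    using r_pos[of k] delta(1)[of k] by (simp add: lam_def delta_def ln_div)
  moreover have "1 / cut_const \<le> lam k / (- ln (cut k))"
    using cut_le_lam[of k] lam_le_cut[of k] lam(2)[of k] cut_const_ge by (simp add: field_simps)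
  ultimately show ?thesis by simp
qed

lemma unavoidable_bubbles:
  assumes div: "AE t in angle_measure. (\<Sum>k. ennreal (bubble_term x r k (cis t))) = \<infinity>"
  shows "unavoidable (bubbles x r)"
proof (rule unavoidable_if_majorants[OF champagne_open[OF ch]])
  \<comment> \<open>The lower bound of \<open>green_sum_ge\<close> divided by the bound
    \<open>green_const\<close> of the potential. It is also below \<open>1 / cut_const\<close>,
    which covers the points inside bubbles.\<close>
  define c where "c = 1 / (green_const * (344064 * cut_const))"
  have prod: "344064 * cut_const \<le> green_const * (344064 * cut_const)"
    using green_const_ge cut_const_ge mult_right_mono[of 1 green_const "344064 * cut_const"] by simp
  show "0 < c" using green_const_ge cut_const_ge by (simp add: c_def)
  have "1 < green_const * (344064 * cut_const)" using prod cut_const_ge by linarith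
  then show "c < 1" unfolding c_def by (subst divide_less_eq_1_pos) linarith+
  have out: "cut k < cmod (blaschke (x k) z)" if "z \<in> ball 0 1 - bubbles x r" for k z
  proof -
    have "z \<notin> cball (x k) (r k)" using that by (auto simp: bubbles_def)
    then have "r k < cmod (z - x k)" by (simp add: dist_norm norm_minus_commute)
    then show ?thesis
      unfolding cut_def delta_def using that by (intro cmod_blaschke_gt[OF norm_x _ r_pos]) auto
  qed
  fix z :: complex assume z: "z \<in> ball 0 1"
  show "\<exists>v. majorant (ball 0 1 - bubbles x r) v \<and> v z \<le> 1 - c"
  proof (cases "z \<in> bubbles x r")
    case True
    then obtain k where k: "z \<in> cball (x k) (r k)" by (auto simp: bubbles_def)
    have "majorant (ball 0 1 - bubbles x r) (\<lambda>z. 1 - (\<Sum>k\<in>{k}. tgreen (x k) (cut k) z) / 1)"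
      by (rule majorant_green_sum) (use norm_x cut out tgreen_le_1[OF cut] in auto)
    moreover have "c \<le> 1 / cut_const"
      unfolding c_def using prod cut_const_ge by (intro divide_left_mono mult_pos_pos) auto
    then have "1 - (\<Sum>k\<in>{k}. tgreen (x k) (cut k) z) / 1 \<le> 1 - c"
      using tgreen_bubble_ge[OF k] by simp
    ultimately show ?thesis by blast
  next
    case False
    then obtain K n0 where K: "finite K" "\<And>k. k \<in> K \<Longrightarrow> \<exists>t. 0 \<le> t \<and> t < 2 * pi \<and> chosen n0 k t"
      "1 / (344064 * cut_const) \<le> (\<Sum>k\<in>K. tgreen (x k) (cut k) z)"
      using green_sum_ge[OF near_sum_infinite[OF div], of z] z by blast
    have "majorant (ball 0 1 - bubbles x r) (\<lambda>z. 1 - (\<Sum>k\<in>K. tgreen (x k) (cut k) z) / green_const)"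
    proof (rule majorant_green_sum)
      show "(\<Sum>k\<in>K. tgreen (x k) (cut k) z) \<le> green_const" if "z \<in> ball 0 1" for z
        by (rule green_sum_le[OF K(1) K(2) that])
    qed (use norm_x cut out K(1) green_const_ge in auto)
    moreover have "c \<le> (\<Sum>k\<in>K. tgreen (x k) (cut k) z) / green_const"
    proof -
      have "1 / (344064 * cut_const) / green_const \<le> (\<Sum>k\<in>K. tgreen (x k) (cut k) z) / green_const"
        using K(3) green_const_ge by (intro divide_right_mono) auto
      then show ?thesis by (simp add: c_def mult_ac)
    qed
    ultimately show ?thesis by (intro exI conjI) auto
  qed
qed

end

section \<open>Transfer from angles to the circle and conclusion\<close>

lemma AE_circle_measure_iff:
  assumes [measurable]: "Measurable.pred borel P"
  shows "(AE y in circle_measure. P y) \<longleftrightarrow> (AE t in angle_measure. P (cis t))"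
  unfolding circle_measure_eq by (subst AE_distr_iff) auto

theorem theorem1p1:
  fixes x :: "nat \<Rightarrow> complex" and r :: "nat \<Rightarrow> real"
  assumes "champagne x r"
  shows
    "(unavoidable (bubbles x r) \<longrightarrow>
        (AE y in circle_measure.
           (\<Sum>k. ennreal ((1 - cmod (x k))\<^sup>2 / (cmod (y - x k))\<^sup>2 *
                          inverse (ln ((1 - cmod (x k)) / r k)))) = \<infinity>) \<and>
        (AE y in circle_measure.
           (\<Sum>k. ennreal ((1 - cmod (x k))\<^sup>2 / (cmod (y - x k))\<^sup>2)) = \<infinity>)) \<and>
     ((AE y in circle_measure.
           (\<Sum>k. ennreal ((1 - cmod (x k))\<^sup>2 / (cmod (y - x k))\<^sup>2 *
                          inverse (ln ((1 - cmod (x k)) / r k)))) = \<infinity>) \<and>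
      0 < (INF (j, k)\<in>{(j, k). j \<noteq> k}.
             ereal (cmod (x k - x j) * sqrt (ln ((1 - cmod (x k)) / r k)) / (1 - cmod (x k))))
      \<longrightarrow> unavoidable (bubbles x r))"
proof -
  note ch = assms
  define S where "S y = (\<Sum>k. ennreal (bubble_term x r k y))" for y
  define T where "T y = (\<Sum>k. ennreal ((1 - cmod (x k))\<^sup>2 / (cmod (y - x k))\<^sup>2))" for y
  have S_eq: "(\<Sum>k. ennreal ((1 - cmod (x k))\<^sup>2 / (cmod (y - x k))\<^sup>2 * inverse (ln ((1 - cmod (x k)) / r k)))) = S y" for y
    by (simp add: S_def bubble_term_def)
  have [measurable]: "S \<in> borel_measurable borel" unfolding S_def by measurable
  have AE_S: "(AE y in circle_measure. S y = \<infinity>) \<longleftrightarrow> (AE t in angle_measure. (\<Sum>k. ennreal (bubble_term x r k (cis t))) = \<infinity>)"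
    by (subst AE_circle_measure_iff) (auto simp: S_def)
  obtain c where c: "0 < c" "c < 1" "\<And>k. r k \<le> c * (1 - cmod (x k))"
    using champagne_ratio[OF ch] by blast
  define L where "L = - ln c"
  have L: "0 < L" using c by (simp add: L_def)
  have Lk: "L \<le> ln ((1 - cmod (x k)) / r k)" for k
  proof -
    have "1 / c \<le> (1 - cmod (x k)) / r k"
      using c(3)[of k] c(1) champagne_bubble[OF ch, of k] by (simp add: field_simps)
    then have "ln (1 / c) \<le> ln ((1 - cmod (x k)) / r k)" using c(1) by (intro ln_mono) auto
    then show ?thesis using c(1) by (simp add: L_def ln_div)
  qed
  \<comment> \<open>The logarithms are at least \<open>L\<close>, so the weighted series is at most
    the unweighted one divided by \<open>L\<close>.\<close>
  have T_inf: "T y = \<infinity>" if "S y = \<infinity>" for y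
  proof -
    have "S y \<le> (\<Sum>k. ennreal (inverse L) * ennreal ((1 - cmod (x k))\<^sup>2 / (cmod (y - x k))\<^sup>2))"
      unfolding S_def
    proof (rule suminf_le)
      fix k
      have "inverse (ln ((1 - cmod (x k)) / r k)) \<le> inverse L" using L Lk by (intro le_imp_inverse_le) auto
      then have "bubble_term x r k y \<le> (1 - cmod (x k))\<^sup>2 / (cmod (y - x k))\<^sup>2 * inverse L"
        unfolding bubble_term_def by (intro mult_left_mono) auto
      then show "ennreal (bubble_term x r k y) \<le> ennreal (inverse L) * ennreal ((1 - cmod (x k))\<^sup>2 / (cmod (y - x k))\<^sup>2)"
        using L by (subst ennreal_mult'[symmetric]) (auto intro!: ennreal_leI simp: mult.commute)
    qed simp_all
    also have "\<dots> = ennreal (inverse L) * T y" unfolding T_def by (simp add: ennreal_suminf_cmult)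
    finally show ?thesis using that by (auto simp: ennreal_mult_eq_top_iff top_unique)
  qed
  have "unavoidable (bubbles x r)"
    if AE: "AE y in circle_measure. S y = \<infinity>"
      and sep: "0 < (INF (j, k)\<in>{(j, k). j \<noteq> k}.
             ereal (cmod (x k - x j) * sqrt (ln ((1 - cmod (x k)) / r k)) / (1 - cmod (x k))))"
  proof -
    obtain b where b: "0 < ereal b"
      "ereal b < (INF (j, k)\<in>{(j, k). j \<noteq> k}. ereal (cmod (x k - x j) * sqrt (ln ((1 - cmod (x k)) / r k)) / (1 - cmod (x k))))"
      using ereal_dense2[OF sep] by blast
    have bjk: "b * (1 - cmod (x k)) \<le> cmod (x k - x j) * sqrt (ln ((1 - cmod (x k)) / r k))" if "j \<noteq> k" for j k
    proof -
      have "ereal b < ereal (cmod (x k - x j) * sqrt (ln ((1 - cmod (x k)) / r k)) / (1 - cmod (x k)))"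
        by (rule less_le_trans[OF b(2)], rule INF_lower2[of "(j, k)"]) (use that in auto)
      then show ?thesis using champagne_bubble[OF ch, of k] by (simp add: less_divide_eq)
    qed
    \<comment> \<open>The half of \<open>b\<close> accounts for the factor 2 in the locale; the
      second entry is the locale's upper bound for \<open>a\<close>.\<close>
    define a where "a = min (b / 2) (sqrt L / 2)"
    interpret separated_champagne x r L a
    proof
      show "0 < a" using b(1) L by (simp add: a_def)
      show "a \<le> sqrt L / 2" by (simp add: a_def)
      show "2 * a * (1 - cmod (x k)) \<le> cmod (x k - x j) * sqrt (ln ((1 - cmod (x k)) / r k))" if "j \<noteq> k" for j k
      proof -
        have "2 * a * (1 - cmod (x k)) \<le> b * (1 - cmod (x k))"
          using champagne_bubble[OF ch, of k] by (intro mult_right_mono) (auto simp: a_def)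
        then show ?thesis using bjk[OF that] by linarith
      qed
    qed (rule ch L Lk)+
    show ?thesis using unavoidable_bubbles AE AE_S by simp
  qed
  moreover have "(AE y in circle_measure. S y = \<infinity>) \<and> (AE y in circle_measure. T y = \<infinity>)"
    if "unavoidable (bubbles x r)"
  proof -
    have "AE y in circle_measure. S y = \<infinity>"
      using unavoidable_imp_divergent[OF ch that] AE_S by simp
    moreover from this have "AE y in circle_measure. T y = \<infinity>"
      by (rule eventually_mono) (rule T_inf)
    ultimately show ?thesis by simp
  qed
  ultimately show ?thesis unfolding S_eq T_def by blast
qed


end
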